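(* Let $X_t$ be a symmetric Lévy process in $\mathbb{R}^d$, $d\ge 1$, satisfying the standing assumptions (stated in the context), with Lévy measure $\nu$. Let $D\subset\mathbb{R}^d$ be a bounded and connected Lipschitz domain (in the sense given in the context). Suppose that for every $r>0$ and every $\gamma\in(0,\pi)$ there exists $\rho>0$ such that $$\inf_{|y|=\rho;\ \Gamma_\gamma(y)}\nu\big(\Gamma_\gamma(y)\cap B(0,r)\big)>0,$$ where the infimum is taken over all $y\in\mathbb{R}^d$ with $|y|=\rho$ and over all right circular cones $\Gamma_\gamma(y)$ of angle $\gamma$ with vertex at $y$ (of arbitrary direction). Then the semigroup $\{P^D_t\}_{t>0}$ of the process $X_t$ killed on exiting $D$ is intrinsically ultracontractive, i.e. for every $t>0$ there exists a constant $c_t$ such that $$p_D(t,x,y)\le c_t\,\varphi_0(x)\varphi_0(y),\qquad x,y\in D.$$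
   Context: Standing assumptions on the process: $X_t$ is a symmetric Lévy process in $\mathbb{R}^d$ with nonzero Lévy measure $\nu$ (and arbitrary, possibly zero, Gaussian part). It has transition densities $p(t,x,y)=p(t,x-y)$, $t>0$, $x,y\in\mathbb{R}^d$, where $p(t,\cdot)$ is continuous on $\mathbb{R}^d$ for every $t>0$; moreover for every $\delta>0$ there is a constant $c=c(\delta)$ such that $p(t,x)\le c$ for all $t>0$ and $|x|\ge\delta$. Lipschitz domain: $D$ is a nonempty bounded connected open set for which there exist $\gamma_0>0$, $R_0>0$ and the cone $\Gamma_{\gamma_0}=\{(y,x): 0<x,\ y\in\mathbb{R}^{d-1},\ \gamma_0|y|<x\}$ such that for every $Q\in\partial D$ there is a cone $\Gamma_{\gamma_0}(Q)$ with vertex $Q$, isometric with $\Gamma_{\gamma_0}$, satisfying $\Gamma_{\gamma_0}(Q)\cap B(Q,R_0)\subset D$. Killed process: $B(x,r)$ is the ball of center $x$ and radius $r$; $P^x,E^x$ refer to the process started at $x$; $\tau_D=\inf\{t>0: X_t\notin D\}$. The transition density of the process killed on exiting $D$ is $$p_D(t,x,y)=p(t,x,y)-E^x[t>\tau_D;\,p(t-\tau_D,X_{\tau_D},y)],$$ taken in its version that is continuous and symmetric in $(x,y)\in D\times D$ for each $t>0$. The semigroup is $P^D_tf(x)=\int_D p_D(t,x,y)f(y)\,dy$; on $L^2(D)$ it is a strongly continuous semigroup of self-adjoint compact contractions. There is an orthonormal basis of $L^2(D)$ of real-valued continuous eigenfunctions $\{\varphi_n\}_{n\ge0}$ with $P^D_t\varphi_n=e^{-\lambda_n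 t}\varphi_n$, $0<\lambda_0<\lambda_1\le\lambda_2\le\dots$; $\varphi_0$ denotes the eigenfunction for $\lambda_0$, chosen strictly positive on $D$. *)

theory Defs
  imports "HOL-Probability.Probability"
begin

text \<open>
  Only times \<open>t \<ge> 0\<close> are relevant. The process starts at the origin; the process started at
  \<open>x\<close> is \<open>\<lambda>t \<omega>. x + X t \<omega>\<close>, so that expectations under \<open>P\<close> at \<open>x\<close> are
  expectations over \<open>M\<close> of functionals of that shifted process.
\<close>

definition cadlag :: "(real \<Rightarrow> 'a::topological_space) \<Rightarrow> bool" where
  "cadlag w \<longleftrightarrow>
     (\<forall>t\<ge>0. (w \<longlongrightarrow> w t) (at_right t)) \<and>
     (\<forall>t>0. \<exists>l. (w \<longlongrightarrow> l) (at_left t))"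

locale levy_process = prob_space M
  for M :: "'w measure" and X :: "real \<Rightarrow> 'w \<Rightarrow> 'a::euclidean_space" +
  assumes measurable: "t \<ge> 0 \<Longrightarrow> X t \<in> borel_measurable M"
    and start: "AE \<omega> in M. X 0 \<omega> = 0"
    and independent_increments:
      "\<lbrakk>0 \<le> u 0; \<And>i. i < n \<Longrightarrow> u i < u (Suc i)\<rbrakk> \<Longrightarrow>
         indep_vars (\<lambda>_. borel) (\<lambda>i \<omega>. X (u (Suc i)) \<omega> - X (u i) \<omega>) {..<(n::nat)}"
    and stationary_increments:
      "\<lbrakk>0 \<le> s; 0 \<le> t\<rbrakk> \<Longrightarrow>
         distr M borel (\<lambda>\<omega>. X (s + t) \<omega> - X s \<omega>) = distr M borel (X t)"
    and cadlag_paths: "AE \<omega> in M. cadlag (\<lambda>t. X t \<omega>)"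

locale symmetric_levy_process = levy_process +
  assumes symmetric: "t \<ge> 0 \<Longrightarrow> distr M borel (\<lambda>\<omega>. - X t \<omega>) = distr M borel (X t)"

text \<open>
  The Levy measure is identified by the Levy-Khintchine formula with drift \<open>b\<close>, Gaussian
  covariance \<open>A\<close> and truncation function the indicator of the closed unit ball.
\<close>

definition levy_exponent ::
    "'a::euclidean_space \<Rightarrow> ('a \<Rightarrow> 'a) \<Rightarrow> 'a measure \<Rightarrow> 'a \<Rightarrow> complex" where
  "levy_exponent b A \<nu> \<xi> =
     \<i> * complex_of_real (b \<bullet> \<xi>) - complex_of_real (A \<xi> \<bullet> \<xi>) / 2 +
     (CLINT z|\<nu>. iexp (\<xi> \<bullet> z) - 1 - \<i> * complex_of_real (indicator (cball 0 1) z * (\<xi> \<bullet> z)))"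

definition is_levy_measure_of ::
    "'a::euclidean_space measure \<Rightarrow> 'w measure \<Rightarrow> (real \<Rightarrow> 'w \<Rightarrow> 'a) \<Rightarrow> bool" where
  "is_levy_measure_of \<nu> M X \<longleftrightarrow>
     sets \<nu> = sets borel \<and> emeasure \<nu> {0} = 0 \<and>
     (\<integral>\<^sup>+z. ennreal (min 1 ((norm z)\<^sup>2)) \<partial>\<nu>) < \<infinity> \<and>
     (\<exists>b A. linear A \<and> (\<forall>\<xi> \<eta>. A \<xi> \<bullet> \<eta> = \<xi> \<bullet> A \<eta>) \<and> (\<forall>\<xi>. 0 \<le> A \<xi> \<bullet> \<xi>) \<and>
        (\<forall>t\<ge>0. \<forall>\<xi>. (CLINT \<omega>|M. iexp (\<xi> \<bullet> X t \<omega>)) =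
            exp (complex_of_real t * levy_exponent b A \<nu> \<xi>)))"

definition continuous_transition_density ::
    "'w measure \<Rightarrow> (real \<Rightarrow> 'w \<Rightarrow> 'a::euclidean_space) \<Rightarrow> (real \<Rightarrow> 'a \<Rightarrow> real) \<Rightarrow> bool" where
  "continuous_transition_density M X p \<longleftrightarrow>
     (\<forall>t>0. (\<forall>z. 0 \<le> p t z) \<and> continuous_on UNIV (p t) \<and>
        distributed M lborel (X t) (\<lambda>z. ennreal (p t z)))"

text \<open>
  The cone with vertex \<open>Q\<close> and axis in the direction of the unit vector \<open>e\<close> that is isometric
  with the set of all \<open>(y, x)\<close> with \<open>0 < x\<close> and \<open>g * norm y < x\<close>: the coordinate along the
  axis is \<open>(z - Q) \<bullet> e\<close>, and the transversal part of \<open>z - Q\<close> is its projection orthogonal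
  to \<open>e\<close>.
\<close>

definition lipschitz_cone :: "real \<Rightarrow> 'a::euclidean_space \<Rightarrow> 'a \<Rightarrow> 'a set" where
  "lipschitz_cone g Q e =
     {z. 0 < (z - Q) \<bullet> e \<and> g * norm ((z - Q) - ((z - Q) \<bullet> e) *\<^sub>R e) < (z - Q) \<bullet> e}"

definition lipschitz_domain :: "'a::euclidean_space set \<Rightarrow> bool" where
  "lipschitz_domain D \<longleftrightarrow>
     D \<noteq> {} \<and> bounded D \<and> connected D \<and> open D \<and>
     (\<exists>g>0. \<exists>R>0. \<forall>Q\<in>frontier D. \<exists>e. norm e = 1 \<and> lipschitz_cone g Q e \<inter> ball Q R \<subseteq> D)"

text \<open>
  Here \<open>\<gamma> \<in> {0<..<pi}\<close> is the opening angle, so a generating ray makes the angle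
  \<open>\<gamma> / 2\<close> with the axis, whose direction is the unit vector \<open>e\<close>.
\<close>

definition circular_cone :: "real \<Rightarrow> 'a::euclidean_space \<Rightarrow> 'a \<Rightarrow> 'a set" where
  "circular_cone \<gamma> y e = {z. norm (z - y) * cos (\<gamma> / 2) < (z - y) \<bullet> e}"

text \<open>Extended real valued, so that the infimum over the empty set is \<open>\<infinity>\<close>.\<close>

definition exit_time :: "'a set \<Rightarrow> (real \<Rightarrow> 'a) \<Rightarrow> ereal" where
  "exit_time D w = (INF t\<in>{t. 0 < t \<and> w t \<notin> D}. ereal t)"

text \<open>
  The expectation is taken over the completed probability space, because the exit time of a
  cadlag process from an open set need not be measurable before completion.
\<close>

definition killed_density ::
    "'w measure \<Rightarrow> (real \<Rightarrow> 'w \<Rightarrow> 'a::euclidean_space) \<Rightarrow> (real \<Rightarrow> 'a \<Rightarrow> real) \<Rightarrow>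
      'a set \<Rightarrow> real \<Rightarrow> 'a \<Rightarrow> 'a \<Rightarrow> real" where
  "killed_density M X p D t x y =
     p t (x - y) -
     (LINT \<omega>|completion M.
        (let \<tau> = exit_time D (\<lambda>s. x + X s \<omega>); u = real_of_ereal \<tau>
         in if \<tau> < ereal t then p (t - u) (x + X u \<omega> - y) else 0))"

definition regular_killed_density ::
    "'w measure \<Rightarrow> (real \<Rightarrow> 'w \<Rightarrow> 'a::euclidean_space) \<Rightarrow> (real \<Rightarrow> 'a \<Rightarrow> real) \<Rightarrow>
      'a set \<Rightarrow> (real \<Rightarrow> 'a \<Rightarrow> 'a \<Rightarrow> real) \<Rightarrow> bool" where
  "regular_killed_density M X p D pD \<longleftrightarrow>
     (\<forall>t>0.
        (\<forall>x\<in>D. AE y in lborel. y \<in> D \<longrightarrow> pD t x y = killed_density M X p D t x y) \<and>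
        continuous_on (D \<times> D) (\<lambda>(x, y). pD t x y) \<and>
        (\<forall>x\<in>D. \<forall>y\<in>D. pD t x y = pD t y x))"

definition killed_semigroup ::
    "'a::euclidean_space set \<Rightarrow> (real \<Rightarrow> 'a \<Rightarrow> 'a \<Rightarrow> real) \<Rightarrow> real \<Rightarrow> ('a \<Rightarrow> real) \<Rightarrow> 'a \<Rightarrow> real" where
  "killed_semigroup D pD t f x = (LINT y:D|lborel. pD t x y * f y)"

definition square_integrable_on :: "('a::euclidean_space \<Rightarrow> real) \<Rightarrow> 'a set \<Rightarrow> bool" where
  "square_integrable_on f D \<longleftrightarrow>
     set_borel_measurable lborel D f \<and> set_integrable lborel D (\<lambda>x. (f x)\<^sup>2)"

definition L2_orthonormal_basis :: "'a::euclidean_space set \<Rightarrow> (nat \<Rightarrow> 'a \<Rightarrow> real) \<Rightarrow> bool" where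
  "L2_orthonormal_basis D \<phi> \<longleftrightarrow>
     (\<forall>n. square_integrable_on (\<phi> n) D) \<and>
     (\<forall>m n. (LINT x:D|lborel. \<phi> m x * \<phi> n x) = (if m = n then 1 else 0)) \<and>
     (\<forall>f. square_integrable_on f D \<longrightarrow>
        (\<lambda>N. LINT x:D|lborel. (f x - (\<Sum>n<N. (LINT y:D|lborel. f y * \<phi> n y) * \<phi> n x))\<^sup>2)
          \<longlonglongrightarrow> 0)"

definition killed_eigenbasis ::
    "'a::euclidean_space set \<Rightarrow> (real \<Rightarrow> 'a \<Rightarrow> 'a \<Rightarrow> real) \<Rightarrow>
      (nat \<Rightarrow> 'a \<Rightarrow> real) \<Rightarrow> (nat \<Rightarrow> real) \<Rightarrow> bool" where
  "killed_eigenbasis D pD \<phi> eig \<longleftrightarrow>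
     L2_orthonormal_basis D \<phi> \<and>
     (\<forall>n. continuous_on D (\<phi> n)) \<and>
     (\<forall>t>0. \<forall>n. \<forall>x\<in>D. killed_semigroup D pD t (\<phi> n) x = exp (- eig n * t) * \<phi> n x) \<and>
     0 < eig 0 \<and> eig 0 < eig 1 \<and> (\<forall>n\<ge>1. eig n \<le> eig (Suc n)) \<and>
     (\<forall>x\<in>D. 0 < \<phi> 0 x)"

end

theory Submission
  imports Defs
begin

text \<open>
  The process started at \<open>x\<close> is still in \<open>D\<close> at time \<open>t\<close> with probability at most
  \<open>A * \<phi> 0 x\<close>, where \<open>A\<close> depends on \<open>t\<close> only. This estimate, \<open>alive_probability_bound\<close>, is the
  heart of the matter. Once it is known, the Chapman-Kolmogorov equation splits \<open>pD t\<close> into three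
  factors over time \<open>t / 3\<close>: the middle one is bounded, and the mass of each outer one is at most a
  survival probability (\<open>intrinsic_bound_of_mass_bound\<close>). The Chapman-Kolmogorov equation itself is
  read off from the eigenfunctions, because both sides have the same Fourier coefficients.

  The survival estimate is a Dynkin argument. From every point of \<open>D\<close> close to the boundary, the
  process jumps into a fixed compact part of \<open>D\<close> at a rate bounded below: an interior cone of the
  domain contains a circular cone whose vertex has exactly the distance \<open>\<rho>\<close> from the given point, and
  the hypothesis bounds the Levy measure of this cone from below (\<open>lipschitz_jump_target\<close>). Let \<open>\<psi>\<close>
  be a bump with values in \<open>[0, 1]\<close> that equals \<open>1\<close> on that compact part and vanishes near and beyond
  the boundary. Its generator is at least some \<open>c > 0\<close> on the boundary layer and bounded below by some
  \<open>- C\<close> on the remaining compact set \<open>K'\<close>. Integrating the generator along the path up to the exit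
  time bounds \<open>c\<close> times the time spent in \<open>D\<close> before \<open>t\<close>, in mean, by probabilities of being in \<open>K'\<close> at
  times before the exit (\<open>dynkin_inequality\<close>). Those are bounded by multiples of \<open>\<phi> 0 x\<close>, since
  \<open>\<phi> 0\<close> is bounded below on \<open>K'\<close> and is an eigenfunction of the positive semigroup
  (\<open>interior_probability_bound\<close>). As the survival probability decreases in time, the mean time spent
  in \<open>D\<close> before \<open>t\<close> is at least \<open>t\<close> times the survival probability at \<open>t\<close>.

  The generator never appears itself, only difference quotients over a small time step \<open>h\<close>. Two facts
  about small times are enough. The truncated second moment of \<open>X h\<close> is \<open>O(h)\<close>
  (\<open>truncated_second_moment\<close>), which bounds the quotient from below for a semiconvex bump; and
  \<open>liminf P(X h \<in> U) / h\<close> is at least \<open>\<nu> U\<close> for open \<open>U\<close> without the origin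
  (\<open>small_time_lower_bound\<close>). The second fact comes from characteristic functions: a second order
  difference of the Levy-Khintchine exponent removes drift and Gaussian part and leaves the Fourier
  transform of a finite measure equivalent to \<open>\<nu>\<close>; trigonometric polynomials on a large torus then
  determine the limit by the Stone-Weierstrass theorem.

  The rest of the work links \<open>pD\<close> to the path of the process. The exit time is replaced by the first
  time at which the path or its left limit touches the complement of \<open>D\<close>. That time is an optional
  time approximated from below by times of approach, so quasi-left-continuity shows that it agrees
  with the exit time almost surely (\<open>quasi_left_continuity\<close>, \<open>AE_exit_time_eq\<close>). By the strong
  Markov property, the expression defining the killed density is then the limit of mollifications of
  the law of \<open>X t\<close> on the event of survival (\<open>killed_mollified_tendsto\<close>), which gives positivity of
  \<open>pD\<close>, the bound of its mass by the survival probability, and its action on continuous functions.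
\<close>

section \<open>Small-time moments and tails\<close>

text \<open>
  The version of the process with which the proof works: all paths, not just almost all, are cadlag
  and start at the origin, which keeps null sets out of every pathwise argument. Symmetry makes the
  characteristic exponent real, so the law of \<open>X t\<close> is recorded by \<open>\<eta>\<close> alone.
\<close>

locale cadlag_symmetric_levy = prob_space M
  for M :: "'w measure" +
  fixes X :: "real \<Rightarrow> 'w \<Rightarrow> 'a::euclidean_space" and \<eta> :: "'a \<Rightarrow> real"
  assumes measurable_X: "t \<ge> 0 \<Longrightarrow> X t \<in> borel_measurable M"
    and X_zero: "X 0 \<omega> = 0"
    and cadlag_X: "cadlag (\<lambda>t. X t \<omega>)"
    and independent_increments:
      "\<lbrakk>0 \<le> u 0; \<And>i. i < n \<Longrightarrow> u i < u (Suc i)\<rbrakk> \<Longrightarrow>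
         indep_vars (\<lambda>_. borel) (\<lambda>i \<omega>. X (u (Suc i)) \<omega> - X (u i) \<omega>) {..<(n::nat)}"
    and stationary_increments:
      "\<lbrakk>0 \<le> s; 0 \<le> t\<rbrakk> \<Longrightarrow>
         distr M borel (\<lambda>\<omega>. X (s + t) \<omega> - X s \<omega>) = distr M borel (X t)"
    and symmetric_X: "t \<ge> 0 \<Longrightarrow> distr M borel (\<lambda>\<omega>. - X t \<omega>) = distr M borel (X t)"
    and eta_nonneg: "0 \<le> \<eta> \<xi>"
    and expectation_cos: "t \<ge> 0 \<Longrightarrow> expectation (\<lambda>\<omega>. cos (\<xi> \<bullet> X t \<omega>)) = exp (- t * \<eta> \<xi>)"
begin

lemma integrable_bounded:
  fixes f :: "'w \<Rightarrow> real"
  assumes "f \<in> borel_measurable M" "\<And>\<omega>. \<omega> \<in> space M \<Longrightarrow> \<bar>f \<omega>\<bar> \<le> B"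
  shows "integrable M f"
  using assms by (intro integrable_const_bound[of _ B]) auto

lemma expectation_reflect:
  fixes f :: "'a \<Rightarrow> real"
  assumes "t \<ge> 0" and [measurable]: "f \<in> borel_measurable borel"
  shows "expectation (\<lambda>\<omega>. f (- X t \<omega>)) = expectation (\<lambda>\<omega>. f (X t \<omega>))"
proof -
  note measurable_X[OF assms(1), measurable]
  have "expectation (\<lambda>\<omega>. f (- X t \<omega>)) = integral\<^sup>L (distr M borel (\<lambda>\<omega>. - X t \<omega>)) f"
    by (subst integral_distr) auto
  also have "\<dots> = expectation (\<lambda>\<omega>. f (X t \<omega>))"
    unfolding symmetric_X[OF assms(1)] by (subst integral_distr) auto
  finally show ?thesis .
qed

lemma expectation_sin:
  assumes "t \<ge> 0"
  shows "expectation (\<lambda>\<omega>. sin (\<xi> \<bullet> X t \<omega>)) = 0"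
  using expectation_reflect[OF assms, of "\<lambda>z. sin (\<xi> \<bullet> z)"] by simp

text \<open>
  The exponent is minus the logarithm of the characteristic function at time 1, which is continuous by
  dominated convergence.
\<close>

lemma eta_tendsto_0: "((\<lambda>v. \<eta> (v *\<^sub>R \<xi>)) \<longlongrightarrow> 0) (at 0)"
  unfolding tendsto_at_iff_sequentially comp_def
proof (intro allI impI)
  fix v :: "nat \<Rightarrow> real" assume v: "v \<longlonglongrightarrow> 0"
  note measurable_X[of 1, simplified, measurable]
  have "(\<lambda>n. expectation (\<lambda>\<omega>. cos ((v n *\<^sub>R \<xi>) \<bullet> X 1 \<omega>))) \<longlonglongrightarrow> expectation (\<lambda>\<omega>. 1)"
  proof (rule integral_dominated_convergence[where w="\<lambda>_. 1"])
    show "AE \<omega> in M. (\<lambda>n. cos ((v n *\<^sub>R \<xi>) \<bullet> X 1 \<omega>)) \<longlonglongrightarrow> 1"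
      using v by (intro AE_I2) (auto intro!: tendsto_eq_intros)
  qed auto
  hence "(\<lambda>n. - ln (expectation (\<lambda>\<omega>. cos ((v n *\<^sub>R \<xi>) \<bullet> X 1 \<omega>)))) \<longlonglongrightarrow> - ln 1"
    by (intro tendsto_intros) (auto simp: prob_space)
  thus "(\<lambda>n. \<eta> (v n *\<^sub>R \<xi>)) \<longlonglongrightarrow> 0"
    by (simp add: expectation_cos[of 1, simplified] del: inner_scaleR_left)
qed

lemma one_minus_expectation_cos_le:
  assumes "t \<ge> 0"
  shows "expectation (\<lambda>\<omega>. 1 - cos (\<xi> \<bullet> X t \<omega>)) \<le> t * \<eta> \<xi>"
proof -
  note measurable_X[OF assms, measurable]
  have "expectation (\<lambda>\<omega>. 1 - cos (\<xi> \<bullet> X t \<omega>)) = 1 - exp (- t * \<eta> \<xi>)"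
    by (subst Bochner_Integration.integral_diff)
        (auto simp: prob_space expectation_cos[OF assms] intro!: integrable_bounded[of _ 1])
  also have "\<dots> \<le> t * \<eta> \<xi>"
    using exp_ge_add_one_self[of "- t * \<eta> \<xi>"] by simp
  finally show ?thesis .
qed

text \<open>
  Tail bound for a projection, linear in the time \<open>h\<close>: large values of \<open>\<xi> \<bullet> X h\<close> make the average of
  \<open>1 - cos (v * (\<xi> \<bullet> X h))\<close> over \<open>v\<close> in \<open>[0, u]\<close> large, while its expectation is at most \<open>h\<close> times the
  average of the exponent.
\<close>

lemma prob_projection_tail:
  assumes h: "h > 0" and u: "u > 0" and B: "\<And>v. 0 < v \<Longrightarrow> v \<le> u \<Longrightarrow> \<eta> (v *\<^sub>R \<xi>) \<le> B"
  shows "prob {\<omega> \<in> space M. 2 / u \<le> \<bar>\<xi> \<bullet> X h \<omega>\<bar>} \<le> 2 * B * h"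
proof -
  note measurable_X[of h, measurable]
  note less_imp_le[OF h, simp]
  interpret L: pair_sigma_finite lborel M ..
  have B0: "0 \<le> B" using B[of u] u eta_nonneg[of "u *\<^sub>R \<xi>"] by auto
  define F where "F v \<omega> = 1 - cos (v * (\<xi> \<bullet> X h \<omega>))" for v \<omega>
  have meas[measurable]: "(\<lambda>(v, \<omega>). F v \<omega>) \<in> borel_measurable (lborel \<Otimes>\<^sub>M M)"
    unfolding F_def by measurable
  have inner: "ennreal (u / 2) \<le> (\<integral>\<^sup>+v. ennreal (F v \<omega>) * indicator {0..u} v \<partial>lborel)"
    if "2 / u \<le> \<bar>\<xi> \<bullet> X h \<omega>\<bar>" for \<omega>
  proof -
    define z where "z = \<xi> \<bullet> X h \<omega>"
    have z: "2 / u \<le> \<bar>z\<bar>" "z \<noteq> 0" using that u by (auto simp: z_def)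
    have "(\<integral>\<^sup>+v. ennreal (F v \<omega>) * indicator {0..u} v \<partial>lborel)
        = ennreal ((u - sin (u * z) / z) - (0 - sin (0 * z) / z))"
      unfolding F_def z_def[symmetric]
    proof (rule nn_integral_FTC_Icc)
      show "DERIV (\<lambda>v. v - sin (v * z) / z) v :> 1 - cos (v * z)" for v
        using z by (auto intro!: derivative_eq_intros)
    qed (use u in auto)
    moreover have "sin (u * z) / z \<le> u / 2"
    proof -
      \<comment> \<open>Hence the average is at least one half once \<open>2 / u \<le> \<bar>z\<bar>\<close>.\<close>
      have "sin (u * z) / z \<le> 1 / \<bar>z\<bar>"
        by (metis abs_divide abs_ge_self abs_ge_zero abs_sin_le_one divide_right_mono order_trans)
      also have "\<dots> \<le> u / 2" using z u by (simp add: field_simps)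
      finally show ?thesis .
    qed
    ultimately show ?thesis by (simp add: ennreal_leI)
  qed
  have "ennreal (u / 2) * emeasure M {\<omega> \<in> space M. 2 / u \<le> \<bar>\<xi> \<bullet> X h \<omega>\<bar>}
      = (\<integral>\<^sup>+\<omega>. ennreal (u / 2) * indicator {\<omega> \<in> space M. 2 / u \<le> \<bar>\<xi> \<bullet> X h \<omega>\<bar>} \<omega> \<partial>M)"
    by (subst nn_integral_cmult_indicator) auto
  also have "\<dots> \<le> (\<integral>\<^sup>+\<omega>. (\<integral>\<^sup>+v. ennreal (F v \<omega>) * indicator {0..u} v \<partial>lborel) \<partial>M)"
    by (intro nn_integral_mono) (auto simp: inner split: split_indicator)
  also have "\<dots> = (\<integral>\<^sup>+v. (\<integral>\<^sup>+\<omega>. ennreal (F v \<omega>) * indicator {0..u} v \<partial>M) \<partial>lborel)"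
    by (rule L.Fubini') measurable
  also have "\<dots> \<le> (\<integral>\<^sup>+v. ennreal (h * B) * indicator {0..u} v \<partial>lborel)"
  proof (intro nn_integral_mono)
    fix v :: real
    show "(\<integral>\<^sup>+\<omega>. ennreal (F v \<omega>) * indicator {0..u} v \<partial>M) \<le> ennreal (h * B) * indicator {0..u} v"
    proof (cases "v \<in> {0..u}")
      case v: True
      have "(\<integral>\<^sup>+\<omega>. ennreal (F v \<omega>) \<partial>M) = ennreal (expectation (F v))"
        unfolding F_def by (intro nn_integral_eq_integral integrable_bounded[of _ 2])
            (auto simp: abs_le_iff intro: order_trans[OF cos_le_one])
      also have "expectation (F v) \<le> h * \<eta> (v *\<^sub>R \<xi>)"
        using one_minus_expectation_cos_le[of h "v *\<^sub>R \<xi>"] by (simp add: F_def[abs_def])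
      also have "\<dots> \<le> h * B"
      proof (cases "v = 0")
        case True
        have "\<eta> 0 = 0" using expectation_cos[of 1 0] by (simp add: prob_space)
        thus ?thesis using True B0 h by simp
      qed (use v B h in auto)
      finally show ?thesis using v by (simp add: ennreal_leI)
    qed auto
  qed
  also have "\<dots> = ennreal (h * B * u)"
    using u h B0 by (subst nn_integral_cmult_indicator) (auto simp: ennreal_mult)
  finally have "ennreal (u / 2 * prob {\<omega> \<in> space M. 2 / u \<le> \<bar>\<xi> \<bullet> X h \<omega>\<bar>}) \<le> ennreal (h * B * u)"
    using u by (subst ennreal_mult) (auto simp: emeasure_eq_measure)
  hence "u / 2 * prob {\<omega> \<in> space M. 2 / u \<le> \<bar>\<xi> \<bullet> X h \<omega>\<bar>} \<le> h * B * u"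
    using u h B0 by (subst (asm) ennreal_le_iff) auto
  thus ?thesis using u by (simp add: field_simps)
qed

text \<open>
  The constant is not optimal; it comes from \<open>y / 2 \<le> sin y\<close> on \<open>[0, 1]\<close>.
\<close>

lemma quadratic_le_one_minus_cos:
  fixes x :: real
  assumes "\<bar>x\<bar> \<le> 2"
  shows "x\<^sup>2 \<le> 8 * (1 - cos x)"
proof -
  define y where "y = \<bar>x\<bar> / 2"
  have y: "0 \<le> y" "y \<le> 1" using assms by (auto simp: y_def)
  have "sin 0 - 0 / 2 \<le> sin y - y / 2"
  proof (rule DERIV_nonneg_imp_nondecreasing[OF y(1)])
    fix v assume v: "0 \<le> v" "v \<le> y"
    have "cos (pi / 3) \<le> cos v"
      using v y pi_gt3 by (intro cos_monotone_0_pi_le) auto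
    hence "0 \<le> cos v - 1 / 2" by (simp add: cos_60)
    moreover have "DERIV (\<lambda>v. sin v - v / 2) v :> cos v - 1 / 2"
      by (auto intro!: derivative_eq_intros)
    ultimately show "\<exists>d. DERIV (\<lambda>v. sin v - v / 2) v :> d \<and> 0 \<le> d" by blast
  qed
  hence "(y / 2)\<^sup>2 \<le> (sin y)\<^sup>2" using y by (intro power_mono) auto
  moreover have "cos x = 1 - 2 * (sin y)\<^sup>2"
    using cos_double_sin[of y] by (simp add: y_def)
  ultimately show ?thesis by (simp add: y_def power_divide)
qed

lemma eta_bound_near_0:
  assumes "B > 0"
  obtains u where "u > 0" "\<And>v b. 0 < v \<Longrightarrow> v \<le> u \<Longrightarrow> b \<in> Basis \<Longrightarrow> \<eta> (v *\<^sub>R b) \<le> B"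
proof -
  have "\<forall>\<^sub>F v in at_right 0. \<forall>b\<in>Basis. \<eta> (v *\<^sub>R b) < B"
  proof (intro eventually_ball_finite ballI)
    fix b :: 'a
    have "((\<lambda>v. \<eta> (v *\<^sub>R b)) \<longlongrightarrow> 0) (at_right 0)"
      using eta_tendsto_0[of b] by (rule filterlim_mono) (auto simp: at_within_le_at at_le)
    thus "\<forall>\<^sub>F v in at_right 0. \<eta> (v *\<^sub>R b) < B"
      using assms by (rule order_tendstoD)
  qed auto
  then obtain d where d: "d > 0" "\<And>v b. 0 < v \<Longrightarrow> v < d \<Longrightarrow> b \<in> Basis \<Longrightarrow> \<eta> (v *\<^sub>R b) < B"
    unfolding eventually_at_right_field by auto
  show thesis
  proof (rule that[of "d / 2"])
    show "\<eta> (v *\<^sub>R b) \<le> B" if "0 < v" "v \<le> d / 2" "b \<in> Basis" for v b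
      using d(2)[of v b] that d(1) by fastforce
  qed (use d in auto)
qed

text \<open>
  The rate of leaving a box of size \<open>r\<close> tends to zero as \<open>r\<close> grows, uniformly in the time: the exponent
  vanishes at the origin, and \<open>prob_projection_tail\<close> reads the tail off its values near the origin.
\<close>

lemma prob_coordinate_tail:
  assumes "\<delta> > 0"
  obtains R where "R > 0"
    "\<And>r h. R \<le> r \<Longrightarrow> h > 0 \<Longrightarrow> prob {\<omega> \<in> space M. \<exists>b\<in>Basis. r \<le> \<bar>b \<bullet> X h \<omega>\<bar>} \<le> \<delta> * h"
proof -
  define B where "B = \<delta> / (2 * DIM('a))"
  have B: "B > 0" using assms by (simp add: B_def)
  obtain u where u: "u > 0" "\<And>v b. 0 < v \<Longrightarrow> v \<le> u \<Longrightarrow> b \<in> Basis \<Longrightarrow> \<eta> (v *\<^sub>R b) \<le> B"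
    using eta_bound_near_0[OF B] by blast
  show thesis
  proof (rule that[of "2 / u"])
    fix r h :: real assume r: "2 / u \<le> r" and h: "h > 0"
    note measurable_X[of h, measurable]
    note less_imp_le[OF h, simp]
    have "prob {\<omega> \<in> space M. \<exists>b\<in>Basis. r \<le> \<bar>b \<bullet> X h \<omega>\<bar>}
        \<le> prob (\<Union>b\<in>Basis. {\<omega> \<in> space M. 2 / u \<le> \<bar>b \<bullet> X h \<omega>\<bar>})"
      using r by (intro finite_measure_mono) auto
    also have "\<dots> \<le> (\<Sum>b\<in>Basis. prob {\<omega> \<in> space M. 2 / u \<le> \<bar>b \<bullet> X h \<omega>\<bar>})"
      by (intro finite_measure_subadditive_finite) auto
    also have "\<dots> \<le> (\<Sum>b\<in>(Basis::'a set). 2 * B * h)"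
      by (intro sum_mono prob_projection_tail[OF h u(1)] u)
    also have "\<dots> = \<delta> * h" by (simp add: B_def)
    finally show "prob {\<omega> \<in> space M. \<exists>b\<in>Basis. r \<le> \<bar>b \<bullet> X h \<omega>\<bar>} \<le> \<delta> * h" .
  qed (use u in auto)
qed

text \<open>
  For each coordinate the truncated square is dominated by a tail indicator and a multiple of
  \<open>1 - cos\<close>, and both have expectation \<open>O(h)\<close>.
\<close>

lemma truncated_second_moment:
  obtains C where "C \<ge> 0" "\<And>h. h > 0 \<Longrightarrow> expectation (\<lambda>\<omega>. min 1 ((norm (X h \<omega>))\<^sup>2)) \<le> C * h"
proof -
  obtain u where u: "u > 0" "\<And>v b. 0 < v \<Longrightarrow> v \<le> u \<Longrightarrow> b \<in> Basis \<Longrightarrow> \<eta> (v *\<^sub>R b) \<le> 1"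
    using eta_bound_near_0[of 1] by auto
  define c where "c = 2 + 8 / u\<^sup>2"
  have "expectation (\<lambda>\<omega>. min 1 ((norm (X h \<omega>))\<^sup>2)) \<le> DIM('a) * c * h" if h: "h > 0" for h
  proof -
    note measurable_X[of h, measurable]
    note less_imp_le[OF h, simp]
    define T where "T b = {\<omega> \<in> space M. 2 / u \<le> \<bar>b \<bullet> X h \<omega>\<bar>}" for b
    have [measurable]: "T b \<in> sets M" for b unfolding T_def by measurable
    define g where "g b \<omega> = indicator (T b) \<omega> + 8 / u\<^sup>2 * (1 - cos ((u *\<^sub>R b) \<bullet> X h \<omega>))" for b \<omega>
    have cos_int: "integrable M (\<lambda>\<omega>. 1 - cos ((u *\<^sub>R b) \<bullet> X h \<omega>))" for b
      by (rule integrable_bounded[of _ 2]) (auto simp: abs_le_iff intro: order_trans[OF cos_le_one])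
    have T_int: "integrable M (\<lambda>\<omega>. indicat_real (T b) \<omega>)" for b
      by (simp add: emeasure_eq_measure)
    have g_int: "integrable M (g b)" for b
      unfolding g_def by (intro Bochner_Integration.integrable_add integrable_mult_right cos_int
          T_int)
    have g_exp: "expectation (g b) \<le> c * h" if b: "b \<in> Basis" for b
    proof -
      have "expectation (g b) = prob (T b)
          + 8 / u\<^sup>2 * expectation (\<lambda>\<omega>. 1 - cos ((u *\<^sub>R b) \<bullet> X h \<omega>))"
        unfolding g_def
        by (subst Bochner_Integration.integral_add[OF T_int integrable_mult_right[OF cos_int]])
           (simp only: integral_mult_right_zero, simp)
      also have "\<dots> \<le> 2 * 1 * h + 8 / u\<^sup>2 * (h * 1)"
      proof (intro add_mono mult_left_mono)
        show "prob (T b) \<le> 2 * 1 * h"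
          unfolding T_def by (rule prob_projection_tail[OF h u(1)]) (use u b in auto)
        have "expectation (\<lambda>\<omega>. 1 - cos ((u *\<^sub>R b) \<bullet> X h \<omega>)) \<le> h * \<eta> (u *\<^sub>R b)"
          using h by (intro one_minus_expectation_cos_le) auto
        also have "\<dots> \<le> h * 1" using h u b by (intro mult_left_mono) auto
        finally show "expectation (\<lambda>\<omega>. 1 - cos ((u *\<^sub>R b) \<bullet> X h \<omega>)) \<le> h * 1" .
      qed auto
      finally show ?thesis by (simp add: c_def algebra_simps)
    qed
    have pt: "min 1 ((norm (X h \<omega>))\<^sup>2) \<le> (\<Sum>b\<in>Basis. g b \<omega>)" if \<omega>: "\<omega> \<in> space M" for \<omega>
    proof -
      have "min 1 ((b \<bullet> X h \<omega>)\<^sup>2) \<le> g b \<omega>" for b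
      proof (cases "\<omega> \<in> T b")
        case True thus ?thesis by (auto simp: g_def min_le_iff_disj)
      next
        case False
        hence "\<bar>u * (b \<bullet> X h \<omega>)\<bar> \<le> 2" using \<omega> u by (auto simp: T_def abs_mult field_simps)
        from quadratic_le_one_minus_cos[OF this] u(1)
        have "(b \<bullet> X h \<omega>)\<^sup>2 \<le> 8 / u\<^sup>2 * (1 - cos (u * (b \<bullet> X h \<omega>)))"
          by (simp add: field_simps power_mult_distrib)
        thus ?thesis using False by (simp add: g_def min_le_iff_disj)
      qed
      hence "(\<Sum>b\<in>Basis. min 1 ((b \<bullet> X h \<omega>)\<^sup>2)) \<le> (\<Sum>b\<in>Basis. g b \<omega>)" by (intro sum_mono)
      moreover have "min 1 ((norm (X h \<omega>))\<^sup>2) \<le> (\<Sum>b\<in>Basis. min 1 ((b \<bullet> X h \<omega>)\<^sup>2))"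
      proof (cases "\<exists>b\<in>Basis. 1 \<le> (b \<bullet> X h \<omega>)\<^sup>2")
        case True
        then obtain b where b: "b \<in> Basis" "1 \<le> (b \<bullet> X h \<omega>)\<^sup>2" by auto
        have "1 \<le> min 1 ((b \<bullet> X h \<omega>)\<^sup>2)" using b by auto
        also have "\<dots> \<le> (\<Sum>b\<in>Basis. min 1 ((b \<bullet> X h \<omega>)\<^sup>2))" using b by (intro member_le_sum) auto
        finally show ?thesis by linarith
      next
        case False
        hence "(\<Sum>b\<in>Basis. min 1 ((b \<bullet> X h \<omega>)\<^sup>2)) = (\<Sum>b\<in>Basis. (b \<bullet> X h \<omega>)\<^sup>2)"
          by (intro sum.cong) auto
        also have "\<dots> = (norm (X h \<omega>))\<^sup>2"
          unfolding power2_norm_eq_inner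
              by (subst euclidean_inner) (simp add: power2_eq_square inner_commute)
        finally show ?thesis by simp
      qed
      ultimately show ?thesis by linarith
    qed
    have "expectation (\<lambda>\<omega>. min 1 ((norm (X h \<omega>))\<^sup>2)) \<le> expectation (\<lambda>\<omega>. \<Sum>b\<in>Basis. g b \<omega>)"
      by (intro integral_mono integrable_bounded[of _ 1] Bochner_Integration.integrable_sum g_int
          pt) auto
    also have "\<dots> = (\<Sum>b\<in>Basis. expectation (g b))"
      by (intro Bochner_Integration.integral_sum g_int)
    also have "\<dots> \<le> (\<Sum>b\<in>(Basis::'a set). c * h)" by (intro sum_mono g_exp)
    finally show ?thesis by simp
  qed
  moreover have "DIM('a) * c \<ge> 0" by (simp add: c_def)
  ultimately show thesis using that by blast
qed

end

section \<open>Small-time limits and the Levy measure\<close>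

text \<open>
  The product of two symmetric second differences, in the directions \<open>\<alpha>\<close> and \<open>\<beta>\<close>, of a function of the
  frequency. It annihilates polynomials of degree at most three, hence the drift and Gaussian terms of
  a Levy-Khintchine exponent together with all compensating terms.
\<close>

definition sdiff2 :: "'a::real_vector \<Rightarrow> 'a \<Rightarrow> ('a \<Rightarrow> complex) \<Rightarrow> 'a \<Rightarrow> complex" where
  "sdiff2 \<alpha> \<beta> F \<xi> =
     4 * F \<xi> - 2 * F (\<xi> + \<alpha>) - 2 * F (\<xi> - \<alpha>) - 2 * F (\<xi> + \<beta>) - 2 * F (\<xi> - \<beta>) +
     F (\<xi> + \<alpha> + \<beta>) + F (\<xi> + \<alpha> - \<beta>) + F (\<xi> - \<alpha> + \<beta>) + F (\<xi> - \<alpha> - \<beta>)"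

lemma sdiff2_add: "sdiff2 \<alpha> \<beta> (\<lambda>\<xi>. F \<xi> + G \<xi>) \<xi> = sdiff2 \<alpha> \<beta> F \<xi> + sdiff2 \<alpha> \<beta> G \<xi>"
  by (simp add: sdiff2_def algebra_simps)

lemma sdiff2_cmult: "sdiff2 \<alpha> \<beta> (\<lambda>\<xi>. c * F \<xi>) \<xi> = c * sdiff2 \<alpha> \<beta> F \<xi>"
  by (simp add: sdiff2_def algebra_simps)

lemma sdiff2_const: "sdiff2 \<alpha> \<beta> (\<lambda>\<xi>. c) \<xi> = 0"
  by (simp add: sdiff2_def algebra_simps)

lemma sdiff2_linear: "sdiff2 \<alpha> \<beta> (\<lambda>\<xi>. complex_of_real (b \<bullet> \<xi>)) \<xi> = 0"
  by (simp add: sdiff2_def algebra_simps inner_add_right inner_diff_right)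

lemma sdiff2_quadratic:
  assumes "linear A"
  shows "sdiff2 \<alpha> \<beta> (\<lambda>\<xi>. complex_of_real (A \<xi> \<bullet> \<xi>)) \<xi> = 0"
  using assms
  by (simp add: sdiff2_def linear_add linear_diff inner_add_right inner_diff_right
       inner_add_left inner_diff_left algebra_simps)

text \<open>
  The factor by which \<open>sdiff2\<close> multiplies the character \<open>\<xi> \<mapsto> iexp (\<xi> \<bullet> z)\<close>.
\<close>

definition cosweight :: "'a::euclidean_space \<Rightarrow> 'a \<Rightarrow> 'a \<Rightarrow> real" where
  "cosweight \<alpha> \<beta> z = (2 - 2 * cos (\<alpha> \<bullet> z)) * (2 - 2 * cos (\<beta> \<bullet> z))"

lemma sdiff2_iexp: "sdiff2 \<alpha> \<beta> (\<lambda>\<xi>. iexp (\<xi> \<bullet> z)) \<xi>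
    = iexp (\<xi> \<bullet> z) * complex_of_real (cosweight \<alpha> \<beta> z)"
proof -
  have c: "2 * complex_of_real (cos x) = iexp x + iexp (- x)" for x :: real
    by (simp add: cos_of_real[symmetric] cos_exp_eq)
  have "iexp (\<xi> \<bullet> z) * complex_of_real (cosweight \<alpha> \<beta> z) =
    iexp (\<xi> \<bullet> z) * (2 - (iexp (\<alpha> \<bullet> z) + iexp (- (\<alpha> \<bullet> z)))) *
        (2 - (iexp (\<beta> \<bullet> z) + iexp (- (\<beta> \<bullet> z))))"
    unfolding cosweight_def by (simp only: c[symmetric]) simp
  also have "\<dots> = sdiff2 \<alpha> \<beta> (\<lambda>\<xi>. iexp (\<xi> \<bullet> z)) \<xi>"
    unfolding sdiff2_def
    by (simp add: inner_add_left inner_diff_left exp_add exp_diff exp_minus field_simps)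
  finally show ?thesis by simp
qed

lemma iexp_compensated_bound:
  "cmod (iexp (\<xi> \<bullet> z) - 1 - \<i> * complex_of_real (indicator (cball 0 1) z * (\<xi> \<bullet> z)))
     \<le> (2 + (norm \<xi>)\<^sup>2) * min 1 ((norm z)\<^sup>2)" for \<xi> z :: "'a::euclidean_space"
proof (cases "norm z \<le> 1")
  case True
  have "cmod (iexp (\<xi> \<bullet> z) - (\<Sum>k\<le>1. (\<i> * (\<xi> \<bullet> z)) ^ k / fact k)) \<le> \<bar>\<xi> \<bullet> z\<bar> ^ (Suc 1) / fact (Suc 1)"
    by (rule iexp_approx1)
  hence "cmod (iexp (\<xi> \<bullet> z) - 1 - \<i> * complex_of_real (indicator (cball 0 1) z * (\<xi> \<bullet> z)))
      \<le> (\<xi> \<bullet> z)\<^sup>2 / 2"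
    using True by (simp add: diff_diff_eq power2_eq_square)
  also have "\<dots> \<le> (norm \<xi> * norm z)\<^sup>2 / 2"
    using Cauchy_Schwarz_ineq2[of \<xi> z] by (simp add: abs_le_square_iff[symmetric] abs_mult)
  also have "\<dots> \<le> (2 + (norm \<xi>)\<^sup>2) * (norm z)\<^sup>2"
    by (simp add: power_mult_distrib algebra_simps)
  also have "(norm z)\<^sup>2 = min 1 ((norm z)\<^sup>2)" using True by (simp add: power_le_one)
  finally show ?thesis .
next
  case False
  hence "1 \<le> (norm z)\<^sup>2" by simp
  moreover have "cmod (iexp (\<xi> \<bullet> z) - 1) \<le> 2"
    using norm_triangle_ineq4[of "iexp (\<xi> \<bullet> z)" 1] by simp
  ultimately show ?thesis using False by (simp add: min_absorb1) (smt (verit) zero_le_power2)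
qed

lemma two_minus_two_cos_bounds:
  fixes x :: real
  shows "0 \<le> 2 - 2 * cos x" "2 - 2 * cos x \<le> 4" "2 - 2 * cos x \<le> x\<^sup>2"
proof -
  show "0 \<le> 2 - 2 * cos x" by simp
  show "2 - 2 * cos x \<le> 4" using cos_ge_minus_one[of x] by linarith
  have "\<bar>sin (x/2)\<bar> \<le> \<bar>x/2\<bar>" by (rule abs_sin_x_le_abs_x)
  hence "(sin (x/2))\<^sup>2 \<le> (x/2)\<^sup>2" by (simp only: abs_le_square_iff)
  thus "2 - 2 * cos x \<le> x\<^sup>2" using cos_double_sin[of "x/2"] by (simp add: power_divide)
qed

lemma cosweight_nonneg: "0 \<le> cosweight \<alpha> \<beta> z"
  unfolding cosweight_def by (intro mult_nonneg_nonneg two_minus_two_cos_bounds)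

lemma cosweight_bound: "cosweight \<alpha> \<beta> z \<le> (16 + 4 * (norm \<alpha>)\<^sup>2) * min 1 ((norm z)\<^sup>2)"
proof -
  have "cosweight \<alpha> \<beta> z \<le> 4 * 4"
    unfolding cosweight_def by (intro mult_mono two_minus_two_cos_bounds) auto
  moreover have "cosweight \<alpha> \<beta> z \<le> (\<alpha> \<bullet> z)\<^sup>2 * 4"
    unfolding cosweight_def by (intro mult_mono two_minus_two_cos_bounds) auto
  moreover have "(\<alpha> \<bullet> z)\<^sup>2 \<le> (norm \<alpha>)\<^sup>2 * (norm z)\<^sup>2"
    using Cauchy_Schwarz_ineq2[of \<alpha> z]
        by (simp add: abs_le_square_iff[symmetric] abs_mult power_mult_distrib[symmetric])
  moreover define A Z where "A = (norm \<alpha>)\<^sup>2" and "Z = (norm z)\<^sup>2"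
  moreover have "0 \<le> A" "0 \<le> Z" by (auto simp: A_def Z_def)
  ultimately show ?thesis
    unfolding A_def[symmetric] Z_def[symmetric]
    by (cases "1 \<le> Z") (auto simp: min_absorb1 min_absorb2 algebra_simps)
qed

locale levy_measure_space =
  fixes \<nu> :: "'a::euclidean_space measure"
  assumes sets_nu[measurable_cong, simp]: "sets \<nu> = sets borel"
    and nu_moment: "(\<integral>\<^sup>+z. ennreal (min 1 ((norm z)\<^sup>2)) \<partial>\<nu>) < \<infinity>"
begin

lemma integrable_moment: "integrable \<nu> (\<lambda>z. min 1 ((norm z)\<^sup>2))"
  using nu_moment by (intro integrableI_bounded) (auto)

lemma integrable_moment_bounded:
  fixes f :: "'a \<Rightarrow> 'b::{banach, second_countable_topology}"
  assumes [measurable]: "f \<in> borel_measurable borel" and "\<And>z. norm (f z) \<le> C * min 1 ((norm z)\<^sup>2)"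
  shows "integrable \<nu> f"
  by (rule Bochner_Integration.integrable_bound[OF
      integrable_mult_right[OF integrable_moment, of C]])
     (use assms(2) in \<open>auto intro: order_trans[OF _ abs_ge_self]\<close>)

text \<open>
  What \<open>sdiff2\<close> leaves of the exponent is the Fourier transform of the finite measure with density
  \<open>cosweight \<alpha> \<beta>\<close> with respect to \<open>\<nu>\<close>.
\<close>

lemma sdiff2_levy_exponent:
  assumes "linear A"
  shows "sdiff2 \<alpha> \<beta> (levy_exponent b A \<nu>) \<xi>
      = (CLINT z|\<nu>. iexp (\<xi> \<bullet> z) * complex_of_real (cosweight \<alpha> \<beta> z))"
proof -
  define K where "K \<xi> z = iexp (\<xi> \<bullet> z) - 1
      - \<i> * complex_of_real (indicator (cball 0 1) z * (\<xi> \<bullet> z))"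
    for \<xi> z :: 'a
  have K_int: "integrable \<nu> (K \<xi>)" for \<xi>
  proof (rule integrable_moment_bounded)
    have [measurable]: "cball 0 1 \<in> sets (borel :: 'a measure)" by simp
    have [measurable]: "(\<bullet>) \<xi> \<in> borel_measurable borel"
        by (intro borel_measurable_continuous_onI continuous_intros)
    show "K \<xi> \<in> borel_measurable borel" unfolding K_def by measurable
  qed (use iexp_compensated_bound in \<open>auto simp: K_def\<close>)
  have K_sdiff: "sdiff2 \<alpha> \<beta> (\<lambda>\<xi>. K \<xi> z) \<xi> = iexp (\<xi> \<bullet> z) * complex_of_real (cosweight \<alpha> \<beta> z)" for z
  proof -
    have "(\<lambda>\<xi>. K \<xi> z) = (\<lambda>\<xi>. iexp (\<xi> \<bullet> z)
        + ((-1) + (- \<i> * complex_of_real (indicator (cball 0 1) z)) * complex_of_real (z \<bullet> \<xi>)))"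
      by (simp add: K_def fun_eq_iff inner_commute)
    thus ?thesis by (simp only: sdiff2_add sdiff2_iexp sdiff2_const sdiff2_cmult sdiff2_linear) simp
  qed
  have "(\<lambda>\<xi>. levy_exponent b A \<nu> \<xi>)
      = (\<lambda>\<xi>. \<i> * complex_of_real (b \<bullet> \<xi>) +
      ((-1/2) * complex_of_real (A \<xi> \<bullet> \<xi>) + (CLINT z|\<nu>. K \<xi> z)))"
    by (simp add: levy_exponent_def K_def fun_eq_iff)
  hence "sdiff2 \<alpha> \<beta> (levy_exponent b A \<nu>) \<xi> = sdiff2 \<alpha> \<beta> (\<lambda>\<xi>. CLINT z|\<nu>. K \<xi> z) \<xi>"
    by (simp only: sdiff2_add sdiff2_cmult sdiff2_linear sdiff2_quadratic[OF assms]) simp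
  also have "\<dots> = (CLINT z|\<nu>. sdiff2 \<alpha> \<beta> (\<lambda>\<xi>. K \<xi> z) \<xi>)"
    unfolding sdiff2_def by (simp add: K_int)
  finally show ?thesis by (simp only: K_sdiff)
qed

end

lemma tendsto_difference_quotient_exp:
  "((\<lambda>h. (exp (complex_of_real h * z) - 1) / complex_of_real h) \<longlongrightarrow> z) (at_right 0)"
proof -
  have "((\<lambda>w. exp (w * z)) has_field_derivative z) (at 0)"
    by (auto intro!: derivative_eq_intros)
  hence "((\<lambda>w. (exp (w * z) - 1) / w) \<longlongrightarrow> z) (at 0)"
    by (simp add: has_field_derivative_iff)
  moreover have "filterlim complex_of_real (at 0) (at_right 0)"
    by (auto simp: filterlim_at eventually_at_right_field intro!: tendsto_eq_intros exI[of _ 1])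
  ultimately show ?thesis by (rule filterlim_compose)
qed

text \<open>
  The real span of the functions \<open>cos (\<xi> \<bullet> z)\<close> and \<open>sin (\<xi> \<bullet> z)\<close>, on which small-time limits are known
  from characteristic functions. It is an algebra, by the product-to-sum formulas.
\<close>

inductive trig_polynomial :: "('a::euclidean_space \<Rightarrow> real) \<Rightarrow> bool" where
  cos: "trig_polynomial (\<lambda>z. cos (\<xi> \<bullet> z))"
| sin: "trig_polynomial (\<lambda>z. sin (\<xi> \<bullet> z))"
| add: "trig_polynomial f \<Longrightarrow> trig_polynomial g \<Longrightarrow> trig_polynomial (\<lambda>z. f z + g z)"
| scale: "trig_polynomial f \<Longrightarrow> trig_polynomial (\<lambda>z. c * f z)"

lemma trig_polynomial_const: "trig_polynomial (\<lambda>z. c)"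
  using trig_polynomial.scale[OF trig_polynomial.cos[of 0], of c] by simp

lemma trig_polynomial_sum:
  "finite I \<Longrightarrow> (\<And>i. i \<in> I \<Longrightarrow> trig_polynomial (f i)) \<Longrightarrow> trig_polynomial (\<lambda>z. \<Sum>i\<in>I. f i z)"
  by (induction I rule: finite_induct) (auto intro: trig_polynomial_const trig_polynomial.add)

lemma trig_polynomial_mult_basic:
  assumes "trig_polynomial g"
  shows "trig_polynomial (\<lambda>z. cos (\<xi> \<bullet> z) * g z) \<and> trig_polynomial (\<lambda>z. sin (\<xi> \<bullet> z) * g z)"
  using assms
proof (induction rule: trig_polynomial.induct)
  case (cos \<zeta>)
  have "trig_polynomial (\<lambda>z. 1/2 * cos ((\<xi> - \<zeta>) \<bullet> z) + 1/2 * cos ((\<xi> + \<zeta>) \<bullet> z))"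
    "trig_polynomial (\<lambda>z. 1/2 * sin ((\<xi> + \<zeta>) \<bullet> z) + 1/2 * sin ((\<xi> - \<zeta>) \<bullet> z))"
    by (intro trig_polynomial.intros)+
  thus ?case by (simp add: cos_times_cos sin_times_cos inner_add_left inner_diff_left
      add_divide_distrib)
next
  case (sin \<zeta>)
  have "trig_polynomial (\<lambda>z. 1/2 * sin ((\<xi> + \<zeta>) \<bullet> z) + (-1/2) * sin ((\<xi> - \<zeta>) \<bullet> z))"
    "trig_polynomial (\<lambda>z. 1/2 * cos ((\<xi> - \<zeta>) \<bullet> z) + (-1/2) * cos ((\<xi> + \<zeta>) \<bullet> z))"
    by (intro trig_polynomial.intros)+
  thus ?case by (simp add: cos_times_sin sin_times_sin inner_add_left inner_diff_left
      diff_divide_distrib)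
next
  case (add f g)
  thus ?case by (auto simp: distrib_left intro: trig_polynomial.add)
next
  case (scale f c)
  hence "trig_polynomial (\<lambda>z. c * (cos (\<xi> \<bullet> z) * f z))"
      "trig_polynomial (\<lambda>z. c * (sin (\<xi> \<bullet> z) * f z))"
    by (auto intro: trig_polynomial.scale)
  thus ?case by (simp add: mult_ac)
qed

lemma trig_polynomial_mult:
  assumes "trig_polynomial f" "trig_polynomial g"
  shows "trig_polynomial (\<lambda>z. f z * g z)"
  using assms(1)
proof (induction rule: trig_polynomial.induct)
  case (cos \<xi>) show ?case using trig_polynomial_mult_basic[OF assms(2)] by blast
next
  case (sin \<xi>) show ?case using trig_polynomial_mult_basic[OF assms(2)] by blast
next
  case (add f h) thus ?case by (auto simp: distrib_right intro: trig_polynomial.add)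
next
  case (scale f c)
  thus ?case using trig_polynomial.scale[OF scale.IH, of c] by (simp add: mult_ac)
qed

text \<open>
  The covering of a torus with periods \<open>2 * pi / a\<close>, embedded by the cosines and sines of the
  coordinates. Polynomials on the ambient space pull back to trigonometric polynomials.
\<close>

definition torus_map :: "real \<Rightarrow> 'a::euclidean_space \<Rightarrow> 'a \<times> 'a" where
  "torus_map a z = (\<Sum>b\<in>Basis. cos ((a *\<^sub>R b) \<bullet> z) *\<^sub>R b, \<Sum>b\<in>Basis. sin ((a *\<^sub>R b) \<bullet> z) *\<^sub>R b)"

lemma continuous_torus_map: "continuous_on S (torus_map a)"
  unfolding torus_map_def by (intro continuous_intros)

lemma torus_map_inner:
  assumes "b \<in> Basis"
  shows "fst (torus_map a z) \<bullet> b = cos (a * (b \<bullet> z))" "snd (torus_map a z) \<bullet> b = sin (a * (b \<bullet> z))"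
  using assms by (simp_all add: torus_map_def)

lemma trig_polynomial_compose:
  assumes "real_polynomial_function g"
  shows "trig_polynomial (\<lambda>z. g (torus_map a z))"
  using assms
proof (induction rule: real_polynomial_function.induct)
  case (linear f)
  then interpret bounded_linear f .
  have "f (torus_map a z) = (\<Sum>b\<in>Basis. f (b, 0) * cos ((a *\<^sub>R b) \<bullet> z))
      + (\<Sum>b\<in>Basis. f (0, b) * sin ((a *\<^sub>R b) \<bullet> z))"
    for z :: 'a
  proof -
    have 1: "torus_map a z = (\<Sum>b\<in>Basis. cos ((a *\<^sub>R b) \<bullet> z) *\<^sub>R (b, 0))
        + (\<Sum>b\<in>Basis. sin ((a *\<^sub>R b) \<bullet> z) *\<^sub>R (0, b))"
      by (simp add: torus_map_def prod_eq_iff fst_sum snd_sum)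
    show ?thesis unfolding 1 add sum scaleR by (simp add: mult_ac)
  qed
  moreover have "trig_polynomial
      (\<lambda>z. (\<Sum>b\<in>Basis. f (b, 0) * cos ((a *\<^sub>R b) \<bullet> z)) + (\<Sum>b\<in>Basis. f (0, b) * sin ((a *\<^sub>R b) \<bullet> z)))"
    by (intro trig_polynomial.intros trig_polynomial_sum) auto
  ultimately show ?case by simp
qed (auto intro: trig_polynomial_const trig_polynomial.add trig_polynomial_mult)

text \<open>
  A trigonometric polynomial that vanishes exactly at the lattice of periods, there to fourth order.
  Summing over all pairs of directions makes it the square of \<open>\<Sum>b. 2 - 2 * cos (a * (b \<bullet> z))\<close>.
\<close>

definition torus_weight :: "real \<Rightarrow> 'a::euclidean_space \<Rightarrow> real" where
  "torus_weight a z = (\<Sum>\<alpha>\<in>Basis. \<Sum>\<beta>\<in>Basis. cosweight (a *\<^sub>R \<alpha>) (a *\<^sub>R \<beta>) z)"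

lemma torus_weight_eq: "torus_weight a z = (\<Sum>b\<in>Basis. 2 - 2 * (fst (torus_map a z) \<bullet> b))\<^sup>2"
  unfolding torus_weight_def cosweight_def power2_eq_square sum_product
  by (intro sum.cong refl) (simp add: torus_map_inner)

lemma continuous_torus_weight: "continuous_on S (torus_weight a)"
  unfolding torus_weight_def cosweight_def by (intro continuous_intros)

lemma torus_weight_nonneg: "0 \<le> torus_weight a z"
  unfolding torus_weight_def by (intro sum_nonneg cosweight_nonneg)

lemma torus_weight_bound:
  "torus_weight a z \<le> (real DIM('a))\<^sup>2 * (16 + 4 * a\<^sup>2) * min 1 ((norm z)\<^sup>2)"
      for z :: "'a::euclidean_space"
proof -
  have "torus_weight a z \<le> (\<Sum>\<alpha>\<in>(Basis::'a set). \<Sum>\<beta>\<in>(Basis::'a set). (16 + 4 * a\<^sup>2) * min 1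
      ((norm z)\<^sup>2))"
    unfolding torus_weight_def
  proof (intro sum_mono)
    fix \<alpha> \<beta> :: 'a assume "\<alpha> \<in> Basis"
    thus "cosweight (a *\<^sub>R \<alpha>) (a *\<^sub>R \<beta>) z \<le> (16 + 4 * a\<^sup>2) * min 1 ((norm z)\<^sup>2)"
      using cosweight_bound[of "a *\<^sub>R \<alpha>" "a *\<^sub>R \<beta>" z] by simp
  qed
  thus ?thesis by (simp add: power2_eq_square mult_ac)
qed

lemma torus_weight_pos:
  assumes z: "\<And>b. b \<in> Basis \<Longrightarrow> \<bar>a * (b \<bullet> z)\<bar> < 2 * pi" and "z \<noteq> 0" "a \<noteq> 0"
  shows "0 < torus_weight a z"
proof -
  obtain b where b: "b \<in> Basis" "b \<bullet> z \<noteq> 0" using assms(2)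
      by (metis euclidean_all_zero_iff inner_commute)
  have "cos (a * (b \<bullet> z)) \<noteq> 1"
  proof
    assume "cos (a * (b \<bullet> z)) = 1"
    then obtain n :: int where n: "a * (b \<bullet> z) = n * 2 * pi" by (auto simp: cos_one_2pi_int)
    hence "\<bar>real_of_int n\<bar> * (2 * pi) < 1 * (2 * pi)" using z[OF b(1)] by (simp add: abs_mult)
    hence "\<bar>real_of_int n\<bar> < 1" by (subst (asm) mult_less_cancel_right) auto
    hence "n = 0" by linarith
    thus False using n b assms(3) by simp
  qed
  hence "0 < 2 - 2 * cos (a * (b \<bullet> z))" using cos_le_one[of "a * (b \<bullet> z)"] by linarith
  also have "\<dots> \<le> (\<Sum>b\<in>Basis. 2 - 2 * cos (a * (b \<bullet> z)))"
    using b(1) by (intro member_le_sum) auto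
  finally have "0 < (\<Sum>b\<in>Basis. 2 - 2 * (fst (torus_map a z) \<bullet> b))" by (simp add: torus_map_inner)
  thus ?thesis unfolding torus_weight_eq by simp
qed

locale levy_with_measure = cadlag_symmetric_levy M X \<eta> + levy_measure_space \<nu>
  for M :: "'w measure" and X :: "real \<Rightarrow> 'w \<Rightarrow> 'a::euclidean_space" and \<eta> \<nu> +
  assumes levy_khintchine: "\<exists>b A. linear A \<and>
    (\<forall>t\<ge>0. \<forall>\<xi>. (CLINT \<omega>|M. iexp (\<xi> \<bullet> X t \<omega>)) = exp (complex_of_real t * levy_exponent b A \<nu> \<xi>))"
begin

text \<open>
  The characteristic function at time \<open>h\<close> is the exponential of \<open>h\<close> times the exponent, so its
  difference quotient at \<open>h = 0\<close> converges to the exponent; \<open>sdiff2\<close> commutes with this limit and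
  with both integrals.
\<close>

lemma cosweight_char_tendsto:
  "((\<lambda>h. (CLINT \<omega>|M. iexp (\<xi> \<bullet> X h \<omega>) * complex_of_real (cosweight \<alpha> \<beta> (X h \<omega>))) / complex_of_real
      h)
     \<longlongrightarrow> (CLINT z|\<nu>. iexp (\<xi> \<bullet> z) * complex_of_real (cosweight \<alpha> \<beta> z))) (at_right 0)"
proof -
  obtain b A where A: "linear A"
    and ch: "\<And>t \<xi>. t \<ge> 0 \<Longrightarrow> (CLINT \<omega>|M. iexp (\<xi> \<bullet> X t \<omega>))
        = exp (complex_of_real t * levy_exponent b A \<nu> \<xi>)"
    using levy_khintchine by blast
  define E where "E = levy_exponent b A \<nu>"
  define q where "q h = (\<lambda>\<xi>. (exp (complex_of_real h * E \<xi>) - 1) / complex_of_real h)" for h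
  have "((\<lambda>h. sdiff2 \<alpha> \<beta> (q h) \<xi>) \<longlongrightarrow> sdiff2 \<alpha> \<beta> E \<xi>) (at_right 0)"
    unfolding sdiff2_def q_def
    by (intro tendsto_intros tendsto_difference_quotient_exp)
  also have "sdiff2 \<alpha> \<beta> E \<xi> = (CLINT z|\<nu>. iexp (\<xi> \<bullet> z) * complex_of_real (cosweight \<alpha> \<beta> z))"
    unfolding E_def by (rule sdiff2_levy_exponent[OF A])
  finally show ?thesis
  proof (rule Lim_transform_eventually)
    have "sdiff2 \<alpha> \<beta> (q h) \<xi> =
        (CLINT \<omega>|M. iexp (\<xi> \<bullet> X h \<omega>) * complex_of_real (cosweight \<alpha> \<beta> (X h \<omega>))) / complex_of_real h"
      if h: "h > 0" for h
    proof -
      note measurable_X[OF less_imp_le[OF h], measurable]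
      have int: "integrable M (\<lambda>\<omega>. iexp (\<xi> \<bullet> X h \<omega>))" for \<xi>
        by (rule integrable_const_bound[where B=1]) auto
      have "q h = (\<lambda>\<xi>. (1 / complex_of_real h) * ((CLINT \<omega>|M. iexp (\<xi> \<bullet> X h \<omega>)) + (- 1)))"
        by (simp add: q_def E_def ch[OF less_imp_le[OF h]] fun_eq_iff)
      hence "sdiff2 \<alpha> \<beta> (q h) \<xi> = (1 / complex_of_real h) * sdiff2 \<alpha> \<beta>
          (\<lambda>\<xi>. CLINT \<omega>|M. iexp (\<xi> \<bullet> X h \<omega>)) \<xi>"
        by (simp only: sdiff2_cmult sdiff2_add sdiff2_const) simp
      also have "sdiff2 \<alpha> \<beta> (\<lambda>\<xi>. CLINT \<omega>|M. iexp (\<xi> \<bullet> X h \<omega>)) \<xi>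
          = (CLINT \<omega>|M. sdiff2 \<alpha> \<beta> (\<lambda>\<xi>. iexp (\<xi> \<bullet> X h \<omega>)) \<xi>)"
        unfolding sdiff2_def by (simp add: int)
      finally show ?thesis by (simp only: sdiff2_iexp) simp
    qed
    thus "\<forall>\<^sub>F h in at_right 0. sdiff2 \<alpha> \<beta> (q h) \<xi> =
       (CLINT \<omega>|M. iexp (\<xi> \<bullet> X h \<omega>) * complex_of_real (cosweight \<alpha> \<beta> (X h \<omega>))) / complex_of_real h"
      by (auto simp: eventually_at_right_field intro!: exI[of _ 1])
  qed
qed

lemma iexp_Re_Im: "Re (iexp x * complex_of_real c) = cos x * c"
    "Im (iexp x * complex_of_real c) = sin x * c"
  by (simp_all add: Re_exp Im_exp)

lemma measurable_cosweight [measurable]: "cosweight \<alpha> \<beta> \<in> borel_measurable borel"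
  unfolding cosweight_def[abs_def] by measurable

lemma measurable_torus_weight [measurable]: "torus_weight a \<in> borel_measurable borel"
  by (intro borel_measurable_continuous_onI continuous_torus_weight)

lemma cosweight_le_16: "cosweight \<alpha> \<beta> z \<le> 16"
proof -
  have "cosweight \<alpha> \<beta> z \<le> 4 * 4"
    unfolding cosweight_def by (intro mult_mono two_minus_two_cos_bounds) auto
  thus ?thesis by simp
qed

definition small_time_limit :: "('a \<Rightarrow> real) \<Rightarrow> bool" where
  "small_time_limit f \<longleftrightarrow>
     ((\<lambda>h. expectation (\<lambda>\<omega>. f (X h \<omega>)) / h) \<longlongrightarrow> integral\<^sup>L \<nu> f) (at_right 0)"

lemma integrable_iexp_cosweight:
  "integrable \<nu> (\<lambda>z. iexp (\<xi> \<bullet> z) * complex_of_real (cosweight \<alpha> \<beta> z))"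
proof (rule integrable_moment_bounded)
  have [measurable]: "(\<bullet>) \<xi> \<in> borel_measurable borel"
      by (intro borel_measurable_continuous_onI continuous_intros)
  show "(\<lambda>z. iexp (\<xi> \<bullet> z) * complex_of_real (cosweight \<alpha> \<beta> z)) \<in> borel_measurable borel"
    by measurable
  show "norm (iexp (\<xi> \<bullet> z) * complex_of_real (cosweight \<alpha> \<beta> z))
      \<le> (16 + 4 * (norm \<alpha>)\<^sup>2) * min 1 ((norm z)\<^sup>2)" for z
    using cosweight_bound[of \<alpha> \<beta> z] cosweight_nonneg[of \<alpha> \<beta> z] by (simp add: norm_mult)
qed

lemma small_time_limit_cosweight:
  "small_time_limit (\<lambda>z. cos (\<xi> \<bullet> z) * cosweight \<alpha> \<beta> z)"
      "small_time_limit (\<lambda>z. sin (\<xi> \<bullet> z) * cosweight \<alpha> \<beta> z)"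
proof -
  let ?J = "\<lambda>z. iexp (\<xi> \<bullet> z) * complex_of_real (cosweight \<alpha> \<beta> z)"
  have int: "integrable M (\<lambda>\<omega>. ?J (X h \<omega>))" if "h > 0" for h
  proof -
    note measurable_X[OF less_imp_le[OF that], measurable]
    show ?thesis
      by (rule integrable_const_bound[where B=16])
         (auto simp: norm_mult cosweight_nonneg cosweight_le_16)
  qed
  have "\<forall>\<^sub>F h in at_right 0. Re ((CLINT \<omega>|M. ?J (X h \<omega>)) / complex_of_real h)
      = expectation (\<lambda>\<omega>. cos (\<xi> \<bullet> X h \<omega>) * cosweight \<alpha> \<beta> (X h \<omega>)) / h"
    "\<forall>\<^sub>F h in at_right 0. Im ((CLINT \<omega>|M. ?J (X h \<omega>)) / complex_of_real h)
      = expectation (\<lambda>\<omega>. sin (\<xi> \<bullet> X h \<omega>) * cosweight \<alpha> \<beta> (X h \<omega>)) / h"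
    by (auto simp only: eventually_at_right_field Re_divide_of_real Im_divide_of_real
        integral_Re[OF int, symmetric] integral_Im[OF int, symmetric] iexp_Re_Im intro!:
            exI[of _ "1::real"])
  from Lim_transform_eventually[OF tendsto_Re[OF cosweight_char_tendsto] this(1)]
       Lim_transform_eventually[OF tendsto_Im[OF cosweight_char_tendsto] this(2)]
  show "small_time_limit (\<lambda>z. cos (\<xi> \<bullet> z) * cosweight \<alpha> \<beta> z)"
      "small_time_limit (\<lambda>z. sin (\<xi> \<bullet> z) * cosweight \<alpha> \<beta> z)"
    unfolding small_time_limit_def
    by (simp_all only: integral_Re[OF integrable_iexp_cosweight, symmetric]
         integral_Im[OF integrable_iexp_cosweight, symmetric] iexp_Re_Im)
qed

lemma integrable_torus_weight_mult:
  assumes [measurable]: "f \<in> borel_measurable borel" and f: "\<And>z. \<bar>f z\<bar> \<le> B"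
  shows "integrable \<nu> (\<lambda>z. f z * torus_weight a z)"
    and "h > 0 \<Longrightarrow> integrable M (\<lambda>\<omega>. f (X h \<omega>) * torus_weight a (X h \<omega>))"
proof -
  define C where "C = (real DIM('a))\<^sup>2 * (16 + 4 * a\<^sup>2)"
  have B: "0 \<le> B" using f[of 0] by linarith
  have C: "0 \<le> C" by (simp add: C_def)
  have bd: "norm (f z * torus_weight a z) \<le> (B * C) * min 1 ((norm z)\<^sup>2)" for z
  proof -
    have "norm (f z * torus_weight a z) \<le> B * (C * min 1 ((norm z)\<^sup>2))"
      using f[of z] B torus_weight_bound[of a z] torus_weight_nonneg[of a z]
      unfolding real_norm_def abs_mult C_def by (intro mult_mono) auto
    thus ?thesis by (simp add: mult_ac)
  qed
  show "integrable \<nu> (\<lambda>z. f z * torus_weight a z)"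
    by (rule integrable_moment_bounded[OF _ bd]) measurable
  assume h: "h > 0"
  note measurable_X[OF less_imp_le[OF h], measurable]
  show "integrable M (\<lambda>\<omega>. f (X h \<omega>) * torus_weight a (X h \<omega>))"
  proof (rule integrable_const_bound[where B="B * C"])
    have "norm (f z * torus_weight a z) \<le> B * C" for z
      using bd[of z] mult_left_mono[of "min 1 ((norm z)\<^sup>2)" 1 "B * C"] B C by simp
    thus "AE \<omega> in M. norm (f (X h \<omega>) * torus_weight a (X h \<omega>)) \<le> B * C" by simp
  qed measurable
qed

lemma small_time_limit_sum:
  assumes "finite I" "\<And>i. i \<in> I \<Longrightarrow> small_time_limit (f i)" "\<And>i. i \<in> I \<Longrightarrow> integrable \<nu> (f i)"
    "\<And>i h. i \<in> I \<Longrightarrow> h > 0 \<Longrightarrow> integrable M (\<lambda>\<omega>. f i (X h \<omega>))"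
  shows "small_time_limit (\<lambda>z. \<Sum>i\<in>I. f i z)"
proof -
  have "((\<lambda>h. \<Sum>i\<in>I. expectation (\<lambda>\<omega>. f i (X h \<omega>)) / h) \<longlongrightarrow> (\<Sum>i\<in>I. integral\<^sup>L \<nu> (f i))) (at_right 0)"
    using assms(2) by (intro tendsto_sum) (simp add: small_time_limit_def)
  moreover have "\<forall>\<^sub>F h in at_right 0. (\<Sum>i\<in>I. expectation (\<lambda>\<omega>. f i (X h \<omega>)) / h)
      = expectation (\<lambda>\<omega>. \<Sum>i\<in>I. f i (X h \<omega>)) / h"
    using assms(4) by (auto simp: eventually_at_right_field sum_divide_distrib intro!: exI[of _ 1])
  ultimately show ?thesis
    using assms(3) unfolding small_time_limit_def
    by (simp add: Bochner_Integration.integral_sum) (rule Lim_transform_eventually)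
qed

lemma trig_polynomial_bounded:
  assumes "trig_polynomial f"
  shows "f \<in> borel_measurable borel \<and> (\<exists>B. \<forall>z. \<bar>f z\<bar> \<le> B)"
  using assms
proof (induction rule: trig_polynomial.induct)
  case (cos \<xi>) show ?case by
      (auto intro!: borel_measurable_continuous_onI continuous_intros exI[of _ 1])
next
  case (sin \<xi>) show ?case by
      (auto intro!: borel_measurable_continuous_onI continuous_intros exI[of _ 1])
next
  case (add f g)
  then obtain B C where "\<And>z. \<bar>f z\<bar> \<le> B" "\<And>z. \<bar>g z\<bar> \<le> C" by auto
  hence "\<bar>f z + g z\<bar> \<le> B + C" for z by (meson abs_triangle_ineq add_mono order_trans)
  thus ?case using add by auto
next
  case (scale f c)
  then obtain B where "\<And>z. \<bar>f z\<bar> \<le> B" by auto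
  hence "\<bar>c * f z\<bar> \<le> \<bar>c\<bar> * B" for z by (simp add: abs_mult mult_left_mono)
  thus ?case using scale by auto
qed

lemma small_time_limit_trig_polynomial:
  assumes "trig_polynomial f"
  shows "small_time_limit (\<lambda>z. f z * torus_weight a z)"
  using assms
proof (induction rule: trig_polynomial.induct)
  case (cos \<xi>)
  have i: "integrable \<nu> (\<lambda>z. cos (\<xi> \<bullet> z) * cosweight \<alpha> \<beta> z)" for \<alpha> \<beta>
    using integrable_Re[OF integrable_iexp_cosweight[of \<xi> \<alpha> \<beta>]] by (simp only: iexp_Re_Im)
  have j: "integrable M (\<lambda>\<omega>. cos (\<xi> \<bullet> X h \<omega>) * cosweight \<alpha> \<beta> (X h \<omega>))" if "h > 0" for h \<alpha> \<beta>
  proof (rule integrable_bounded[of _ "1 * 16"])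
    note measurable_X[OF less_imp_le[OF that], measurable]
    show "(\<lambda>\<omega>. cos (\<xi> \<bullet> X h \<omega>) * cosweight \<alpha> \<beta> (X h \<omega>)) \<in> borel_measurable M" by measurable
    show "\<bar>cos (\<xi> \<bullet> X h \<omega>) * cosweight \<alpha> \<beta> (X h \<omega>)\<bar> \<le> 1 * 16" for \<omega>
      unfolding abs_mult abs_of_nonneg[OF cosweight_nonneg]
      by (intro mult_mono cosweight_le_16 cosweight_nonneg) auto
  qed
  show ?case unfolding torus_weight_def sum_distrib_left
    by (intro small_time_limit_sum small_time_limit_cosweight i j
        Bochner_Integration.integrable_sum) auto
next
  case (sin \<xi>)
  have i: "integrable \<nu> (\<lambda>z. sin (\<xi> \<bullet> z) * cosweight \<alpha> \<beta> z)" for \<alpha> \<beta>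
    using integrable_Im[OF integrable_iexp_cosweight[of \<xi> \<alpha> \<beta>]] by (simp only: iexp_Re_Im)
  have j: "integrable M (\<lambda>\<omega>. sin (\<xi> \<bullet> X h \<omega>) * cosweight \<alpha> \<beta> (X h \<omega>))" if "h > 0" for h \<alpha> \<beta>
  proof (rule integrable_bounded[of _ "1 * 16"])
    note measurable_X[OF less_imp_le[OF that], measurable]
    show "(\<lambda>\<omega>. sin (\<xi> \<bullet> X h \<omega>) * cosweight \<alpha> \<beta> (X h \<omega>)) \<in> borel_measurable M" by measurable
    show "\<bar>sin (\<xi> \<bullet> X h \<omega>) * cosweight \<alpha> \<beta> (X h \<omega>)\<bar> \<le> 1 * 16" for \<omega>
      unfolding abs_mult abs_of_nonneg[OF cosweight_nonneg]
      by (intro mult_mono cosweight_le_16 cosweight_nonneg) auto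
  qed
  show ?case unfolding torus_weight_def sum_distrib_left
    by (intro small_time_limit_sum small_time_limit_cosweight i j
        Bochner_Integration.integrable_sum) auto
next
  case (add f g)
  from trig_polynomial_bounded[OF add.hyps(1)] trig_polynomial_bounded[OF add.hyps(2)]
  obtain B C where bd: "f \<in> borel_measurable borel" "\<And>z. \<bar>f z\<bar> \<le> B" "g \<in> borel_measurable borel"
      "\<And>z. \<bar>g z\<bar> \<le> C" by blast
  note i = integrable_torus_weight_mult[OF bd(1,2)] integrable_torus_weight_mult[OF bd(3,4)]
  have "small_time_limit (\<lambda>z. \<Sum>k\<in>UNIV. (if k then f z else g z) * torus_weight a z)"
  proof (rule small_time_limit_sum)
    fix k :: bool
    show "small_time_limit (\<lambda>z. (if k then f z else g z) * torus_weight a z)" using add.IH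
        by (cases k) auto
    show "integrable \<nu> (\<lambda>z. (if k then f z else g z) * torus_weight a z)" using i by (cases k) auto
    show "integrable M (\<lambda>\<omega>. (if k then f (X h \<omega>) else g (X h \<omega>)) * torus_weight a (X h \<omega>))"
        if "h > 0" for h
      using i that by (cases k) auto
  qed auto
  thus ?case by (simp add: UNIV_bool distrib_right add.commute)
next
  case (scale f c)
  have "((\<lambda>h. c * (expectation (\<lambda>\<omega>. f (X h \<omega>) * torus_weight a (X h \<omega>)) / h)) \<longlongrightarrow> c * integral\<^sup>L \<nu>
      (\<lambda>z. f z * torus_weight a z)) (at_right 0)"
    using scale.IH unfolding small_time_limit_def by (intro tendsto_intros)
  thus ?case unfolding small_time_limit_def by (simp add: mult.assoc)
qed

end

context levy_with_measure
begin

text \<open>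
  Weierstrass approximation of \<open>H\<close> on a ball that contains the torus. The error is uniform and is
  multiplied by the weight, whose own small-time limit is finite, so it stays of order \<open>h\<close>.
\<close>

lemma small_time_limit_torus:
  fixes H :: "'a \<times> 'a \<Rightarrow> real"
  assumes H: "continuous_on UNIV H"
  shows "small_time_limit (\<lambda>z. H (torus_map a z) * torus_weight a z)"
proof -
  let ?W = "torus_weight a :: 'a \<Rightarrow> real"
  define S :: "('a \<times> 'a) set" where "S = cball 0 (2 * DIM('a))"
  have cS: "compact S" unfolding S_def by simp
  have in_S: "torus_map a z \<in> S" for z :: 'a
  proof -
    have n: "norm (\<Sum>b\<in>(Basis::'a set). f b *\<^sub>R b) \<le> DIM('a)" if "\<And>b. \<bar>f b\<bar> \<le> 1" for f
    proof -
      have "norm (\<Sum>b\<in>(Basis::'a set). f b *\<^sub>R b) \<le> (\<Sum>b\<in>(Basis::'a set). norm (f b *\<^sub>R b))"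
          by (rule norm_sum)
      also have "\<dots> \<le> (\<Sum>b\<in>(Basis::'a set). 1)" using that by (intro sum_mono) auto
      finally show ?thesis by simp
    qed
    have "norm (torus_map a z) \<le> norm (fst (torus_map a z)) + norm (snd (torus_map a z))"
      using norm_Pair_le[of "fst (torus_map a z)" "snd (torus_map a z)"] by simp
    also have "\<dots> \<le> real DIM('a) + real DIM('a)"
      unfolding torus_map_def fst_conv snd_conv by (intro add_mono n) auto
    finally show ?thesis by (simp add: S_def)
  qed
  have Hm[measurable]: "(\<lambda>z. H (torus_map a z)) \<in> borel_measurable borel"
    by (intro borel_measurable_continuous_onI continuous_on_compose2[OF H continuous_torus_map])
        auto
  obtain B where B: "\<And>p. p \<in> S \<Longrightarrow> \<bar>H p\<bar> \<le> B"
  proof -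
    have "compact (H ` S)" using H cS
        by (intro compact_continuous_image continuous_on_subset[OF H]) auto
    from compact_imp_bounded[OF this] show thesis using that by (auto simp: bounded_iff)
  qed
  have Hint: "integrable \<nu> (\<lambda>z. H (torus_map a z) * ?W z)"
    "h > 0 \<Longrightarrow> integrable M (\<lambda>\<omega>. H (torus_map a (X h \<omega>)) * ?W (X h \<omega>))" for h
    by (rule integrable_torus_weight_mult[OF Hm B[OF in_S]], assumption?)+
  have Wlim: "((\<lambda>h. expectation (\<lambda>\<omega>. ?W (X h \<omega>)) / h) \<longlongrightarrow> integral\<^sup>L \<nu> ?W) (at_right 0)"
    using small_time_limit_trig_polynomial[OF trig_polynomial_const[of 1], of a]
        by (simp add: small_time_limit_def)
  have Wint: "integrable \<nu> ?W" "h > 0 \<Longrightarrow> integrable M (\<lambda>\<omega>. ?W (X h \<omega>))" for h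
    using integrable_torus_weight_mult[of "\<lambda>_. 1" 1, where a = a] by auto
  define w0 where "w0 = integral\<^sup>L \<nu> ?W"
  have w0: "0 \<le> w0" unfolding w0_def by (intro integral_nonneg_AE) (auto simp: torus_weight_nonneg)
  show ?thesis
    unfolding small_time_limit_def
  proof (rule tendstoI)
    fix e :: real assume e: "e > 0"
    define \<epsilon> where "\<epsilon> = (e / 3) / (w0 + 1)"
    have \<epsilon>: "\<epsilon> > 0" using e w0 by (simp add: \<epsilon>_def)
    obtain g where g: "real_polynomial_function g" "\<And>p. p \<in> S \<Longrightarrow> \<bar>H p - g p\<bar> < \<epsilon>"
      using Stone_Weierstrass_real_polynomial_function[OF cS continuous_on_subset[OF H] \<epsilon>] by blast
    define G where "G z = g (torus_map a z)" for z :: 'a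
    have G: "trig_polynomial G" unfolding G_def by (rule trig_polynomial_compose[OF g(1)])
    from trig_polynomial_bounded[OF this] obtain C
        where C: "G \<in> borel_measurable borel" "\<And>z. \<bar>G z\<bar> \<le> C" by blast
    note Gint = integrable_torus_weight_mult[OF C]
    have lim: "((\<lambda>h. expectation (\<lambda>\<omega>. G (X h \<omega>) * ?W (X h \<omega>)) / h) \<longlongrightarrow> integral\<^sup>L \<nu>
        (\<lambda>z. G z * ?W z)) (at_right 0)"
      using small_time_limit_trig_polynomial[OF G] by (simp add: small_time_limit_def)
    have close: "\<bar>H (torus_map a z) * ?W z - G z * ?W z\<bar> \<le> \<epsilon> * ?W z" for z
    proof -
      have "\<bar>H (torus_map a z) * ?W z - G z * ?W z\<bar> = \<bar>H (torus_map a z) - G z\<bar> * ?W z"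
        by (simp add: abs_mult torus_weight_nonneg left_diff_distrib[symmetric])
      also have "\<dots> \<le> \<epsilon> * ?W z"
        using g(2)[OF in_S, of z] by (intro mult_right_mono torus_weight_nonneg) (simp add: G_def)
      finally show ?thesis .
    qed
    have nu_close: "\<bar>integral\<^sup>L \<nu> (\<lambda>z. H (torus_map a z) * ?W z) - integral\<^sup>L \<nu> (\<lambda>z. G z * ?W z)\<bar>
        \<le> \<epsilon> * w0"
    proof -
      have "\<bar>integral\<^sup>L \<nu> (\<lambda>z. H (torus_map a z) * ?W z - G z * ?W z)\<bar>
          \<le> integral\<^sup>L \<nu> (\<lambda>z. \<epsilon> * ?W z)"
        using close Hint(1) Gint(1) Wint(1)
        by (intro order_trans[OF integral_abs_bound] integral_mono) auto
      thus ?thesis using Hint(1) Gint(1) by (simp add: w0_def)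
    qed
    have M_close: "\<bar>expectation (\<lambda>\<omega>. H (torus_map a (X h \<omega>)) * ?W (X h \<omega>)) / h
        - expectation (\<lambda>\<omega>. G (X h \<omega>) * ?W (X h \<omega>)) / h\<bar>
        \<le> \<epsilon> * (expectation (\<lambda>\<omega>. ?W (X h \<omega>)) / h)" if h: "h > 0" for h
    proof -
      have "\<bar>expectation (\<lambda>\<omega>. H (torus_map a (X h \<omega>)) * ?W (X h \<omega>) - G (X h \<omega>) * ?W (X h \<omega>))\<bar>
          \<le> expectation (\<lambda>\<omega>. \<epsilon> * ?W (X h \<omega>))"
        using close Hint(2)[OF h] Gint(2)[OF h] Wint(2)[OF h]
        by (intro order_trans[OF integral_abs_bound] integral_mono) auto
      hence "\<bar>expectation (\<lambda>\<omega>. H (torus_map a (X h \<omega>)) * ?W (X h \<omega>))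
          - expectation (\<lambda>\<omega>. G (X h \<omega>) * ?W (X h \<omega>))\<bar> / h
         \<le> \<epsilon> * expectation (\<lambda>\<omega>. ?W (X h \<omega>)) / h"
        using Hint(2)[OF h] Gint(2)[OF h] h by (intro divide_right_mono) auto
      thus ?thesis using h by (simp add: diff_divide_distrib[symmetric])
    qed
    have "\<forall>\<^sub>F h in at_right 0. expectation (\<lambda>\<omega>. ?W (X h \<omega>)) / h < w0 + 1"
      using order_tendstoD(2)[OF Wlim, of "w0 + 1"] by (simp add: w0_def)
    moreover have "\<forall>\<^sub>F h in at_right 0. dist (expectation (\<lambda>\<omega>. G (X h \<omega>) * ?W (X h \<omega>)) / h)
        (integral\<^sup>L \<nu> (\<lambda>z. G z * ?W z)) < e / 3"
      using e by (intro tendstoD[OF lim]) simp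
    moreover have "\<forall>\<^sub>F h in at_right 0. (h::real) > 0" by (simp add: eventually_at_right_less)
    ultimately show "\<forall>\<^sub>F h in at_right 0. dist
        (expectation (\<lambda>\<omega>. H (torus_map a (X h \<omega>)) * ?W (X h \<omega>)) / h)
         (integral\<^sup>L \<nu> (\<lambda>z. H (torus_map a z) * ?W z)) < e"
    proof eventually_elim
      case (elim h)
      have "\<epsilon> * (expectation (\<lambda>\<omega>. ?W (X h \<omega>)) / h) \<le> \<epsilon> * (w0 + 1)" using elim(1) \<epsilon>
          by (intro mult_left_mono) auto
      moreover have "w0 + 1 \<noteq> 0" using w0 by linarith
      from nonzero_eq_divide_eq[OF this, of \<epsilon> "e / 3"] \<epsilon>_def have "\<epsilon> * (w0 + 1) = e / 3" by blast
      moreover have "\<epsilon> * w0 \<le> \<epsilon> * (w0 + 1)" using \<epsilon> by simp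
      ultimately show ?case using M_close[OF elim(3)] nu_close elim(2) unfolding dist_real_def
          by linarith
    qed
  qed
qed

lemma torus_map_eq_iff:
  fixes z z' :: 'a
  assumes a: "a > 0" and z: "\<And>b. b \<in> Basis \<Longrightarrow> \<bar>b \<bullet> z\<bar> < pi / a"
      and z': "\<And>b. b \<in> Basis \<Longrightarrow> \<bar>b \<bullet> z'\<bar> \<le> pi / a"
    and eq: "torus_map a z = torus_map a z'"
  shows "z = z'"
proof (rule euclidean_eqI)
  fix b :: 'a assume b: "b \<in> Basis"
  have "cos (a * (b \<bullet> z)) = cos (a * (b \<bullet> z'))" "sin (a * (b \<bullet> z)) = sin (a * (b \<bullet> z'))"
    using eq torus_map_inner[OF b] by metis+
  then obtain n :: int where n: "a * (b \<bullet> z) = a * (b \<bullet> z') + 2 * pi * n" by (metis sin_cos_eq_iff)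
  have "\<bar>a * (b \<bullet> z)\<bar> < pi" "\<bar>a * (b \<bullet> z')\<bar> \<le> pi"
    using z[OF b] z'[OF b] a by (auto simp: abs_mult field_simps)
  hence "\<bar>2 * pi * n\<bar> < 2 * pi" using n by linarith
  hence "\<bar>real_of_int n\<bar> * (2 * pi) < 1 * (2 * pi)" by (simp add: abs_mult)
  hence "\<bar>real_of_int n\<bar> < 1" by (subst (asm) mult_less_cancel_right) auto
  hence "n = 0" by linarith
  thus "z \<bullet> b = z' \<bullet> b" using n a by (simp add: inner_commute)
qed

text \<open>
  On a torus so large that hardly any mass wraps around it, the indicator of \<open>U\<close> dominates a continuous
  function \<open>\<Phi>\<close> that is \<open>1\<close> on \<open>C\<close> and vanishes near the origin. Hence \<open>\<Phi>\<close> can be divided by the weight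
  and \<open>small_time_limit_torus\<close> applies to the quotient.
\<close>

lemma small_time_lower_bound_compact:
  assumes U: "open U" "0 \<notin> U" and C: "compact C" "C \<subseteq> U" and c: "c < measure \<nu> C"
  shows "\<forall>\<^sub>F h in at_right 0. c * h \<le> prob {\<omega> \<in> space M. X h \<omega> \<in> U}"
proof (cases "C = {}")
  case True
  hence "c < 0" using c by simp
  have "\<forall>\<^sub>F h in at_right 0. (h::real) > 0" by (simp add: eventually_at_right_less)
  thus ?thesis
  proof eventually_elim
    case (elim h)
    hence "c * h \<le> 0" using \<open>c < 0\<close> by (simp add: mult_nonpos_nonneg)
    thus ?case by (rule order_trans) simp
  qed
next
  case nonempty: False
  define \<delta> where "\<delta> = (measure \<nu> C - c) / 2"
  have \<delta>: "\<delta> > 0" using c by (simp add: \<delta>_def)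
  obtain R1 where "R1 > 0" and R1:
      "\<And>r h. R1 \<le> r \<Longrightarrow> h > 0 \<Longrightarrow> prob {\<omega> \<in> space M. \<exists>b\<in>Basis. r \<le> \<bar>b \<bullet> X h \<omega>\<bar>} \<le> \<delta> * h"
  proof (rule prob_coordinate_tail[OF \<delta>])
    fix R assume "R > 0" "\<And>r h. R \<le> r \<Longrightarrow> h > 0 \<Longrightarrow> prob {\<omega> \<in> space M. \<exists>b\<in>Basis. r \<le> \<bar>b \<bullet> X h \<omega>\<bar>}
        \<le> \<delta> * h"
    thus thesis by (rule that)
  qed
  obtain R2 where R2: "\<And>z. z \<in> C \<Longrightarrow> norm z \<le> R2" using compact_imp_bounded[OF C(1)]
      by (auto simp: bounded_iff)
  define R where "R = max R1 (max (R2 + 1) 1)"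
  have R: "R > 0" "R1 \<le> R" "R2 < R" by (auto simp: R_def)
  \<comment> \<open>With this frequency the box of half-width \<open>R\<close> is a fundamental domain of the torus.\<close>
  define a where "a = pi / R"
  have a: "a > 0" "pi / a = R" using R by (auto simp: a_def)
  let ?\<theta> = "torus_map a :: 'a \<Rightarrow> 'a \<times> 'a"
  let ?Wp = "\<lambda>p::'a\<times>'a. (\<Sum>b\<in>Basis. 2 - 2 * (fst p \<bullet> b))\<^sup>2"
  have CR: "\<bar>b \<bullet> z\<bar> < R" if "z \<in> C" "b \<in> Basis" for z b
    using R2[OF that(1)] Basis_le_norm[OF that(2), of z] R by (simp add: inner_commute)
  define Box where "Box = {z::'a. \<forall>b\<in>Basis. \<bar>b \<bullet> z\<bar> \<le> R}"
  have Box: "Box = cbox (\<Sum>b\<in>Basis. (-R) *\<^sub>R b) (\<Sum>b\<in>Basis. R *\<^sub>R b)"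
  proof (rule set_eqI)
    fix z
    have *: "(\<Sum>b\<in>Basis. r *\<^sub>R b) \<bullet> i = r" if "i \<in> Basis" for r and i :: 'a
      using that by (subst inner_sum_left_Basis) auto
    show "z \<in> Box \<longleftrightarrow> z \<in> cbox (\<Sum>b\<in>Basis. (-R) *\<^sub>R b) (\<Sum>b\<in>Basis. R *\<^sub>R b)"
      unfolding Box_def mem_box mem_Collect_eq
    proof (intro ball_cong refl)
      fix i :: 'a assume i: "i \<in> Basis"
      show "(\<bar>i \<bullet> z\<bar> \<le> R) = ((\<Sum>b\<in>Basis. (-R) *\<^sub>R b) \<bullet> i \<le> z \<bullet> i \<and> z \<bullet> i \<le> (\<Sum>b\<in>Basis. R *\<^sub>R b) \<bullet> i)"
        unfolding *[OF i] inner_commute[of i z] by (auto simp: abs_le_iff)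
    qed
  qed
  define K where "K = ?\<theta> ` C"
  have K: "compact K" "K \<noteq> {}" unfolding K_def using C(1) nonempty
      by (auto intro!: compact_continuous_image continuous_torus_map)
  have Wp_cont: "continuous_on S ?Wp" for S by (intro continuous_intros)
  have WpK: "0 < ?Wp p" if p: "p \<in> K" for p
  proof -
    from p obtain z where z: "z \<in> C" "p = ?\<theta> z" by (auto simp: K_def)
    have "0 < torus_weight a z"
    proof (rule torus_weight_pos)
      fix b :: 'a assume "b \<in> Basis"
      from mult_strict_left_mono[OF CR[OF z(1) this] a(1)] have "a * \<bar>b \<bullet> z\<bar> < pi"
        using R by (simp add: a_def)
      moreover have "\<bar>a * (b \<bullet> z)\<bar> = a * \<bar>b \<bullet> z\<bar>" using a by (simp add: abs_mult)
      ultimately show "\<bar>a * (b \<bullet> z)\<bar> < 2 * pi" using pi_gt_zero by linarith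
    qed (use z C U a in auto)
    thus ?thesis using z by (simp add: torus_weight_eq)
  qed
  obtain p0 where p0: "p0 \<in> K" "\<And>p. p \<in> K \<Longrightarrow> ?Wp p0 \<le> ?Wp p"
    using continuous_attains_inf[OF K Wp_cont] by blast
  define m where "m = ?Wp p0 / 2"
  have m: "m > 0" using WpK[OF p0(1)] by (simp add: m_def)
  define E where "E = ?\<theta> ` (Box - U)"
  have "compact (Box - U)" unfolding Box using U(1) by (intro compact_diff) auto
  hence E: "compact E" unfolding E_def by (intro compact_continuous_image continuous_torus_map)
  \<comment> \<open>Points of the torus that come from the box only through \<open>U\<close> and where the weight is
    bounded away from zero.\<close>
  define V where "V = - E \<inter> {p. m < ?Wp p}"
  have "open {p. m < ?Wp p}"
    using open_Collect_less[OF continuous_on_const Wp_cont[of UNIV]] by simp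
  hence V: "open V" using E unfolding V_def by (auto intro: compact_imp_closed)
  have KV: "K \<subseteq> V"
  proof
    fix p assume p: "p \<in> K"
    have "m < ?Wp p" using p0(2)[OF p] WpK[OF p0(1)] unfolding m_def by linarith
    moreover have "p \<notin> E"
    proof
      assume "p \<in> E"
      then obtain z' where z': "z' \<in> Box" "z' \<notin> U" "p = ?\<theta> z'" by (auto simp: E_def)
      obtain z where z: "z \<in> C" "p = ?\<theta> z" using p by (auto simp: K_def)
      have "z = z'" by (rule torus_map_eq_iff[OF a(1)]) (use CR[OF z(1)] z z' a Box_def in auto)
      thus False using z z' C by auto
    qed
    ultimately show "p \<in> V" by (simp add: V_def)
  qed
  obtain e where e: "e > 0" "\<And>p. infdist p K < e \<Longrightarrow> p \<in> V"
  proof -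
    obtain e where e: "e > 0" "(\<Union>x\<in>K. cball x e) \<subseteq> V"
        using compact_subset_open_imp_cball_epsilon_subset[OF K(1) V KV] by blast
    have in_Un: "p \<in> (\<Union>x\<in>K. cball x e)" if "infdist p K < e" for p
    proof -
      obtain x where "x \<in> K" "infdist p K = dist p x"
          using infdist_attains_inf[OF compact_imp_closed[OF K(1)] K(2)] by blast
      thus ?thesis using that by (auto simp: dist_commute intro!: bexI[of _ x])
    qed
    show thesis by (rule that[OF e(1)]) (use in_Un e(2) in blast)
  qed
  define \<Phi> where "\<Phi> p = max 0 (1 - infdist p K / e)" for p
  \<comment> \<open>The maximum makes the quotient continuous everywhere and changes nothing where
    \<open>\<Phi>\<close> is positive.\<close>
  define H where "H p = \<Phi> p / max m (?Wp p)" for p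
  have \<Phi>: "0 \<le> \<Phi> p" "\<Phi> p \<le> 1" for p using e(1) by (auto simp: \<Phi>_def infdist_nonneg)
  have \<Phi>V: "p \<in> V" if "\<Phi> p > 0" for p using that e(1)
      by (intro e(2)) (auto simp: \<Phi>_def field_simps max_def split: if_splits)
  have H_cont: "continuous_on UNIV H"
    unfolding H_def \<Phi>_def using m e(1) by (intro continuous_intros Wp_cont) auto
  have HW: "H (?\<theta> z) * torus_weight a z = \<Phi> (?\<theta> z)" for z
  proof (cases "\<Phi> (?\<theta> z) > 0")
    case True
    from \<Phi>V[OF this] have "m < torus_weight a z" by (auto simp: V_def torus_weight_eq)
    thus ?thesis using m by (auto simp: H_def torus_weight_eq[symmetric])
  next
    case False
    hence "\<Phi> (?\<theta> z) = 0" using \<Phi>(1)[of "?\<theta> z"] by linarith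
    thus ?thesis by (simp add: H_def)
  qed
  have lim: "((\<lambda>h. expectation (\<lambda>\<omega>. \<Phi> (?\<theta> (X h \<omega>))) / h) \<longlongrightarrow> integral\<^sup>L \<nu> (\<lambda>z. \<Phi> (?\<theta> z)))
      (at_right 0)"
    using small_time_limit_torus[OF H_cont, of a] unfolding small_time_limit_def HW .
  have \<Phi>m[measurable]: "(\<lambda>z. \<Phi> (?\<theta> z)) \<in> borel_measurable borel"
    unfolding \<Phi>_def by (intro borel_measurable_continuous_onI continuous_intros
        continuous_torus_map) (use e in auto)
  have \<Phi>int: "integrable \<nu> (\<lambda>z. \<Phi> (?\<theta> z))"
  proof -
    have "\<bar>H p\<bar> \<le> 1 / m" for p using \<Phi>[of p] m by (auto simp: H_def intro!: frac_le)
    moreover have "(\<lambda>z. H (?\<theta> z)) \<in> borel_measurable borel"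
      by (intro borel_measurable_continuous_onI
          continuous_on_compose2[OF H_cont continuous_torus_map]) auto
    ultimately show ?thesis using integrable_torus_weight_mult(1)[of "\<lambda>z. H (?\<theta> z)" "1/m" a]
        by (simp add: HW)
  qed
  have C_sets[measurable]: "C \<in> sets \<nu>" using compact_imp_closed[OF C(1)] by simp
  have \<Phi>C: "\<Phi> (?\<theta> z) = 1" if "z \<in> C" for z using that by (simp add: \<Phi>_def K_def)
  have "measure \<nu> C \<le> integral\<^sup>L \<nu> (\<lambda>z. \<Phi> (?\<theta> z))"
  proof -
    have "emeasure \<nu> C < \<infinity>"
    proof -
      have "emeasure \<nu> C = (\<integral>\<^sup>+z. indicator C z \<partial>\<nu>)"
          by (rule nn_integral_indicator[OF C_sets, symmetric])
      also have "\<dots> \<le> (\<integral>\<^sup>+z. ennreal (\<Phi> (?\<theta> z)) \<partial>\<nu>)"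
        using \<Phi>C by (intro nn_integral_mono) (auto split: split_indicator)
      also have "\<dots> = ennreal (integral\<^sup>L \<nu> (\<lambda>z. \<Phi> (?\<theta> z)))" using \<Phi>int \<Phi>
          by (intro nn_integral_eq_integral) auto
      finally show ?thesis by (simp add: le_less_trans)
    qed
    hence "integrable \<nu> (indicator C :: 'a \<Rightarrow> real)" using C_sets
        by (simp only: integrable_indicator_iff) simp
    hence "integral\<^sup>L \<nu> (indicator C) \<le> integral\<^sup>L \<nu> (\<lambda>z. \<Phi> (?\<theta> z))"
      using \<Phi>int \<Phi>C \<Phi> by (intro integral_mono) (auto split: split_indicator)
    moreover have "space \<nu> = UNIV" using sets_eq_imp_space_eq[OF sets_nu] by simp
    ultimately show ?thesis by simp
  qed
  hence "c + \<delta> < integral\<^sup>L \<nu> (\<lambda>z. \<Phi> (?\<theta> z))" using \<delta> unfolding \<delta>_def by argo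
  hence "\<forall>\<^sub>F h in at_right 0. c + \<delta> < expectation (\<lambda>\<omega>. \<Phi> (?\<theta> (X h \<omega>))) / h"
      by (rule order_tendstoD(1)[OF lim])
  moreover have "\<forall>\<^sub>F h in at_right 0. (h::real) > 0" by (simp add: eventually_at_right_less)
  ultimately show ?thesis
  proof eventually_elim
    case (elim h)
    note h = elim(2)
    note measurable_X[OF less_imp_le[OF h], measurable]
    have [measurable]: "U \<in> sets borel" using U(1) by simp
    define A where "A = {\<omega> \<in> space M. X h \<omega> \<in> U}"
    define T where "T = {\<omega> \<in> space M. \<exists>b\<in>Basis. R \<le> \<bar>b \<bullet> X h \<omega>\<bar>}"
    have [measurable]: "A \<in> sets M" "T \<in> sets M" unfolding A_def T_def by measurable
    have pt: "\<Phi> (?\<theta> (X h \<omega>)) \<le> indicator A \<omega> + indicator T \<omega>" if \<omega>: "\<omega> \<in> space M" for \<omega>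
    proof (cases "\<omega> \<in> T \<or> \<omega> \<in> A")
      case False
      hence "X h \<omega> \<in> Box - U" using \<omega> by (force simp: A_def T_def Box_def)
      hence "?\<theta> (X h \<omega>) \<notin> V" by (auto simp: V_def E_def)
      hence "\<Phi> (?\<theta> (X h \<omega>)) \<le> 0" using \<Phi>V[of "?\<theta> (X h \<omega>)"] by linarith
      thus ?thesis by (rule order_trans) simp
    qed (use \<Phi>(2)[of "?\<theta> (X h \<omega>)"] in \<open>auto simp: indicator_def\<close>)
    have "expectation (\<lambda>\<omega>. \<Phi> (?\<theta> (X h \<omega>))) \<le> expectation (\<lambda>\<omega>. indicator A \<omega> + indicator T \<omega>)"
      using pt \<Phi> by (intro integral_mono integrable_bounded[of _ 1]
          Bochner_Integration.integrable_add)
        (auto simp: emeasure_eq_measure)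
    also have "\<dots> = prob A + prob T"
        by (subst Bochner_Integration.integral_add) (auto simp: emeasure_eq_measure)
    also have "prob T \<le> \<delta> * h" unfolding T_def by (rule R1[OF R(2) h])
    finally have "expectation (\<lambda>\<omega>. \<Phi> (?\<theta> (X h \<omega>))) \<le> prob A + \<delta> * h" by simp
    moreover have "(c + \<delta>) * h \<le> expectation (\<lambda>\<omega>. \<Phi> (?\<theta> (X h \<omega>)))" using elim(1) h
        by (simp add: field_simps)
    ultimately show ?case unfolding A_def[symmetric] by (simp add: algebra_simps)
  qed
qed

text \<open>
  Half of the vague convergence of \<open>P(X h \<in> dz) / h\<close> to the Levy measure away from the origin: exhaust
  \<open>U\<close> by compact sets.
\<close>

lemma small_time_lower_bound:
  assumes U: "open U" "0 \<notin> U" and c: "ennreal c < emeasure \<nu> U" "c \<ge> 0"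
  shows "\<forall>\<^sub>F h in at_right 0. c * h \<le> prob {\<omega> \<in> space M. X h \<omega> \<in> U}"
proof -
  define C where "C n = cball 0 (real n) \<inter> {z. 1 / real (Suc n) \<le> infdist z (- U)}" for n
  have "closed {z. 1 / real (Suc n) \<le> infdist z (- U)}" for n
    by (intro closed_Collect_le continuous_intros)
  hence C: "compact (C n)" for n unfolding C_def by (intro compact_Int_closed) auto
  have ne: "- U \<noteq> {}" using U by auto
  have CU: "C n \<subseteq> U" for n
  proof
    fix z assume z: "z \<in> C n"
    have "0 < 1 / real (Suc n)" by simp
    also have "\<dots> \<le> infdist z (- U)" using z by (simp add: C_def)
    finally have "0 < infdist z (- U)" .
    thus "z \<in> U" using infdist_zero[of z "- U"] by (cases "z \<in> U") auto
  qed
  have "(\<Union>n. C n) = U"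
  proof (intro antisym subsetI)
    fix z assume z: "z \<in> U"
    have "infdist z (- U) \<noteq> 0" using in_closed_iff_infdist_zero[of "- U" z] U ne z by auto
    hence "0 < infdist z (- U)" using infdist_nonneg[of z "- U"] by simp
    then obtain n where n: "inverse (real (Suc n)) < infdist z (- U)" using reals_Archimedean
        by blast
    obtain k where k: "norm z \<le> real k" using real_arch_simple by blast
    have "1 / real (Suc (max n k)) \<le> inverse (real (Suc n))" by (simp add: field_simps)
    hence "z \<in> C (max n k)" using n k by (auto simp: C_def)
    thus "z \<in> (\<Union>n. C n)" by blast
  qed (use CU in auto)
  moreover have "incseq C"
  proof (rule incseq_SucI)
    fix n
    have "1 / real (Suc (Suc n)) \<le> 1 / real (Suc n)" by (simp add: field_simps)
    thus "C n \<subseteq> C (Suc n)" unfolding C_def by (auto simp del: of_nat_Suc)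
  qed
  ultimately have "emeasure \<nu> U = (SUP n. emeasure \<nu> (C n))"
    using C by (subst SUP_emeasure_incseq) (auto simp: borel_compact)
  then obtain n where n: "ennreal c < emeasure \<nu> (C n)" using c by (auto simp: less_SUP_iff)
  show ?thesis
  proof (cases "emeasure \<nu> (C n) = \<infinity>")
    case False
    hence "c < measure \<nu> (C n)" using n c
        by (simp add: emeasure_eq_ennreal_measure ennreal_less_iff)
    thus ?thesis by (rule small_time_lower_bound_compact[OF U C CU])
  next
    case True
    have fin: "emeasure \<nu> (C n) < \<infinity>"
    proof -
      have "0 < 1 / real (Suc n)" by simp
      define k where "k = (min 1 (1 / real (Suc n)))\<^sup>2"
      have k: "k > 0" by (simp add: k_def)
      have "k \<le> min 1 ((norm z)\<^sup>2)" if "z \<in> C n" for z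
      proof -
        have "1 / real (Suc n) \<le> infdist z (- U)" using that by (simp add: C_def)
        also have "\<dots> \<le> dist z 0" using U by (intro infdist_le) auto
        finally have "min 1 (1 / real (Suc n)) \<le> norm z" by simp
        hence "k \<le> (norm z)\<^sup>2" unfolding k_def by (intro power_mono) auto
        moreover have "k \<le> 1" unfolding k_def by (intro power_le_one) auto
        ultimately show ?thesis by simp
      qed
      hence "(\<integral>\<^sup>+z. ennreal k * indicator (C n) z \<partial>\<nu>) \<le> (\<integral>\<^sup>+z. ennreal (min 1 ((norm z)\<^sup>2)) \<partial>\<nu>)"
        by (intro nn_integral_mono) (auto split: split_indicator intro: ennreal_leI)
      hence "ennreal k * emeasure \<nu> (C n) < \<infinity>"
        using nu_moment C by (subst (asm) nn_integral_cmult_indicator)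
            (auto simp: borel_compact intro: le_less_trans)
      thus ?thesis using k by (auto simp: ennreal_mult_less_top)
    qed
    thus ?thesis using True by simp
  qed
qed

end

section \<open>Markov property and optional times\<close>

context cadlag_symmetric_levy
begin

definition past :: "real \<Rightarrow> 'w measure" where
  "past s = sigma (space M) {X v -` B \<inter> space M | v B. 0 \<le> v \<and> v \<le> s \<and> B \<in> sets borel}"

lemma space_past [simp]: "space (past s) = space M"
  unfolding past_def by (rule space_measure_of) auto

lemma sets_past: "sets (past s)
    = sigma_sets (space M) {X v -` B \<inter> space M | v B. 0 \<le> v \<and> v \<le> s \<and> B \<in> sets borel}"
  unfolding past_def by (rule sets_measure_of) auto

lemma measurable_past_X: "0 \<le> v \<Longrightarrow> v \<le> s \<Longrightarrow> X v \<in> borel_measurable (past s)"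
  by (rule measurableI) (auto simp: sets_past intro!: sigma_sets.Basic)

lemma sets_past_subset: "sets (past s) \<subseteq> sets M"
  unfolding sets_past using measurable_X by (intro sets.sigma_sets_subset) auto

lemma measurable_past_M: "f \<in> measurable (past s) N \<Longrightarrow> f \<in> measurable M N"
  using sets_past_subset by (auto simp: measurable_def)

lemma sets_past_mono: "s \<le> t \<Longrightarrow> sets (past s) \<subseteq> sets (past t)"
  unfolding sets_past by (intro sigma_sets_mono') (blast intro: order_trans)

definition cylinders :: "real \<Rightarrow> 'w set set" where
  "cylinders s = {A. \<exists>J B. finite J \<and> J \<subseteq> {0..s} \<and> (\<forall>v. B v \<in> sets borel) \<and> A
      = {\<omega> \<in> space M. \<forall>v\<in>J. X v \<omega> \<in> B v}}"

lemma sets_past_cylinders: "sets (past s) = sigma_sets (space M) (cylinders s)"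
proof (intro antisym)
  show "sets (past s) \<subseteq> sigma_sets (space M) (cylinders s)"
    unfolding sets_past
  proof (intro sigma_sets_mono subsetI)
    fix A assume "A \<in> {X v -` B \<inter> space M | v B. 0 \<le> v \<and> v \<le> s \<and> B \<in> sets borel}"
    then obtain v B where "0 \<le> v" "v \<le> s" "B \<in> sets borel" "A = X v -` B \<inter> space M" by auto
    thus "A \<in> sigma_sets (space M) (cylinders s)"
      unfolding cylinders_def by (intro sigma_sets.Basic CollectI exI[of _ "{v}"]
          exI[of _ "\<lambda>_. B"]) auto
  qed
  have "cylinders s \<subseteq> sets (past s)"
  proof
    fix A assume "A \<in> cylinders s"
    then obtain J B where J: "finite J" "J \<subseteq> {0..s}" "\<And>v. B v \<in> sets borel"
        "A = {\<omega> \<in> space M. \<forall>v\<in>J. X v \<omega> \<in> B v}"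
      unfolding cylinders_def by blast
    have "{\<omega> \<in> space (past s). \<forall>v\<in>J. X v \<omega> \<in> B v} \<in> sets (past s)"
    proof (rule sets.sets_Collect_finite_All[OF _ J(1)])
      fix v assume "v \<in> J"
      thus "{\<omega> \<in> space (past s). X v \<omega> \<in> B v} \<in> sets (past s)"
        using J(2) measurable_sets[OF measurable_past_X[of v s] J(3)[of v]]
        by (auto simp: vimage_def Int_def conj_commute)
    qed
    thus "A \<in> sets (past s)" using J by simp
  qed
  thus "sigma_sets (space M) (cylinders s) \<subseteq> sets (past s)"
    using sets.sigma_sets_subset[of "cylinders s" "past s"] by simp
qed

lemma Int_stable_cylinders: "Int_stable (cylinders s)"
proof (rule Int_stableI)
  fix A1 A2 assume "A1 \<in> cylinders s" "A2 \<in> cylinders s"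
  then obtain J1 B1 J2 B2 where 1: "finite J1" "J1 \<subseteq> {0..s}" "\<And>v. B1 v \<in> sets borel"
      "A1 = {\<omega> \<in> space M. \<forall>v\<in>J1. X v \<omega> \<in> B1 v}"
    and 2: "finite J2" "J2 \<subseteq> {0..s}" "\<And>v. B2 v \<in> sets borel"
        "A2 = {\<omega> \<in> space M. \<forall>v\<in>J2. X v \<omega> \<in> B2 v}"
    unfolding cylinders_def by blast
  define B where "B v = (if v \<in> J1 then B1 v else UNIV) \<inter> (if v \<in> J2 then B2 v else UNIV)" for v
  have "A1 \<inter> A2 = {\<omega> \<in> space M. \<forall>v\<in>J1 \<union> J2. X v \<omega> \<in> B v}" unfolding 1 2 B_def by auto
  moreover have "B v \<in> sets borel" for v using 1(3) 2(3) by (auto simp: B_def)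
  ultimately show "A1 \<inter> A2 \<in> cylinders s"
    unfolding cylinders_def using 1 2 by (intro CollectI exI[of _ "J1 \<union> J2"] exI[of _ B]) auto
qed

text \<open>
  A cylinder event depends only on the increments between consecutive time points of the cylinder,
  after \<open>0\<close> and \<open>s\<close> have been inserted among them; these are independent of the increment from \<open>s\<close> to
  \<open>t\<close>.
\<close>

lemma cylinder_increment_indep:
  assumes s: "0 \<le> s" "s < t" and A: "A \<in> cylinders s" and C: "C \<in> sets borel"
  shows "prob (A \<inter> {\<omega> \<in> space M. X t \<omega> - X s \<omega> \<in> C})
      = prob A * prob {\<omega> \<in> space M. X t \<omega> - X s \<omega> \<in> C}"
proof -
  obtain J B where J: "finite J" "J \<subseteq> {0..s}" "\<And>v. B v \<in> sets borel"
      "A = {\<omega> \<in> space M. \<forall>v\<in>J. X v \<omega> \<in> B v}"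
    using A unfolding cylinders_def by blast
  define l where "l = sorted_list_of_set (insert 0 (insert s J))"
  define m where "m = length l - 1"
  have l: "sorted_wrt (<) l" "set l = insert 0 (insert s J)"
    using J(1) by (simp_all only: l_def strict_sorted_list_of_set set_sorted_list_of_set
        finite_insert)
  have lne: "l \<noteq> []" using l(2) by auto
  have len: "length l = Suc m" using lne by (simp add: m_def)
  \<comment> \<open>The time points of the cylinder in increasing order, from \<open>0\<close> to \<open>s\<close>, followed by \<open>t\<close>.\<close>
  define u where "u i = (if i \<le> m then l ! i else t)" for i
  have in_set: "l ! i \<in> {0..s}" if "i \<le> m" for i
    using nth_mem[of i l] that len l(2) J(2) s by (auto simp del: nth_mem)
  have u0: "u 0 = 0"
  proof -
    obtain k where k: "k < length l" "l ! k = 0" using l(2) by (metis in_set_conv_nth insertI1)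
    have "l ! 0 \<le> l ! k"
    proof (cases "k = 0")
      case False
      hence "l ! 0 < l ! k" using l(1) k(1) unfolding sorted_wrt_iff_nth_less by blast
      thus ?thesis by simp
    qed simp
    thus ?thesis using in_set[of 0] k by (simp add: u_def)
  qed
  have um: "u m = s"
  proof -
    obtain k where k: "k < length l" "l ! k = s" using l(2)
        by (metis in_set_conv_nth insertI1 insertI2)
    have "l ! k \<le> l ! m"
    proof (cases "k = m")
      case False
      hence "k < m" "m < length l" using k len by auto
      hence "l ! k < l ! m" using l(1) unfolding sorted_wrt_iff_nth_less by blast
      thus ?thesis by simp
    qed simp
    thus ?thesis using in_set[of m] k by (simp add: u_def)
  qed
  have inc: "u i < u (Suc i)" if "i < Suc m" for i
  proof (cases "i < m")
    case True thus ?thesis using l(1) len by (auto simp: u_def sorted_wrt_iff_nth_less)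
  next
    case False
    hence "i = m" using that by simp
    thus ?thesis using um s by (simp add: u_def)
  qed
  let ?D = "\<lambda>i \<omega>. X (u (Suc i)) \<omega> - X (u i) \<omega>"
  have indep: "indep_vars (\<lambda>_. borel) ?D {..<Suc m}"
    by (rule independent_increments) (use u0 inc in auto)
  have iv: "indep_var (PiM {..<m} (\<lambda>_. borel)) (\<lambda>\<omega>. restrict (\<lambda>i. ?D i \<omega>) {..<m})
                      (PiM {m} (\<lambda>_. borel)) (\<lambda>\<omega>. restrict (\<lambda>i. ?D i \<omega>) {m})"
    by (rule indep_var_restrict[OF indep]) auto
  have ix: "\<exists>j\<le>m. v = u j" if "v \<in> J" for v
  proof -
    have "v \<in> set l" using that l by simp
    then obtain j where "j < length l" "l ! j = v" by (auto simp: in_set_conv_nth)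
    thus ?thesis using len by (intro exI[of _ j]) (auto simp: u_def)
  qed
  define ind where "ind v = (SOME j. j \<le> m \<and> v = u j)" for v
  have ind: "ind v \<le> m \<and> v = u (ind v)" if "v \<in> J" for v
    unfolding ind_def by (rule someI_ex) (use ix[OF that] in blast)
  have tele: "X (u j) \<omega> = (\<Sum>i<j. restrict (\<lambda>i. ?D i \<omega>) {..<m} i)" if "j \<le> m" for j \<omega>
  proof -
    have "(\<Sum>i<j. restrict (\<lambda>i. ?D i \<omega>) {..<m} i) = (\<Sum>i<j. ?D i \<omega>)" using that
        by (intro sum.cong) auto
    also have "\<dots> = X (u j) \<omega> - X (u 0) \<omega>" by (rule sum_lessThan_telescope)
    finally show ?thesis using u0 X_zero by simp
  qed
  define E where "E = {f \<in> space (PiM {..<m} (\<lambda>_. borel :: 'a measure)). \<forall>v\<in>J. (\<Sum>i<ind v. f i)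
      \<in> B v}"
  have E: "E \<in> sets (PiM {..<m} (\<lambda>_. borel))"
    unfolding E_def
  proof (rule sets.sets_Collect_finite_All[OF _ J(1)])
    fix v assume v: "v \<in> J"
    have "(\<lambda>f. \<Sum>i<ind v. f i) \<in> borel_measurable (PiM {..<m} (\<lambda>_. borel :: 'a measure))"
      using ind[OF v] by (intro borel_measurable_sum measurable_component_singleton) auto
    thus "{f \<in> space (PiM {..<m} (\<lambda>_. borel)). (\<Sum>i<ind v. f i) \<in> B v}
        \<in> sets (PiM {..<m} (\<lambda>_. borel))"
      using J(3) by (auto intro!: measurable_sets_Collect)
  qed
  define G where "G = {f \<in> space (PiM {m} (\<lambda>_. borel :: 'a measure)). f m \<in> C}"
  have G: "G \<in> sets (PiM {m} (\<lambda>_. borel))"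
    unfolding G_def using C by (auto intro!: measurable_sets_Collect measurable_component_singleton)
  have "prob ((\<lambda>\<omega>. restrict (\<lambda>i. ?D i \<omega>) {..<m}) -` E \<inter> space M \<inter>
      ((\<lambda>\<omega>. restrict (\<lambda>i. ?D i \<omega>) {m}) -` G \<inter> space M)) =
     prob ((\<lambda>\<omega>. restrict (\<lambda>i. ?D i \<omega>) {..<m}) -` E \<inter> space M) * prob
         ((\<lambda>\<omega>. restrict (\<lambda>i. ?D i \<omega>) {m}) -` G \<inter> space M)"
    using iv E G unfolding indep_var_eq by (intro indep_setD) (auto intro!: sigma_sets.Basic)
  moreover have "(\<lambda>\<omega>. restrict (\<lambda>i. ?D i \<omega>) {..<m}) -` E \<inter> space M = A"
  proof -
    define dm where "dm \<omega> = restrict (\<lambda>i. ?D i \<omega>) {..<m}" for \<omega>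
    have dm: "dm \<omega> \<in> space (PiM {..<m} (\<lambda>_. borel :: 'a measure))" for \<omega>
      by (simp add: dm_def space_PiM)
    have mem: "(\<Sum>i<ind v. dm \<omega> i) = X v \<omega>" if "v \<in> J" for v \<omega>
      using tele[of "ind v" \<omega>] ind[OF that] unfolding dm_def by simp
    have "dm -` E \<inter> space M = A"
      unfolding J(4) E_def using mem dm by auto
    thus ?thesis unfolding dm_def .
  qed
  moreover have "(\<lambda>\<omega>. restrict (\<lambda>i. ?D i \<omega>) {m}) -` G \<inter> space M = {\<omega> \<in> space M. X t \<omega> - X s \<omega> \<in> C}"
    using um by (auto simp: G_def space_PiM u_def)
  ultimately show ?thesis by (simp only:)
qed

lemma past_increment_indep:
  assumes s: "0 \<le> s" "s < t" and A: "A \<in> sets (past s)" and C: "C \<in> sets borel"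
  shows "prob (A \<inter> {\<omega> \<in> space M. X t \<omega> - X s \<omega> \<in> C})
      = prob A * prob {\<omega> \<in> space M. X t \<omega> - X s \<omega> \<in> C}"
proof -
  have rv: "random_variable borel (\<lambda>\<omega>. X t \<omega> - X s \<omega>)"
    using measurable_X[of s] measurable_X[of t] s by auto
  let ?b = "{\<omega> \<in> space M. X t \<omega> - X s \<omega> \<in> C}"
  have b: "?b \<in> events" using rv C by (auto intro!: measurable_sets_Collect)
  have "indep_set (cylinders s) {?b}"
  proof (rule indep_setI)
    show "cylinders s \<subseteq> events"
      using sets_past_subset[of s] unfolding sets_past_cylinders by auto
  qed (use b cylinder_increment_indep[OF s _ C] in auto)
  hence "indep_set (sigma_sets (space M) (cylinders s)) (sigma_sets (space M) {?b})"
    by (rule indep_set_sigma_sets[OF _ Int_stable_cylinders]) (auto simp: Int_stable_def)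
  thus ?thesis using A unfolding sets_past_cylinders by (intro indep_setD) auto
qed

definition semigroup :: "real \<Rightarrow> ('a \<Rightarrow> real) \<Rightarrow> 'a \<Rightarrow> real" where
  "semigroup u f z = expectation (\<lambda>\<omega>. f (z + X u \<omega>))"

lemma semigroup_0 [simp]: "semigroup 0 f z = f z"
  by (simp add: semigroup_def X_zero prob_space)

lemma semigroup_bound:
  assumes "u \<ge> 0" "f \<in> borel_measurable borel" "\<And>z. \<bar>f z\<bar> \<le> B"
  shows "\<bar>semigroup u f z\<bar> \<le> B"
proof -
  note measurable_X[OF assms(1), measurable] assms(2)[measurable]
  have "0 \<le> B" using assms(3)[of 0] by linarith
  have "\<bar>semigroup u f z\<bar> \<le> expectation (\<lambda>\<omega>. \<bar>f (z + X u \<omega>)\<bar>)"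
    unfolding semigroup_def by (rule integral_abs_bound)
  also have "\<dots> \<le> expectation (\<lambda>\<omega>. B)"
    using assms(3) \<open>0 \<le> B\<close> by (intro integral_mono integrable_bounded[of _ B]) auto
  finally show ?thesis by (simp add: prob_space)
qed

lemma measurable_semigroup:
  assumes "u \<ge> 0" and [measurable]: "f \<in> borel_measurable borel"
  shows "semigroup u f \<in> borel_measurable borel"
proof -
  note measurable_X[OF assms(1), measurable]
  show ?thesis unfolding semigroup_def[abs_def] by measurable
qed

text \<open>
  The joint law of the past and the next increment is a product measure, so integrating out the
  increment replaces \<open>f (X t)\<close> by \<open>semigroup (t - s) f (X s)\<close>.
\<close>

lemma markov_property:
  assumes s: "0 \<le> s" "s \<le> t"
    and V: "V \<in> borel_measurable (past s)" "\<And>\<omega>. \<bar>V \<omega>\<bar> \<le> B"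
    and f: "f \<in> borel_measurable borel" "\<And>z. \<bar>f z\<bar> \<le> C"
  shows "expectation (\<lambda>\<omega>. V \<omega> * f (X t \<omega>)) = expectation (\<lambda>\<omega>. V \<omega> * semigroup (t - s) f (X s \<omega>))"
proof (cases "s = t")
  case False
  hence st: "s < t" using s by simp
  have B0: "0 \<le> B" using V(2)[of undefined] by linarith
  note f(1)[measurable] V(1)[measurable]
  note measurable_past_X[of s s, measurable]
  let ?W = "\<lambda>\<omega>. X t \<omega> - X s \<omega>"
  have Wm[measurable]: "?W \<in> borel_measurable M" using measurable_X[of s] measurable_X[of t] s
      by auto
  have Xm[measurable]: "X (t - s) \<in> borel_measurable M" using s by (intro measurable_X) auto
  have idm[measurable]: "(\<lambda>\<omega>. \<omega>) \<in> measurable M (past s)" by (rule measurable_past_M[of _ s]) simp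
  have law: "distr M borel ?W = distr M borel (X (t - s))"
    using stationary_increments[of s "t - s"] s by simp
  define F where "F = (\<lambda>(\<omega>, z). V \<omega> * f (X s \<omega> + z))"
  have Fm[measurable]: "F \<in> borel_measurable (past s \<Otimes>\<^sub>M borel)"
    unfolding F_def using s by measurable
  define Q where "Q = distr M (past s) (\<lambda>\<omega>. \<omega>)"
  define R where "R = distr M borel ?W"
  interpret Q: prob_space Q unfolding Q_def by (rule prob_space_distr) simp
  interpret R: prob_space R unfolding R_def by (rule prob_space_distr) simp
  interpret QR: pair_prob_space Q R ..
  have "expectation (\<lambda>\<omega>. V \<omega> * f (X t \<omega>)) = expectation (\<lambda>\<omega>. F (\<omega>, ?W \<omega>))" by (simp add: F_def)
  also have "\<dots> = integral\<^sup>L (distr M (past s \<Otimes>\<^sub>M borel) (\<lambda>\<omega>. (\<omega>, ?W \<omega>))) F"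
    by (subst integral_distr) auto
  also have "distr M (past s \<Otimes>\<^sub>M borel) (\<lambda>\<omega>. (\<omega>, ?W \<omega>)) = Q \<Otimes>\<^sub>M R"
  proof (rule pair_measure_eqI[symmetric])
    show "sigma_finite_measure Q" "sigma_finite_measure R" by unfold_locales
    show "sets (Q \<Otimes>\<^sub>M R) = sets (distr M (past s \<Otimes>\<^sub>M borel) (\<lambda>\<omega>. (\<omega>, ?W \<omega>)))"
      unfolding sets_distr by (intro sets_pair_measure_cong) (auto simp: Q_def R_def)
    fix A C assume AC: "A \<in> sets Q" "C \<in> sets R"
    hence A: "A \<in> sets (past s)" "A \<in> sets M" and C: "C \<in> sets borel"
      using sets_past_subset by (auto simp: Q_def R_def)
    have "A \<subseteq> space M" using A(2) by (rule sets.sets_into_space)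
    hence "emeasure Q A = prob A" "emeasure R C = prob {\<omega> \<in> space M. ?W \<omega> \<in> C}"
      "emeasure (distr M (past s \<Otimes>\<^sub>M borel) (\<lambda>\<omega>. (\<omega>, ?W \<omega>))) (A \<times> C)
          = prob (A \<inter> {\<omega> \<in> space M. ?W \<omega> \<in> C})"
      unfolding Q_def R_def using A C
      by (auto simp: emeasure_distr emeasure_eq_measure intro!: arg_cong[where f=prob])
    thus "emeasure Q A * emeasure R C
        = emeasure (distr M (past s \<Otimes>\<^sub>M borel) (\<lambda>\<omega>. (\<omega>, ?W \<omega>))) (A \<times> C)"
      using past_increment_indep[OF s(1) st A(1) C] by (simp add: ennreal_mult)
  qed
  also have "integral\<^sup>L (Q \<Otimes>\<^sub>M R) F = (\<integral>\<omega>. (\<integral>z. F (\<omega>, z) \<partial>R) \<partial>Q)"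
  proof (rule QR.integral_fst'[symmetric])
    have "sets (Q \<Otimes>\<^sub>M R) = sets (past s \<Otimes>\<^sub>M borel)"
        by (intro sets_pair_measure_cong) (auto simp: Q_def R_def)
    hence "F \<in> borel_measurable (Q \<Otimes>\<^sub>M R)" using Fm measurable_cong_sets by blast
    moreover have "norm (F x) \<le> B * C" for x
      using V(2)[of "fst x"] f(2)[of "X s (fst x) + snd x"] B0
      by (auto simp: F_def abs_mult split_def intro!: mult_mono)
    ultimately show "integrable (Q \<Otimes>\<^sub>M R) F" by (intro QR.integrable_const_bound[where B="B * C"])
        auto
  qed
  also have "\<dots> = (\<integral>\<omega>. V \<omega> * semigroup (t - s) f (X s \<omega>) \<partial>Q)"
  proof (intro Bochner_Integration.integral_cong refl)
    fix \<omega>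
    have "(\<integral>z. F (\<omega>, z) \<partial>R) = V \<omega> * (\<integral>z. f (X s \<omega> + z) \<partial>R)" by (simp add: F_def)
    also have "(\<integral>z. f (X s \<omega> + z) \<partial>R) = semigroup (t - s) f (X s \<omega>)"
      unfolding R_def law semigroup_def by (subst integral_distr) auto
    finally show "(\<integral>z. F (\<omega>, z) \<partial>R) = V \<omega> * semigroup (t - s) f (X s \<omega>)" .
  qed
  also have "\<dots> = expectation (\<lambda>\<omega>. V \<omega> * semigroup (t - s) f (X s \<omega>))"
    unfolding Q_def
  proof (subst integral_distr)
    have [measurable]: "semigroup (t - s) f \<in> borel_measurable borel" using s
        by (intro measurable_semigroup f) auto
    show "(\<lambda>\<omega>. V \<omega> * semigroup (t - s) f (X s \<omega>)) \<in> borel_measurable (past s)" using s by measurable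
  qed auto
  finally show ?thesis .
qed simp

lemma cadlag_right_sequence:
  fixes w :: "real \<Rightarrow> 'a"
  assumes "cadlag w" "c \<ge> 0" "\<And>n. c \<le> s n" "s \<longlonglongrightarrow> c"
  shows "(\<lambda>n. w (s n)) \<longlonglongrightarrow> w c"
proof -
  have "(w \<longlongrightarrow> w c) (at_right c)" using assms(1,2) by (auto simp: cadlag_def)
  hence "continuous (at c within {c..}) w" by (simp add: continuous_within at_within_Ici_at_right)
  thus ?thesis using assms(3,4) unfolding continuous_within_sequentially by (auto simp: o_def)
qed

lemma cadlag_left_sequence:
  fixes w :: "real \<Rightarrow> 'a"
  assumes w: "cadlag w" and s: "incseq s" "s \<longlonglongrightarrow> c" "\<And>n. 0 \<le> s n"
  shows "convergent (\<lambda>n. w (s n))"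
proof (cases "\<exists>n. s n = c")
  case True
  then obtain n where n: "s n = c" by blast
  have le: "s k \<le> c" for k by (rule incseq_le[OF s(1,2)])
  have "s k = c" if "k \<ge> n" for k using incseqD[OF s(1) that] n le[of k] by simp
  hence "\<forall>\<^sub>F k in sequentially. w (s k) = w c" by (auto simp: eventually_sequentially)
  thus ?thesis by (auto simp: convergent_def intro: tendsto_eventually)
next
  case False
  have le: "s k \<le> c" for k by (rule incseq_le[OF s(1,2)])
  hence lt: "s k < c" for k using False le[of k] by (auto simp: less_le)
  hence "c > 0" using s(3)[of 0] lt[of 0] by linarith
  then obtain l where l: "(w \<longlongrightarrow> l) (at_left c)" using w by (auto simp: cadlag_def)
  have "filterlim s (at_left c) sequentially"
    using s(2) lt by (auto simp: filterlim_at intro!: always_eventually less_imp_neq)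
  from filterlim_compose[OF l this] show ?thesis by (auto simp: convergent_def)
qed

text \<open>
  The first point of the grid \<open>t * j / N\<close> strictly after \<open>S\<close>, or the last grid point if \<open>S\<close> is not below
  \<open>t\<close>. The strict inequality is what makes the discretisation of an optional time depend on the past
  up to the grid point only.
\<close>

definition grid_index :: "real \<Rightarrow> nat \<Rightarrow> ereal \<Rightarrow> nat" where
  "grid_index t N S = (LEAST j. N \<le> j \<or> S < ereal (t * real j / real N))"

text \<open>
  The minimum of \<open>S\<close> and \<open>t\<close> as a real number; for \<open>0 \<le> S\<close> it is the limit of the grid times from the
  right.
\<close>

definition capped :: "real \<Rightarrow> ereal \<Rightarrow> real" where
  "capped t S = real_of_ereal (min S (ereal t))"

lemma capped_bounds: "0 \<le> S \<Longrightarrow> 0 \<le> t \<Longrightarrow> 0 \<le> capped t S" "0 \<le> S \<Longrightarrow> 0 \<le> t \<Longrightarrow> capped t S \<le> t"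
  unfolding capped_def by (cases S; simp add: min_def)+

lemma capped_less: "0 \<le> S \<Longrightarrow> S < ereal t \<Longrightarrow> S = ereal (capped t S)"
  unfolding capped_def by (cases S; simp add: min_def)

lemma capped_not_less: "\<not> S < ereal t \<Longrightarrow> capped t S = t"
  unfolding capped_def by (cases S; simp add: min_def)

lemma capped_mono: "0 \<le> S \<Longrightarrow> S \<le> S' \<Longrightarrow> 0 \<le> t \<Longrightarrow> capped t S \<le> capped t S'"
  unfolding capped_def by (cases S; cases S'; auto simp: min_def)

lemma grid_index_le: "grid_index t N S \<le> N"
  unfolding grid_index_def by (rule Least_le) simp

lemma grid_index_le_iff:
  assumes "t > 0" "j < N"
  shows "grid_index t N S \<le> j \<longleftrightarrow> S < ereal (t * real j / real N)"
proof
  assume j: "grid_index t N S \<le> j"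
  define i where "i = grid_index t N S"
  have "N \<le> i \<or> S < ereal (t * real i / real N)"
    unfolding i_def grid_index_def by (rule LeastI[of _ N]) simp
  hence "S < ereal (t * real i / real N)" using j assms by (auto simp: i_def)
  also have "\<dots> \<le> ereal (t * real j / real N)"
    using j assms by (simp add: i_def divide_right_mono mult_left_mono)
  finally show "S < ereal (t * real j / real N)" .
next
  assume "S < ereal (t * real j / real N)"
  thus "grid_index t N S \<le> j" unfolding grid_index_def by (intro Least_le) simp
qed

lemma grid_index_mono:
  assumes "S \<le> S'" "t > 0"
  shows "grid_index t N S \<le> grid_index t N S'"
proof (cases "grid_index t N S' < N")
  case True
  with grid_index_le_iff[OF assms(2) True, of S'] have
      "S' < ereal (t * real (grid_index t N S') / real N)" by simp
  hence "S < ereal (t * real (grid_index t N S') / real N)" using assms(1)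
      by (rule le_less_trans[rotated])
  thus ?thesis using grid_index_le_iff[OF assms(2) True, of S] by simp
qed (use grid_index_le[of t N S] in simp)

lemma grid_time_bounds:
  assumes "t > 0" "N > 0" "0 \<le> S"
  shows "capped t S \<le> t * real (grid_index t N S) / real N"
    and "t * real (grid_index t N S) / real N \<le> capped t S + t / real N"
proof -
  define j where "j = grid_index t N S"
  have jN: "j \<le> N" unfolding j_def by (rule grid_index_le)
  have tj: "t * real j / real N \<le> t" using jN assms by (simp add: field_simps)
  have j0: "j > 0"
  proof (rule ccontr)
    assume "\<not> j > 0"
    hence "grid_index t N S \<le> 0" by (simp add: j_def)
    hence "S < 0" using grid_index_le_iff[OF assms(1,2), of S] by (simp add: zero_ereal_def)
    thus False using assms(3) by simp
  qed
  have "\<not> grid_index t N S \<le> j - 1" "j - 1 < N" using j0 jN by (auto simp: j_def)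
  with grid_index_le_iff[OF assms(1) this(2), of S] have prev:
      "ereal (t * real (j - 1) / real N) \<le> S" by simp
  have step: "t * real j / real N = t * real (j - 1) / real N + t / real N"
    using j0 by (cases j) (auto simp: add_divide_distrib[symmetric] distrib_left)
  have "capped t S \<le> t * real j / real N \<and> t * real (j - 1) / real N \<le> capped t S"
  proof (cases "S < ereal t")
    case True
    note S = capped_less[OF assms(3) True]
    have "t * real (j - 1) / real N \<le> capped t S" using prev by (subst (asm) S) simp
    moreover have "capped t S \<le> t * real j / real N"
    proof (cases "j < N")
      case True
      with grid_index_le_iff[OF assms(1) True, of S] have "S < ereal (t * real j / real N)"
          by (simp add: j_def)
      thus ?thesis by (subst (asm) S) simp
    next
      case False
      hence "t * real j / real N = t" using jN assms by simp
      thus ?thesis using True by (subst (asm) S) simp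
    qed
    ultimately show ?thesis by simp
  next
    case False
    note c = capped_not_less[OF False]
    have "j = N"
    proof (rule ccontr)
      assume "j \<noteq> N"
      hence jl: "j < N" using jN by simp
      with grid_index_le_iff[OF assms(1) jl, of S] have "S < ereal (t * real j / real N)"
          by (simp add: j_def)
      also have "\<dots> \<le> ereal t" using tj by simp
      finally show False using False by simp
    qed
    moreover have "t * real (j - 1) / real N \<le> t * real j / real N" using assms
        by (simp add: divide_right_mono mult_left_mono)
    ultimately show ?thesis using c tj assms by simp
  qed
  thus "capped t S \<le> t * real (grid_index t N S) / real N"
    "t * real (grid_index t N S) / real N \<le> capped t S + t / real N"
    using step by (auto simp: j_def)
qed

lemma grid_time_tendsto:
  assumes "t > 0" "0 \<le> S"
  shows "(\<lambda>n. t * real (grid_index t (Suc n) S) / real (Suc n)) \<longlonglongrightarrow> capped t S"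
proof (rule tendsto_sandwich)
  show "\<forall>\<^sub>F n in sequentially. capped t S \<le> t * real (grid_index t (Suc n) S) / real (Suc n)"
    "\<forall>\<^sub>F n in sequentially. t * real (grid_index t (Suc n) S) / real (Suc n) \<le> capped t S
        + t / real (Suc n)"
    using grid_time_bounds[OF assms(1) _ assms(2)] by (auto simp del: of_nat_Suc)
  have "(\<lambda>n. capped t S + t * inverse (real (Suc n))) \<longlonglongrightarrow> capped t S + t * 0"
    by (intro tendsto_intros LIMSEQ_inverse_real_of_nat)
  thus "(\<lambda>n. capped t S + t / real (Suc n)) \<longlonglongrightarrow> capped t S" by (simp add: field_simps)
qed simp

text \<open>
  Optional in the sense of strict inequalities, which suffices because \<open>grid_index\<close> only compares \<open>S\<close>
  strictly with grid points. Extended values allow the process never to reach its target.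
\<close>

definition optional_time :: "real \<Rightarrow> ('w \<Rightarrow> ereal) \<Rightarrow> bool" where
  "optional_time t S \<longleftrightarrow> (\<forall>\<omega>. 0 \<le> S \<omega>)
      \<and> (\<forall>u. 0 < u \<longrightarrow> u \<le> t \<longrightarrow> {\<omega> \<in> space M. S \<omega> < ereal u} \<in> sets (past u))"

lemma optional_time_nonneg: "optional_time t S \<Longrightarrow> 0 \<le> S \<omega>"
  by (auto simp: optional_time_def)

lemma grid_index_past:
  assumes "optional_time t S" "t > 0" "j \<le> N" "N > 0"
  shows "{\<omega> \<in> space M. grid_index t N (S \<omega>) = j} \<in> sets (past (t * real j / real N))"
proof -
  have le: "{\<omega> \<in> space M. grid_index t N (S \<omega>) \<le> i} \<in> sets (past (t * real j / real N))"
      if "i < N" "i \<le> j" for i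
  proof (cases "i = 0")
    case True
    have "{\<omega> \<in> space M. S \<omega> < 0} = {}" using optional_time_nonneg[OF assms(1)]
        by (auto simp: not_less)
    moreover have "(grid_index t N (S \<omega>) \<le> i) = (S \<omega> < 0)" for \<omega>
      using grid_index_le_iff[OF assms(2) that(1)] True by (simp add: zero_ereal_def[symmetric])
    ultimately show ?thesis by (simp only: sets.empty_sets)
  next
    case False
    define u where "u = t * real i / real N"
    have u: "0 < u" "u \<le> t" using False assms that by (auto simp: u_def field_simps)
    have "u \<le> t * real j / real N" using assms that
        by (auto simp: u_def intro!: divide_right_mono mult_left_mono)
    moreover have "{\<omega> \<in> space M. S \<omega> < ereal u} \<in> sets (past u)" using assms(1) u
        by (auto simp: optional_time_def)
    ultimately show ?thesis using sets_past_mono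
        unfolding grid_index_le_iff[OF assms(2) that(1)] u_def by blast
  qed
  have le': "{\<omega> \<in> space M. grid_index t N (S \<omega>) \<le> j} \<in> sets (past (t * real j / real N))"
  proof (cases "j < N")
    case False
    hence "{\<omega> \<in> space M. grid_index t N (S \<omega>) \<le> j} = space (past (t * real j / real N))"
      using grid_index_le[of t N] assms(3) by auto
    thus ?thesis by (simp only: sets.top)
  qed (use le in auto)
  show ?thesis
  proof (cases "j = 0")
    case True
    thus ?thesis using le' by simp
  next
    case False
    have "{\<omega> \<in> space M. grid_index t N (S \<omega>) = j} = {\<omega> \<in> space M. grid_index t N (S \<omega>) \<le> j}
        - {\<omega> \<in> space M. grid_index t N (S \<omega>) \<le> j - 1}"
      using False by auto
    thus ?thesis using le[of "j - 1"] le' False assms(3) by auto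
  qed
qed

lemma measurable_grid_index:
  assumes "optional_time t S" "t > 0" "N > 0"
  shows "(\<lambda>\<omega>. grid_index t N (S \<omega>)) \<in> measurable M (count_space UNIV)"
proof (rule measurable_count_space_eq2_countable[THEN iffD2])
  show "(\<lambda>\<omega>. grid_index t N (S \<omega>)) \<in> space M \<rightarrow> UNIV
      \<and> (\<forall>a\<in>UNIV. (\<lambda>\<omega>. grid_index t N (S \<omega>)) -` {a} \<inter> space M \<in> sets M)"
  proof safe
    fix j
    have "{\<omega> \<in> space M. grid_index t N (S \<omega>) = j} \<in> sets M"
    proof (cases "j \<le> N")
      case True
      thus ?thesis using grid_index_past[OF assms(1,2) _ assms(3)] sets_past_subset by blast
    next
      case False
      hence "{\<omega> \<in> space M. grid_index t N (S \<omega>) = j} = {}" using grid_index_le[of t N] by auto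
      thus ?thesis by (simp only: sets.empty_sets)
    qed
    moreover have "(\<lambda>\<omega>. grid_index t N (S \<omega>)) -` {j} \<inter> space M
        = {\<omega> \<in> space M. grid_index t N (S \<omega>) = j}" by auto
    ultimately show "(\<lambda>\<omega>. grid_index t N (S \<omega>)) -` {j} \<inter> space M \<in> sets M" by simp
  qed auto
qed

lemma measurable_X_grid:
  assumes "optional_time t S" "t > 0" "N > 0"
  shows "(\<lambda>\<omega>. X (t * real (grid_index t N (S \<omega>)) / real N) \<omega>) \<in> borel_measurable M"
  by (rule measurable_compose_countable[OF _ measurable_grid_index[OF assms]])
     (use assms in \<open>auto intro!: measurable_X\<close>)

lemma X_grid_tendsto:
  assumes "0 \<le> S" "t > 0"
  shows "(\<lambda>n. X (t * real (grid_index t (Suc n) S) / real (Suc n)) \<omega>) \<longlonglongrightarrow> X (capped t S) \<omega>"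
proof (rule cadlag_right_sequence[OF cadlag_X])
  show "0 \<le> capped t S" using assms by (intro capped_bounds) auto
  show "capped t S \<le> t * real (grid_index t (Suc n) S) / real (Suc n)" for n
    by (rule grid_time_bounds(1)[OF assms(2) zero_less_Suc assms(1)])
  show "(\<lambda>n. t * real (grid_index t (Suc n) S) / real (Suc n)) \<longlonglongrightarrow> capped t S"
    by (rule grid_time_tendsto[OF assms(2,1)])
qed

lemma measurable_capped:
  assumes "optional_time t S" "t > 0"
  shows "(\<lambda>\<omega>. capped t (S \<omega>)) \<in> borel_measurable M"
proof (rule borel_measurable_LIMSEQ_metric)
  show "(\<lambda>\<omega>. t * real (grid_index t (Suc n) (S \<omega>)) / real (Suc n)) \<in> borel_measurable M" for n
    by (rule measurable_compose_countable[OF _ measurable_grid_index[OF assms, of "Suc n"]]) auto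
  show "(\<lambda>n. t * real (grid_index t (Suc n) (S \<omega>)) / real (Suc n)) \<longlonglongrightarrow> capped t (S \<omega>)" for \<omega>
    using grid_time_tendsto[OF assms(2) optional_time_nonneg[OF assms(1)]] .
qed

lemma measurable_X_capped:
  assumes "optional_time t S" "t > 0"
  shows "(\<lambda>\<omega>. X (capped t (S \<omega>)) \<omega>) \<in> borel_measurable M"
proof (rule borel_measurable_LIMSEQ_metric)
  show "(\<lambda>\<omega>. X (t * real (grid_index t (Suc n) (S \<omega>)) / real (Suc n)) \<omega>) \<in> borel_measurable M" for n
    using measurable_X_grid[OF assms, of "Suc n"] by simp
  show "(\<lambda>n. X (t * real (grid_index t (Suc n) (S \<omega>)) / real (Suc n)) \<omega>) \<longlonglongrightarrow> X (capped t (S \<omega>)) \<omega>"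
      for \<omega>
    using X_grid_tendsto[OF optional_time_nonneg[OF assms(1)] assms(2)] .
qed

end

section \<open>Optional sampling and quasi-left-continuity\<close>

lemma abs_mult_le_one:
  fixes a b :: real
  assumes "\<bar>a\<bar> \<le> 1" "\<bar>b\<bar> \<le> 1"
  shows "\<bar>a * b\<bar> \<le> 1"
  using mult_mono[OF assms] by (simp add: abs_mult)

context cadlag_symmetric_levy
begin

lemma expectation_grid_split:
  fixes g :: "nat \<Rightarrow> 'w \<Rightarrow> real"
  assumes S: "optional_time t S" "t > 0" "N > 0"
    and g: "\<And>j. j \<le> N \<Longrightarrow> g j \<in> borel_measurable M" "\<And>j \<omega>. j \<le> N \<Longrightarrow> \<bar>g j \<omega>\<bar> \<le> B"
  shows "expectation (\<lambda>\<omega>. g (grid_index t N (S \<omega>)) \<omega>) =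
    (\<Sum>j\<le>N. expectation (\<lambda>\<omega>. indicator {\<omega> \<in> space M. grid_index t N (S \<omega>) = j} \<omega> * g j \<omega>))"
proof -
  let ?E = "\<lambda>j. {\<omega> \<in> space M. grid_index t N (S \<omega>) = j}"
  have E: "?E j \<in> sets M" if "j \<le> N" for j
    using grid_index_past[OF S(1,2) that S(3)] sets_past_subset by blast
  have "expectation (\<lambda>\<omega>. g (grid_index t N (S \<omega>)) \<omega>)
      = expectation (\<lambda>\<omega>. \<Sum>j\<le>N. indicator (?E j) \<omega> * g j \<omega>)"
  proof (intro Bochner_Integration.integral_cong refl)
    fix \<omega> assume \<omega>: "\<omega> \<in> space M"
    have "(\<Sum>j\<le>N. indicator (?E j) \<omega> * g j \<omega>)
        = (\<Sum>j\<in>{grid_index t N (S \<omega>)}. indicator (?E j) \<omega> * g j \<omega>)"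
      using grid_index_le[of t N "S \<omega>"] by (intro sum.mono_neutral_right) (auto simp: indicator_def)
    thus "g (grid_index t N (S \<omega>)) \<omega> = (\<Sum>j\<le>N. indicator (?E j) \<omega> * g j \<omega>)" using \<omega> by simp
  qed
  also have "\<dots> = (\<Sum>j\<le>N. expectation (\<lambda>\<omega>. indicator (?E j) \<omega> * g j \<omega>))"
  proof (rule Bochner_Integration.integral_sum)
    fix j assume "j \<in> {..N}"
    hence j: "j \<le> N" by simp
    note E[OF j, measurable] g(1)[OF j, measurable]
    have B: "0 \<le> B" using g(2)[OF j, of undefined] by linarith
    show "integrable M (\<lambda>\<omega>. indicator (?E j) \<omega> * g j \<omega>)"
    proof (rule integrable_bounded[of _ B])
      show "(\<lambda>\<omega>. indicat_real (?E j) \<omega> * g j \<omega>) \<in> borel_measurable M"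
        by (intro borel_measurable_times borel_measurable_indicator E g j)
    qed (use g(2)[OF j] B in \<open>auto simp: indicator_def\<close>)
  qed
  finally show ?thesis .
qed

text \<open>
  The Markov property at a random grid point: decompose according to its value, for the event of that
  value belongs to the past of the grid point.
\<close>

lemma markov_at_grid_time:
  assumes S: "optional_time t S" "t > 0" "N > 0"
    and V: "\<And>j. j \<le> N \<Longrightarrow> V j \<in> borel_measurable (past (t * real j / real N))" "\<And>j \<omega>. \<bar>V j \<omega>\<bar> \<le> B"
    and f: "f \<in> borel_measurable borel" "\<And>z. \<bar>f z\<bar> \<le> C"
  defines "J \<equiv> \<lambda>\<omega>. grid_index t N (S \<omega>)"
  shows "expectation (\<lambda>\<omega>. V (J \<omega>) \<omega> * f (X t \<omega>)) =
    expectation (\<lambda>\<omega>. V (J \<omega>) \<omega> * semigroup (t - t * real (J \<omega>) / real N) f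
        (X (t * real (J \<omega>) / real N) \<omega>))"
proof -
  let ?u = "\<lambda>j. t * real j / real N"
  let ?E = "\<lambda>j. {\<omega> \<in> space M. grid_index t N (S \<omega>) = j}"
  have u: "0 \<le> ?u j" "?u j \<le> t" if "j \<le> N" for j
    using that S by (auto simp: field_simps)
  have B: "0 \<le> B" using V(2)[of 0 undefined] by linarith
  have C: "0 \<le> C" using f(2)[of 0] by linarith
  have Vm: "V j \<in> borel_measurable M" if "j \<le> N" for j using measurable_past_M[OF V(1)[OF that]] .
  have sb: "\<bar>semigroup (t - ?u j) f z\<bar> \<le> C" if "j \<le> N" for j z
    using u[OF that] f by (intro semigroup_bound) auto
  have "expectation (\<lambda>\<omega>. V (J \<omega>) \<omega> * f (X t \<omega>))
      = (\<Sum>j\<le>N. expectation (\<lambda>\<omega>. indicator (?E j) \<omega> * (V j \<omega> * f (X t \<omega>))))"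
    unfolding J_def
  proof (rule expectation_grid_split[OF S, where g = "\<lambda>j \<omega>. V j \<omega> * f (X t \<omega>)"])
    show "(\<lambda>\<omega>. V j \<omega> * f (X t \<omega>)) \<in> borel_measurable M" if "j \<le> N" for j
      using Vm[OF that] measurable_compose[OF measurable_X f(1)] S by auto
    show "\<bar>V j \<omega> * f (X t \<omega>)\<bar> \<le> B * C" for j \<omega>
      unfolding abs_mult using V(2) f(2) B by (intro mult_mono) auto
  qed
  also have "\<dots> = (\<Sum>j\<le>N. expectation
      (\<lambda>\<omega>. indicator (?E j) \<omega> * (V j \<omega> * semigroup (t - ?u j) f (X (?u j) \<omega>))))"
  proof (rule sum.cong[OF refl])
    fix j assume "j \<in> {..N}"
    hence j: "j \<le> N" by simp
    have "expectation (\<lambda>\<omega>. (indicator (?E j) \<omega> * V j \<omega>) * f (X t \<omega>)) =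
      expectation (\<lambda>\<omega>. (indicator (?E j) \<omega> * V j \<omega>) * semigroup (t - ?u j) f (X (?u j) \<omega>))"
    proof (rule markov_property[OF u[OF j] _ _ f])
      show "(\<lambda>\<omega>. indicat_real (?E j) \<omega> * V j \<omega>) \<in> borel_measurable (past (?u j))"
        by (intro borel_measurable_times borel_measurable_indicator V(1)[OF j]
            grid_index_past[OF S(1,2) j S(3)])
      show "\<bar>indicat_real (?E j) \<omega> * V j \<omega>\<bar> \<le> B" for \<omega> using V(2)[of j \<omega>] B
          by (auto simp: indicator_def)
    qed
    thus "expectation (\<lambda>\<omega>. indicator (?E j) \<omega> * (V j \<omega> * f (X t \<omega>)))
        = expectation (\<lambda>\<omega>. indicator (?E j) \<omega> * (V j \<omega> * semigroup (t - ?u j) f (X (?u j) \<omega>)))"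
      by (simp only: mult.assoc)
  qed
  also have "\<dots> = expectation (\<lambda>\<omega>. V (J \<omega>) \<omega> * semigroup (t - ?u (J \<omega>)) f (X (?u (J \<omega>)) \<omega>))"
    unfolding J_def
  proof (rule expectation_grid_split[OF S,
      where g = "\<lambda>j \<omega>. V j \<omega> * semigroup (t - ?u j) f (X (?u j) \<omega>)", symmetric])
    show "(\<lambda>\<omega>. V j \<omega> * semigroup (t - ?u j) f (X (?u j) \<omega>)) \<in> borel_measurable M" if "j \<le> N" for j
    proof -
      have "semigroup (t - ?u j) f \<in> borel_measurable borel" using u[OF that] f
          by (intro measurable_semigroup) auto
      thus ?thesis using Vm[OF that] measurable_X[OF u(1)[OF that]]
          by (intro borel_measurable_times) auto
    qed
    show "\<bar>V j \<omega> * semigroup (t - ?u j) f (X (?u j) \<omega>)\<bar> \<le> B * C" if "j \<le> N" for j \<omega>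
      unfolding abs_mult using V(2) sb[OF that] B by (intro mult_mono) auto
  qed
  finally show ?thesis .
qed

text \<open>
  For an eigenfunction \<open>f\<close> of the free semigroup the variables \<open>Y S\<close> are the values at \<open>S\<close> of the
  martingale closed by \<open>f (X t)\<close>, and \<open>Y S\<close> is known at the later time \<open>S'\<close>. The identity holds for the
  grid times above \<open>S\<close> and \<open>S'\<close>, and right-continuity of the paths passes it to the limit. Only the
  continuity of \<open>\<phi>\<close> is involved there, whereas for a general \<open>f\<close> it would already require
  continuity of the paths at fixed times.
\<close>

lemma optional_sampling:
  assumes S: "optional_time t S" "optional_time t S'" "\<And>\<omega>. S \<omega> \<le> S' \<omega>" "t > 0"
    and f: "continuous_on UNIV f" "\<And>z. \<bar>f z\<bar> \<le> 1"
    and \<phi>: "continuous_on UNIV \<phi>" "\<And>u. 0 \<le> u \<Longrightarrow> \<bar>\<phi> u\<bar> \<le> 1"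
        "\<And>u z. 0 \<le> u \<Longrightarrow> semigroup u f z = \<phi> u * f z"
  defines "Y \<equiv> \<lambda>S \<omega>. \<phi> (t - capped t (S \<omega>)) * f (X (capped t (S \<omega>)) \<omega>)"
  shows "expectation (\<lambda>\<omega>. Y S \<omega> * f (X t \<omega>)) = expectation (\<lambda>\<omega>. Y S \<omega> * Y S' \<omega>)"
proof -
  have fm[measurable]: "f \<in> borel_measurable borel" using f(1)
      by (rule borel_measurable_continuous_onI)
  have \<phi>m[measurable]: "\<phi> \<in> borel_measurable borel" using \<phi>(1)
      by (rule borel_measurable_continuous_onI)
  have Xt[measurable]: "X t \<in> borel_measurable M" using S(4) by (intro measurable_X) simp
  define u where "u n S \<omega> = t * real (grid_index t (Suc n) (S \<omega>)) / real (Suc n)" for n S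
      and \<omega> :: 'w
  define Z where "Z n S \<omega> = \<phi> (t - u n S \<omega>) * f (X (u n S \<omega>) \<omega>)" for n S \<omega>
  have u: "0 \<le> u n S \<omega>" "u n S \<omega> \<le> t" for n S \<omega>
    using mult_left_mono[of "real (grid_index t (Suc n) (S \<omega>))" "real (Suc n)" t]
        grid_index_le[of t "Suc n" "S \<omega>"] S(4)
    by (auto simp: u_def pos_divide_le_eq simp del: of_nat_Suc)
  have Zb: "\<bar>Z n S \<omega>\<bar> \<le> 1" for n S \<omega>
  proof -
    have "\<bar>Z n S \<omega>\<bar> \<le> 1 * 1" unfolding Z_def abs_mult using \<phi>(2) u f(2) by (intro mult_mono) auto
    thus ?thesis by simp
  qed
  have Zm: "Z n S \<in> borel_measurable M" if "optional_time t S" for n S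
  proof -
    have [measurable]: "(\<lambda>\<omega>. X (u n S \<omega>) \<omega>) \<in> borel_measurable M"
      unfolding u_def by (rule measurable_X_grid[OF that S(4)]) simp
    have [measurable]: "u n S \<in> borel_measurable M"
      unfolding u_def[abs_def] by
          (rule measurable_compose_countable[OF _ measurable_grid_index[OF that S(4)]]) auto
    show ?thesis unfolding Z_def[abs_def] by measurable
  qed
  have discrete: "expectation (\<lambda>\<omega>. Z n S \<omega> * f (X t \<omega>)) = expectation (\<lambda>\<omega>. Z n S \<omega> * Z n S' \<omega>)"
      for n
  proof -
    let ?N = "Suc n"
    let ?v = "\<lambda>i. t * real i / real ?N"
    let ?J = "\<lambda>S \<omega>. grid_index t ?N (S \<omega>)"
    let ?E = "\<lambda>i. {\<omega> \<in> space M. grid_index t ?N (S \<omega>) = i}"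
    \<comment> \<open>The martingale at the grid time above \<open>S\<close>, set to zero until that time has passed; written
      as a sum over its possible values, it visibly depends on the past of the grid point \<open>j\<close>.\<close>
    define V where "V j \<omega> = (\<Sum>i\<le>min j ?N. indicator (?E i) \<omega> * (\<phi> (t - ?v i) * f (X (?v i) \<omega>)))"
        for j \<omega>
    have V_eq: "V j \<omega> = (if \<omega> \<in> space M \<and> ?J S \<omega> \<le> j then Z n S \<omega> else 0)" for j \<omega>
    proof (cases "\<omega> \<in> space M \<and> ?J S \<omega> \<le> j")
      case True
      have "V j \<omega> = (\<Sum>i\<in>{?J S \<omega>}. indicator (?E i) \<omega> * (\<phi> (t - ?v i) * f (X (?v i) \<omega>)))"
        unfolding V_def using True grid_index_le[of t ?N "S \<omega>"]
        by (intro sum.mono_neutral_right) (auto simp: indicator_def)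
      thus ?thesis using True by (simp add: Z_def u_def)
    next
      case False
      hence "V j \<omega> = 0" unfolding V_def by (intro sum.neutral) (auto simp: indicator_def)
      thus ?thesis using False by auto
    qed
    have "expectation (\<lambda>\<omega>. V (?J S' \<omega>) \<omega> * f (X t \<omega>)) =
      expectation (\<lambda>\<omega>. V (?J S' \<omega>) \<omega> * semigroup (t - ?v (?J S' \<omega>)) f (X (?v (?J S' \<omega>)) \<omega>))"
    proof (rule markov_at_grid_time[OF S(2,4) _ _ _ fm f(2)])
      show "V j \<in> borel_measurable (past (?v j))" if "j \<le> ?N" for j
        unfolding V_def[abs_def]
      proof (intro borel_measurable_sum borel_measurable_times borel_measurable_indicator
          borel_measurable_const)
        fix i assume "i \<in> {..min j ?N}"
        hence i: "i \<le> j" "i \<le> ?N" by auto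
        have le: "?v i \<le> ?v j" using i S(4) by (intro divide_right_mono mult_left_mono) auto
        show "?E i \<in> sets (past (?v j))"
          using grid_index_past[OF S(1,4) i(2)] sets_past_mono[OF le] by auto
        show "(\<lambda>\<omega>. f (X (?v i) \<omega>)) \<in> borel_measurable (past (?v j))"
          using measurable_past_X[OF _ le] S(4) by (intro measurable_compose[OF _ fm]) auto
      qed
      show "\<bar>V j \<omega>\<bar> \<le> 1" for j \<omega> using Zb[of n S \<omega>] by (auto simp: V_eq)
    qed simp
    also have "expectation (\<lambda>\<omega>. V (?J S' \<omega>) \<omega> * f (X t \<omega>)) = expectation (\<lambda>\<omega>. Z n S \<omega> * f (X t \<omega>))"
      using grid_index_mono[OF S(3) S(4)]
          by (intro Bochner_Integration.integral_cong refl) (simp add: V_eq)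
    also have "expectation (\<lambda>\<omega>. V (?J S' \<omega>) \<omega> * semigroup (t - ?v (?J S' \<omega>)) f
        (X (?v (?J S' \<omega>)) \<omega>)) = expectation (\<lambda>\<omega>. Z n S \<omega> * Z n S' \<omega>)"
    proof (intro Bochner_Integration.integral_cong refl)
      fix \<omega> assume \<omega>: "\<omega> \<in> space M"
      have "semigroup (t - ?v (?J S' \<omega>)) f (X (?v (?J S' \<omega>)) \<omega>) = Z n S' \<omega>"
        using \<phi>(3)[of "t - u n S' \<omega>"] u(2)[of n S' \<omega>] by (simp add: Z_def u_def)
      thus "V (?J S' \<omega>) \<omega> * semigroup (t - ?v (?J S' \<omega>)) f (X (?v (?J S' \<omega>)) \<omega>)
          = Z n S \<omega> * Z n S' \<omega>"
        using grid_index_mono[OF S(3) S(4)] \<omega> by (simp add: V_eq)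
    qed
    finally show ?thesis .
  qed
  have Zlim: "(\<lambda>n. Z n S \<omega>) \<longlonglongrightarrow> Y S \<omega>" if "optional_time t S" for S \<omega>
  proof -
    have "(\<lambda>n. \<phi> (t - u n S \<omega>)) \<longlonglongrightarrow> \<phi> (t - capped t (S \<omega>))"
      unfolding u_def
      by (intro continuous_on_tendsto_compose[OF \<phi>(1)] tendsto_intros grid_time_tendsto
          optional_time_nonneg[OF that] S(4)) auto
    moreover have "(\<lambda>n. f (X (u n S \<omega>) \<omega>)) \<longlonglongrightarrow> f (X (capped t (S \<omega>)) \<omega>)"
      unfolding u_def
      by (intro continuous_on_tendsto_compose[OF f(1)] X_grid_tendsto
          optional_time_nonneg[OF that] S(4)) auto
    ultimately show ?thesis unfolding Z_def Y_def by (rule tendsto_mult)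
  qed
  have Ym: "Y S \<in> borel_measurable M" if "optional_time t S" for S
    by (rule borel_measurable_LIMSEQ_metric[OF Zm[OF that] Zlim[OF that]])
  note [measurable] = Ym[OF S(1)] Ym[OF S(2)] Zm[OF S(1)] Zm[OF S(2)]
  have "(\<lambda>n. expectation (\<lambda>\<omega>. Z n S \<omega> * f (X t \<omega>))) \<longlonglongrightarrow> expectation (\<lambda>\<omega>. Y S \<omega> * f (X t \<omega>))"
  proof (rule integral_dominated_convergence[where w="\<lambda>_. 1"])
    show "AE \<omega> in M. (\<lambda>n. Z n S \<omega> * f (X t \<omega>)) \<longlonglongrightarrow> Y S \<omega> * f (X t \<omega>)"
      using Zlim[OF S(1)] by (auto intro!: tendsto_intros)
    show "AE \<omega> in M. norm (Z n S \<omega> * f (X t \<omega>)) \<le> 1" for n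
      unfolding real_norm_def by (intro AE_I2 abs_mult_le_one Zb f(2))
  qed auto
  moreover have "(\<lambda>n. expectation (\<lambda>\<omega>. Z n S \<omega> * Z n S' \<omega>)) \<longlonglongrightarrow> expectation (\<lambda>\<omega>. Y S \<omega> * Y S' \<omega>)"
  proof (rule integral_dominated_convergence[where w="\<lambda>_. 1"])
    show "AE \<omega> in M. (\<lambda>n. Z n S \<omega> * Z n S' \<omega>) \<longlonglongrightarrow> Y S \<omega> * Y S' \<omega>"
      using Zlim[OF S(1)] Zlim[OF S(2)] by (auto intro!: tendsto_intros)
    show "AE \<omega> in M. norm (Z n S \<omega> * Z n S' \<omega>) \<le> 1" for n
      unfolding real_norm_def by (intro AE_I2 abs_mult_le_one Zb Zb)
  qed auto
  ultimately show ?thesis unfolding discrete by (rule LIMSEQ_unique)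
qed

text \<open>
  Symmetry removes the cross terms of the addition theorems.
\<close>

lemma semigroup_cos_sin:
  assumes "0 \<le> u"
  shows "semigroup u (\<lambda>z. cos (\<xi> \<bullet> z)) z = exp (- u * \<eta> \<xi>) * cos (\<xi> \<bullet> z)"
    and "semigroup u (\<lambda>z. sin (\<xi> \<bullet> z)) z = exp (- u * \<eta> \<xi>) * sin (\<xi> \<bullet> z)"
proof -
  note measurable_X[OF assms, measurable]
  have c: "integrable M (\<lambda>\<omega>. cos (\<xi> \<bullet> X u \<omega>))" and s: "integrable M (\<lambda>\<omega>. sin (\<xi> \<bullet> X u \<omega>))"
    by (rule integrable_bounded[of _ 1]; simp)+
  show "semigroup u (\<lambda>z. cos (\<xi> \<bullet> z)) z = exp (- u * \<eta> \<xi>) * cos (\<xi> \<bullet> z)"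
    unfolding semigroup_def using c s
    by (simp add: inner_add_right cos_add expectation_cos[OF assms] expectation_sin[OF assms])
  show "semigroup u (\<lambda>z. sin (\<xi> \<bullet> z)) z = exp (- u * \<eta> \<xi>) * sin (\<xi> \<bullet> z)"
    unfolding semigroup_def using c s
    by (simp add: inner_add_right sin_add expectation_cos[OF assms] expectation_sin[OF assms])
qed

lemma capped_SUP_tendsto:
  assumes "incseq S" "0 \<le> S 0" "t \<ge> 0"
  shows "(\<lambda>n. capped t (S n)) \<longlonglongrightarrow> capped t (SUP n. S n)"
proof -
  have "S \<longlonglongrightarrow> (SUP n. S n)" using assms(1) by (rule LIMSEQ_SUP)
  hence "(\<lambda>n. min (S n) (ereal t)) \<longlonglongrightarrow> min (SUP n. S n) (ereal t)" by (intro tendsto_intros)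
  moreover have "\<bar>min (SUP n. S n) (ereal t)\<bar> \<noteq> \<infinity>"
  proof -
    have "0 \<le> (SUP n. S n)" using assms(2) by (auto intro: SUP_upper2)
    hence "0 \<le> min (SUP n. S n) (ereal t)" "min (SUP n. S n) (ereal t) \<le> ereal t" using assms(3)
        by auto
    thus ?thesis by (cases "min (SUP n. S n) (ereal t)") auto
  qed
  then obtain r where "min (SUP n. S n) (ereal t) = ereal r"
      by (cases "min (SUP n. S n) (ereal t)") auto
  ultimately show ?thesis unfolding capped_def by (simp add: lim_real_of_ereal)
qed

lemma inner_cos_eq_1_imp_zero:
  fixes v :: 'a
  assumes "\<And>\<xi>. cos (\<xi> \<bullet> v) = 1"
  shows "v = 0"
proof (rule ccontr)
  assume "v \<noteq> 0"
  hence "((pi / (v \<bullet> v)) *\<^sub>R v) \<bullet> v = pi" by simp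
  thus False using assms[of "(pi / (v \<bullet> v)) *\<^sub>R v"] by simp
qed

text \<open>
  A Levy process does not jump at a time that is announced by an increasing sequence. Apply
  \<open>optional_sampling\<close> to \<open>f = cos (\<xi> \<bullet> _)\<close> and \<open>f = sin (\<xi> \<bullet> _)\<close>, once with \<open>S n\<close> twice and once with
  \<open>S n\<close> and \<open>S'\<close>, and let \<open>n\<close> tend to infinity. Writing \<open>L\<close> for the limit of the positions at the times
  \<open>S n\<close>, this yields \<open>E (g\<^sup>2 * f L * f L) = E (g\<^sup>2 * f L * f X')\<close> with \<open>X'\<close> the position at \<open>S'\<close> and a
  positive factor \<open>g\<close>. Adding the two identities gives \<open>E (g\<^sup>2 * (1 - cos (\<xi> \<bullet> (X' - L)))) = 0\<close>, so
  \<open>X' = L\<close> almost surely.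
\<close>

lemma quasi_left_continuity:
  assumes S: "\<And>n. optional_time t (S n)" "\<And>\<omega>. incseq (\<lambda>n. S n \<omega>)" and t: "t > 0"
    and S': "optional_time t S'" "\<And>\<omega>. S' \<omega> = (SUP n. S n \<omega>)"
  shows "AE \<omega> in M. (\<lambda>n. X (capped t (S n \<omega>)) \<omega>) \<longlonglongrightarrow> X (capped t (S' \<omega>)) \<omega>"
proof -
  define c where "c n \<omega> = capped t (S n \<omega>)" for n \<omega>
  define c' where "c' \<omega> = capped t (S' \<omega>)" for \<omega>
  have c_lim: "(\<lambda>n. c n \<omega>) \<longlonglongrightarrow> c' \<omega>" for \<omega>
    unfolding c_def c'_def S'(2) using S(2) optional_time_nonneg[OF S(1)] t
        by (intro capped_SUP_tendsto) auto
  have c_inc: "incseq (\<lambda>n. c n \<omega>)" for \<omega>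
    unfolding c_def using optional_time_nonneg[OF S(1)] t incseqD[OF S(2)]
        by (intro incseq_SucI capped_mono) auto
  have c_bd: "0 \<le> c n \<omega>" "c n \<omega> \<le> t" for n \<omega>
    unfolding c_def using capped_bounds[OF optional_time_nonneg[OF S(1)]] t by auto
  have c'_bd: "0 \<le> c' \<omega>" "c' \<omega> \<le> t" for \<omega>
    unfolding c'_def using capped_bounds[OF optional_time_nonneg[OF S'(1)]] t by auto
  define L where "L \<omega> = lim (\<lambda>n. X (c n \<omega>) \<omega>)" for \<omega>
  have L: "(\<lambda>n. X (c n \<omega>) \<omega>) \<longlonglongrightarrow> L \<omega>" for \<omega>
    unfolding L_def using cadlag_left_sequence[OF cadlag_X c_inc c_lim c_bd(1)]
        by (simp add: convergent_LIMSEQ_iff)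
  have [measurable]: "(\<lambda>\<omega>. X (c n \<omega>) \<omega>) \<in> borel_measurable M" "c n \<in> borel_measurable M" for n
    unfolding c_def[abs_def] by (intro measurable_X_capped measurable_capped S t)+
  have [measurable]: "(\<lambda>\<omega>. X (c' \<omega>) \<omega>) \<in> borel_measurable M" "c' \<in> borel_measurable M"
    unfolding c'_def[abs_def] by (intro measurable_X_capped measurable_capped S' t)+
  have [measurable]: "L \<in> borel_measurable M"
    by (rule borel_measurable_LIMSEQ_metric[OF _ L]) measurable
  have [measurable]: "X t \<in> borel_measurable M" using t by (intro measurable_X) auto
  have SS': "S n \<omega> \<le> S' \<omega>" for n \<omega> unfolding S'(2) by (rule SUP_upper) simp
  have key: "AE \<omega> in M. cos (\<xi> \<bullet> (X (c' \<omega>) \<omega> - L \<omega>)) = 1" for \<xi>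
  proof -
    define \<phi> where "\<phi> u = exp (- u * \<eta> \<xi>)" for u
    have \<phi>c: "continuous_on UNIV \<phi>" unfolding \<phi>_def by (intro continuous_intros)
    have \<phi>1: "\<bar>\<phi> u\<bar> \<le> 1" if "0 \<le> u" for u using that eta_nonneg[of \<xi>] by (simp add: \<phi>_def)
    define g where "g \<omega> = \<phi> (t - c' \<omega>)" for \<omega>
    have g: "0 < g \<omega>" "\<bar>g \<omega>\<bar> \<le> 1" for \<omega> using \<phi>1[of "t - c' \<omega>"] c'_bd by (auto simp: g_def \<phi>_def)
    have [measurable]: "\<phi> \<in> borel_measurable borel" by (rule borel_measurable_continuous_onI[OF \<phi>c])
    have [measurable]: "g \<in> borel_measurable M" unfolding g_def[abs_def] by measurable
    have eq: "expectation (\<lambda>\<omega>. (g \<omega>)\<^sup>2 * (f (L \<omega>) * f (L \<omega>)))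
        = expectation (\<lambda>\<omega>. (g \<omega>)\<^sup>2 * (f (L \<omega>) * f (X (c' \<omega>) \<omega>)))"
      if f: "continuous_on UNIV f" "\<And>z. \<bar>f z\<bar> \<le> 1" "\<And>u z. 0 \<le> u \<Longrightarrow> semigroup u f z = \<phi> u * f z"
          for f :: "'a \<Rightarrow> real"
    proof -
      have [measurable]: "f \<in> borel_measurable borel"
          by (rule borel_measurable_continuous_onI[OF f(1)])
      define Y where "Y n \<omega> = \<phi> (t - c n \<omega>) * f (X (c n \<omega>) \<omega>)" for n \<omega>
      define Y' where "Y' \<omega> = g \<omega> * f (X (c' \<omega>) \<omega>)" for \<omega>
      have [measurable]: "Y n \<in> borel_measurable M" "Y' \<in> borel_measurable M" for n
        unfolding Y_def[abs_def] Y'_def[abs_def] by measurable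
      have Yb: "\<bar>Y n \<omega>\<bar> \<le> 1" for n \<omega>
        unfolding Y_def using c_bd by (intro abs_mult_le_one \<phi>1 f(2)) auto
      have Y'b: "\<bar>Y' \<omega>\<bar> \<le> 1" for \<omega>
        unfolding Y'_def by (intro abs_mult_le_one g f(2))
      have Ylim: "(\<lambda>n. Y n \<omega>) \<longlonglongrightarrow> g \<omega> * f (L \<omega>)" for \<omega>
        unfolding Y_def g_def
        by (intro tendsto_intros continuous_on_tendsto_compose[OF \<phi>c]
            continuous_on_tendsto_compose[OF f(1)] L c_lim) auto
      have "expectation (\<lambda>\<omega>. Y n \<omega> * Y n \<omega>) = expectation (\<lambda>\<omega>. Y n \<omega> * Y' \<omega>)" for n
        using optional_sampling[OF S(1) S(1) order_refl t f(1,2) \<phi>c \<phi>1 f(3), of n]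
          optional_sampling[OF S(1) S'(1) SS' t f(1,2) \<phi>c \<phi>1 f(3), of n]
        by (simp add: Y_def Y'_def c_def c'_def g_def)
      moreover have "(\<lambda>n. expectation (\<lambda>\<omega>. Y n \<omega> * Y n \<omega>))
          \<longlonglongrightarrow> expectation (\<lambda>\<omega>. (g \<omega> * f (L \<omega>)) * (g \<omega> * f (L \<omega>)))"
      proof (rule integral_dominated_convergence[where w="\<lambda>_. 1"])
        show "AE \<omega> in M. (\<lambda>n. Y n \<omega> * Y n \<omega>) \<longlonglongrightarrow> (g \<omega> * f (L \<omega>)) * (g \<omega> * f (L \<omega>))"
          using Ylim by (auto intro!: tendsto_intros)
        show "AE \<omega> in M. norm (Y n \<omega> * Y n \<omega>) \<le> 1" for n
          unfolding real_norm_def by (intro AE_I2 abs_mult_le_one Yb Yb)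
      qed auto
      moreover have "(\<lambda>n. expectation (\<lambda>\<omega>. Y n \<omega> * Y' \<omega>))
          \<longlonglongrightarrow> expectation (\<lambda>\<omega>. (g \<omega> * f (L \<omega>)) * Y' \<omega>)"
      proof (rule integral_dominated_convergence[where w="\<lambda>_. 1"])
        show "AE \<omega> in M. (\<lambda>n. Y n \<omega> * Y' \<omega>) \<longlonglongrightarrow> (g \<omega> * f (L \<omega>)) * Y' \<omega>"
          using Ylim by (auto intro!: tendsto_intros)
        show "AE \<omega> in M. norm (Y n \<omega> * Y' \<omega>) \<le> 1" for n
          unfolding real_norm_def by (intro AE_I2 abs_mult_le_one Yb Y'b)
      qed auto
      ultimately have "expectation (\<lambda>\<omega>. (g \<omega> * f (L \<omega>)) * (g \<omega> * f (L \<omega>)))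
          = expectation (\<lambda>\<omega>. (g \<omega> * f (L \<omega>)) * Y' \<omega>)"
        using LIMSEQ_unique by simp
      thus ?thesis by (simp add: Y'_def power2_eq_square mult_ac)
    qed
    let ?a = "\<lambda>\<omega>. \<xi> \<bullet> X (c' \<omega>) \<omega>" and ?b = "\<lambda>\<omega>. \<xi> \<bullet> L \<omega>"
    have g2: "(g \<omega>)\<^sup>2 \<le> 1" for \<omega> using g[of \<omega>] by (simp add: power_le_one)
    have int: "integrable M (\<lambda>\<omega>. (g \<omega>)\<^sup>2 * (p \<omega> * q \<omega>))"
      if [measurable]: "p \<in> borel_measurable M" "q \<in> borel_measurable M"
          and "\<And>\<omega>. \<bar>p \<omega>\<bar> \<le> 1" "\<And>\<omega>. \<bar>q \<omega>\<bar> \<le> 1" for p q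
    proof (rule integrable_bounded[of _ "1 * (1 * 1)"])
      show "\<bar>(g \<omega>)\<^sup>2 * (p \<omega> * q \<omega>)\<bar> \<le> 1 * (1 * 1)" for \<omega>
        unfolding abs_mult using g2 that(3,4) by (intro mult_mono) auto
    qed measurable
    have e1: "expectation (\<lambda>\<omega>. (g \<omega>)\<^sup>2 * (cos (?b \<omega>) * cos (?b \<omega>)))
        = expectation (\<lambda>\<omega>. (g \<omega>)\<^sup>2 * (cos (?b \<omega>) * cos (?a \<omega>)))"
      by (rule eq) (auto intro!: continuous_intros simp: semigroup_cos_sin \<phi>_def)
    have e2: "expectation (\<lambda>\<omega>. (g \<omega>)\<^sup>2 * (sin (?b \<omega>) * sin (?b \<omega>)))
        = expectation (\<lambda>\<omega>. (g \<omega>)\<^sup>2 * (sin (?b \<omega>) * sin (?a \<omega>)))"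
      by (rule eq) (auto intro!: continuous_intros simp: semigroup_cos_sin \<phi>_def)
    have i: "integrable M (\<lambda>\<omega>. (g \<omega>)\<^sup>2 * (cos (?b \<omega>) * cos (?b \<omega>)))"
        "integrable M (\<lambda>\<omega>. (g \<omega>)\<^sup>2 * (cos (?b \<omega>) * cos (?a \<omega>)))"
      "integrable M (\<lambda>\<omega>. (g \<omega>)\<^sup>2 * (sin (?b \<omega>) * sin (?b \<omega>)))"
          "integrable M (\<lambda>\<omega>. (g \<omega>)\<^sup>2 * (sin (?b \<omega>) * sin (?a \<omega>)))"
      by (intro int; simp)+
    have split: "(g \<omega>)\<^sup>2 * (1 - cos (\<xi> \<bullet> (X (c' \<omega>) \<omega> - L \<omega>))) =
       ((g \<omega>)\<^sup>2 * (cos (?b \<omega>) * cos (?b \<omega>)) - (g \<omega>)\<^sup>2 * (cos (?b \<omega>) * cos (?a \<omega>))) +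
       ((g \<omega>)\<^sup>2 * (sin (?b \<omega>) * sin (?b \<omega>)) - (g \<omega>)\<^sup>2 * (sin (?b \<omega>) * sin (?a \<omega>)))" for \<omega>
    proof -
      have one: "cos (?b \<omega>) * cos (?b \<omega>) + sin (?b \<omega>) * sin (?b \<omega>) = 1"
        using sin_cos_squared_add2[of "?b \<omega>"] by (simp add: power2_eq_square)
      have "(g \<omega>)\<^sup>2 * (1 - cos (\<xi> \<bullet> (X (c' \<omega>) \<omega> - L \<omega>))) =
        (g \<omega>)\<^sup>2 * ((cos (?b \<omega>) * cos (?b \<omega>) + sin (?b \<omega>) * sin (?b \<omega>)) -
            (cos (?a \<omega>) * cos (?b \<omega>) + sin (?a \<omega>) * sin (?b \<omega>)))"
        by (simp only: one inner_diff_right cos_diff)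
      also have "\<dots> = ((g \<omega>)\<^sup>2 * (cos (?b \<omega>) * cos (?b \<omega>)) - (g \<omega>)\<^sup>2 * (cos (?b \<omega>) * cos (?a \<omega>))) +
       ((g \<omega>)\<^sup>2 * (sin (?b \<omega>) * sin (?b \<omega>)) - (g \<omega>)\<^sup>2 * (sin (?b \<omega>) * sin (?a \<omega>)))"
        by algebra
      finally show ?thesis .
    qed
    have "integrable M (\<lambda>\<omega>. (g \<omega>)\<^sup>2 * (1 - cos (\<xi> \<bullet> (X (c' \<omega>) \<omega> - L \<omega>))))"
      unfolding split using i by auto
    moreover have "expectation (\<lambda>\<omega>. (g \<omega>)\<^sup>2 * (1 - cos (\<xi> \<bullet> (X (c' \<omega>) \<omega> - L \<omega>)))) = 0"
      unfolding split using i e1 e2 by simp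
    ultimately have "AE \<omega> in M. (g \<omega>)\<^sup>2 * (1 - cos (\<xi> \<bullet> (X (c' \<omega>) \<omega> - L \<omega>))) = 0"
      by (subst (asm) integral_nonneg_eq_0_iff_AE) auto
    thus ?thesis using g(1) by (auto elim!: eventually_mono) (metis less_irrefl)
  qed
  \<comment> \<open>Countably many frequencies suffice, because the exceptional set of frequencies is open.\<close>
  obtain D :: "'a set" where D: "countable D" "\<And>U. open U \<Longrightarrow> U \<noteq> {} \<Longrightarrow> \<exists>d\<in>D. d \<in> U"
    using countable_dense_exists by blast
  have "AE \<omega> in M. \<forall>\<xi>\<in>D. cos (\<xi> \<bullet> (X (c' \<omega>) \<omega> - L \<omega>)) = 1"
    using D(1) key by (simp add: AE_ball_countable)
  thus ?thesis
  proof eventually_elim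
    case (elim \<omega>)
    let ?v = "X (c' \<omega>) \<omega> - L \<omega>"
    have "open {\<xi>. cos (\<xi> \<bullet> ?v) \<noteq> 1}" by (intro open_Collect_neq continuous_intros)
    hence "{\<xi>. cos (\<xi> \<bullet> ?v) \<noteq> 1} = {}" using D(2) elim by blast
    hence "?v = 0" by (intro inner_cos_eq_1_imp_zero) auto
    thus ?case using L[of \<omega>] by (simp add: c_def c'_def)
  qed
qed

end

section \<open>The strong Markov property\<close>

context cadlag_symmetric_levy
begin

text \<open>
  A constant time is announced by smaller constants.
\<close>

lemma AE_continuous_at_fixed_time:
  assumes u: "u > 0"
  shows "AE \<omega> in M. ((\<lambda>v. X v \<omega>) \<longlongrightarrow> X u \<omega>) (at_left u)"
proof -
  define s where "s n = u * (1 - 1 / real (Suc n))" for n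
  have s: "0 \<le> s n" "s n < u" for n using u by (auto simp: s_def field_simps)
  have "(\<lambda>n. u * (1 - inverse (real (Suc n)))) \<longlonglongrightarrow> u * (1 - 0)"
    by (intro tendsto_intros LIMSEQ_inverse_real_of_nat)
  hence s_lim: "s \<longlonglongrightarrow> u" by (simp add: s_def[abs_def] inverse_eq_divide)
  have s_inc: "incseq s"
  proof (rule incseq_SucI)
    fix n
    have "1 / real (Suc (Suc n)) \<le> 1 / real (Suc n)" by (intro divide_left_mono) auto
    thus "s n \<le> s (Suc n)" unfolding s_def using u by (intro mult_left_mono) auto
  qed
  have const: "optional_time u (\<lambda>_. ereal r)" if "0 \<le> r" for r
    unfolding optional_time_def
  proof (intro conjI allI impI)
    fix v
    show "{\<omega> \<in> space M. ereal r < ereal v} \<in> sets (past v)"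
      using sets.top[of "past v"] by (cases "r < v") auto
  qed (use that in auto)
  have sup: "ereal u = (SUP n. ereal (s n))"
  proof (rule LIMSEQ_unique)
    show "(\<lambda>n. ereal (s n)) \<longlonglongrightarrow> ereal u" using s_lim by simp
    show "(\<lambda>n. ereal (s n)) \<longlonglongrightarrow> (SUP n. ereal (s n))" using s_inc
        by (intro LIMSEQ_SUP) (auto simp: incseq_def)
  qed
  have "AE \<omega> in M. (\<lambda>n. X (capped u (ereal (s n))) \<omega>) \<longlonglongrightarrow> X (capped u (ereal u)) \<omega>"
    by (rule quasi_left_continuity[where S = "\<lambda>n _. ereal (s n)"
        and S' = "\<lambda>_. ereal u", OF const[OF s(1)] _ u const sup])
       (use s_inc u in \<open>auto simp: incseq_def\<close>)
  moreover have "capped u (ereal (s n)) = s n" for n using s[of n] by (simp add: capped_def min_def)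
  ultimately have "AE \<omega> in M. (\<lambda>n. X (s n) \<omega>) \<longlonglongrightarrow> X u \<omega>" by (simp add: capped_def)
  thus ?thesis
  proof eventually_elim
    case (elim \<omega>)
    obtain l where l: "((\<lambda>v. X v \<omega>) \<longlongrightarrow> l) (at_left u)" using cadlag_X[of \<omega>] u
        by (auto simp: cadlag_def)
    have "filterlim s (at_left u) sequentially"
      using s_lim s(2) by (auto simp: filterlim_at intro!: always_eventually less_imp_neq)
    from LIMSEQ_unique[OF filterlim_compose[OF l this] elim] l show ?case by simp
  qed
qed

lemma semigroup_left_tendsto:
  assumes f: "continuous_on UNIV f" "\<And>z. \<bar>f z\<bar> \<le> B"
    and u: "\<And>n. 0 \<le> u n" "\<And>n. u n \<le> u'" "u \<longlonglongrightarrow> u'" and z: "z \<longlonglongrightarrow> z'"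
  shows "(\<lambda>n. semigroup (u n) f (z n)) \<longlonglongrightarrow> semigroup u' f z'"
proof -
  have u': "0 \<le> u'" using u(1,2)[of 0] by linarith
  have [measurable]: "f \<in> borel_measurable borel" by (rule borel_measurable_continuous_onI[OF f(1)])
  note measurable_X[OF u(1), measurable] measurable_X[OF u', measurable]
  have AE: "AE \<omega> in M. (\<lambda>n. X (u n) \<omega>) \<longlonglongrightarrow> X u' \<omega>"
  proof (cases "u' = 0")
    case True
    hence "u n = 0" for n using u(1,2)[of n] by simp
    thus ?thesis using True by simp
  next
    case False
    hence "u' > 0" using u' by simp
    from AE_continuous_at_fixed_time[OF this] show ?thesis
    proof eventually_elim
      case (elim \<omega>)
      hence "continuous (at u' within {..u'}) (\<lambda>v. X v \<omega>)"
          by (simp add: continuous_within at_within_Iic_at_left)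
      thus ?case using u unfolding continuous_within_sequentially by (auto simp: o_def)
    qed
  qed
  show ?thesis
    unfolding semigroup_def
  proof (rule integral_dominated_convergence[where w="\<lambda>_. B"])
    show "AE \<omega> in M. (\<lambda>n. f (z n + X (u n) \<omega>)) \<longlonglongrightarrow> f (z' + X u' \<omega>)"
      using AE by eventually_elim
          (intro continuous_on_tendsto_compose[OF f(1)] tendsto_intros z; simp)
  qed (use f(2) in auto)
qed

text \<open>
  The grid times decrease to \<open>S\<close>, so the remaining times \<open>t - S\<close> are approached from below. The limit
  therefore needs left-continuity of the semigroup in time, that is
  \<open>AE_continuous_at_fixed_time\<close>.
\<close>

lemma strong_markov:
  assumes S: "optional_time t S" and t: "t > 0" and f: "continuous_on UNIV f" "\<And>z. \<bar>f z\<bar> \<le> B"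
  defines "A \<equiv> {\<omega> \<in> space M. S \<omega> < ereal t}"
  shows "expectation (\<lambda>\<omega>. indicator A \<omega> * f (X t \<omega>)) =
    expectation (\<lambda>\<omega>. indicator A \<omega> * semigroup (t - capped t (S \<omega>)) f (X (capped t (S \<omega>)) \<omega>))"
    and "(\<lambda>\<omega>. indicator A \<omega> * semigroup (t - capped t (S \<omega>)) f (X (capped t (S \<omega>)) \<omega>))
        \<in> borel_measurable M"
proof -
  have fm[measurable]: "f \<in> borel_measurable borel" using f(1)
      by (rule borel_measurable_continuous_onI)
  have Xt[measurable]: "X t \<in> borel_measurable M" using t by (intro measurable_X) simp
  have B: "0 \<le> B" using f(2)[of 0] by linarith
  have Ap: "A \<in> sets (past t)" using S t unfolding A_def optional_time_def by auto
  hence [measurable]: "A \<in> sets M" using sets_past_subset by blast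
  define u where "u n \<omega> = t * real (grid_index t (Suc n) (S \<omega>)) / real (Suc n)" for n \<omega>
  have u: "0 \<le> u n \<omega>" "u n \<omega> \<le> t" for n \<omega>
    using mult_left_mono[of "real (grid_index t (Suc n) (S \<omega>))" "real (Suc n)" t]
        grid_index_le[of t "Suc n" "S \<omega>"] t
    by (auto simp: u_def pos_divide_le_eq simp del: of_nat_Suc)
  define Z where "Z n \<omega> = indicator A \<omega> * semigroup (t - u n \<omega>) f (X (u n \<omega>) \<omega>)" for n \<omega>
  define Z' where "Z' \<omega> = indicator A \<omega> * semigroup (t - capped t (S \<omega>)) f (X (capped t (S \<omega>)) \<omega>)"
      for \<omega>
  have eq: "expectation (\<lambda>\<omega>. indicator A \<omega> * f (X t \<omega>)) = expectation (Z n)" for n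
  proof -
    let ?N = "Suc n"
    let ?J = "\<lambda>\<omega>. grid_index t ?N (S \<omega>)"
    \<comment> \<open>A grid index below \<open>N\<close> already implies \<open>S < t\<close>, so only the last grid point has to be
      restricted to the event \<open>A\<close>.\<close>
    define V where "V j = (if j
        < ?N then (\<lambda>\<omega>. indicator (space M) \<omega>) else (\<lambda>\<omega>. indicat_real A \<omega>))" for j
    have V_eq: "V (?J \<omega>) \<omega> = indicator A \<omega>" if "\<omega> \<in> space M" for \<omega>
    proof (cases "?J \<omega> < ?N")
      case True
      with grid_index_le_iff[OF t True, of "S \<omega>"] have "S \<omega> < ereal (u n \<omega>)" by (simp add: u_def)
      also have "\<dots> \<le> ereal t" using u by simp
      finally show ?thesis using True that by (simp add: V_def A_def)
    qed (simp add: V_def)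
    have "expectation (\<lambda>\<omega>. V (?J \<omega>) \<omega> * f (X t \<omega>)) =
      expectation (\<lambda>\<omega>. V (?J \<omega>) \<omega> * semigroup (t - t * real (?J \<omega>) / real ?N) f
          (X (t * real (?J \<omega>) / real ?N) \<omega>))"
    proof (rule markov_at_grid_time[OF S t _ _ _ fm f(2)])
      show "V j \<in> borel_measurable (past (t * real j / real ?N))" if "j \<le> ?N" for j
      proof (cases "j < ?N")
        case True
        thus ?thesis using sets.top[of "past (t * real j / real ?N)"] by (simp add: V_def)
      next
        case False
        hence "j = ?N" using that by simp
        thus ?thesis using Ap by (simp add: V_def del: of_nat_Suc)
      qed
      show "\<bar>V j \<omega>\<bar> \<le> 1" for j \<omega> by (auto simp: V_def indicator_def)
    qed simp
    thus ?thesis unfolding Z_def u_def using V_eq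
      by (simp cong: Bochner_Integration.integral_cong)
  qed
  have Zm: "Z n \<in> borel_measurable M" for n
  proof -
    \<comment> \<open>The minimum keeps \<open>t - v j\<close> nonnegative for every natural number \<open>j\<close>, as
      \<open>measurable_compose_countable\<close> demands.\<close>
    define v where "v j = t * real (min j (Suc n)) / real (Suc n)" for j
    have v: "0 \<le> v j" "v j \<le> t" for j
      using mult_left_mono[of "real (min j (Suc n))" "real (Suc n)" t] t
      by (auto simp: v_def pos_divide_le_eq simp del: of_nat_Suc)
    have uv: "u n \<omega> = v (grid_index t (Suc n) (S \<omega>))" for \<omega>
      using grid_index_le[of t "Suc n" "S \<omega>"] by (simp add: u_def v_def min_absorb1)
    have "(\<lambda>\<omega>. semigroup (t - v (grid_index t (Suc n) (S \<omega>))) f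
        (X (v (grid_index t (Suc n) (S \<omega>))) \<omega>)) \<in> borel_measurable M"
    proof (rule measurable_compose_countable[OF _ measurable_grid_index[OF S t, of "Suc n"]])
      fix j
      have "semigroup (t - v j) f \<in> borel_measurable borel" using v
          by (intro measurable_semigroup fm) auto
      thus "(\<lambda>\<omega>. semigroup (t - v j) f (X (v j) \<omega>)) \<in> borel_measurable M"
          using measurable_X[OF v(1)] by simp
    qed simp
    thus ?thesis unfolding Z_def uv
        by (intro borel_measurable_times borel_measurable_indicator) auto
  qed
  have Zb: "\<bar>Z n \<omega>\<bar> \<le> B" for n \<omega>
    using semigroup_bound[OF _ fm f(2), of "t - u n \<omega>" "X (u n \<omega>) \<omega>"] u[of n \<omega>] B
        by (auto simp: Z_def indicator_def)
  have Zlim: "(\<lambda>n. Z n \<omega>) \<longlonglongrightarrow> Z' \<omega>" for \<omega>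
  proof -
    have "(\<lambda>n. semigroup (t - u n \<omega>) f (X (u n \<omega>) \<omega>))
        \<longlonglongrightarrow> semigroup (t - capped t (S \<omega>)) f (X (capped t (S \<omega>)) \<omega>)"
    proof (rule semigroup_left_tendsto[OF f])
      show "(\<lambda>n. t - u n \<omega>) \<longlonglongrightarrow> t - capped t (S \<omega>)"
        unfolding u_def by (intro tendsto_intros grid_time_tendsto t optional_time_nonneg[OF S])
      show "(\<lambda>n. X (u n \<omega>) \<omega>) \<longlonglongrightarrow> X (capped t (S \<omega>)) \<omega>"
        unfolding u_def by (intro X_grid_tendsto t optional_time_nonneg[OF S])
      show "t - u n \<omega> \<le> t - capped t (S \<omega>)" for n
        using grid_time_bounds(1)[OF t zero_less_Suc optional_time_nonneg[OF S], of \<omega> n]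
            by (simp add: u_def)
    qed (use u in auto)
    thus ?thesis unfolding Z_def Z'_def by (intro tendsto_intros)
  qed
  show Z'm: "(\<lambda>\<omega>. indicator A \<omega> * semigroup (t - capped t (S \<omega>)) f (X (capped t (S \<omega>)) \<omega>))
      \<in> borel_measurable M"
    using borel_measurable_LIMSEQ_metric[OF Zm Zlim] by (simp add: Z'_def[abs_def])
  have "(\<lambda>n. expectation (Z n)) \<longlonglongrightarrow> expectation Z'"
    by (rule integral_dominated_convergence[where w="\<lambda>_. B"])
        (use Zm Zlim Zb Z'm Z'_def[abs_def] in auto)
  hence "expectation (\<lambda>\<omega>. indicator A \<omega> * f (X t \<omega>)) = expectation Z'"
    unfolding eq[symmetric] by (rule LIMSEQ_unique[OF tendsto_const])
  thus "expectation (\<lambda>\<omega>. indicator A \<omega> * f (X t \<omega>)) =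
    expectation (\<lambda>\<omega>. indicator A \<omega> * semigroup (t - capped t (S \<omega>)) f (X (capped t (S \<omega>)) \<omega>))"
    by (simp add: Z'_def[abs_def])
qed

end

section \<open>The exit time of an open set\<close>

locale levy_in_domain = cadlag_symmetric_levy M X \<eta>
  for M :: "'w measure" and X :: "real \<Rightarrow> 'w \<Rightarrow> 'a::euclidean_space" and \<eta> +
  fixes D :: "'a set"
  assumes open_D: "open D" and D_not_UNIV: "D \<noteq> UNIV"
begin

abbreviation depth :: "'a \<Rightarrow> real" where "depth z \<equiv> infdist z (- D)"

lemma depth_zero_iff: "depth z = 0 \<longleftrightarrow> z \<notin> D"
  using in_closed_iff_infdist_zero[of "- D" z] open_D D_not_UNIV by auto

lemma depth_pos_iff: "0 < depth z \<longleftrightarrow> z \<in> D"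
  using depth_zero_iff[of z] infdist_nonneg[of z "- D"] by linarith

text \<open>
  The hitting time of the open neighbourhood of width \<open>1 / Suc n\<close> of the complement of \<open>D\<close>. By
  right-continuity rational times suffice, which makes it an optional time.
\<close>

definition approach_time :: "'a \<Rightarrow> nat \<Rightarrow> 'w \<Rightarrow> ereal" where
  "approach_time x n \<omega> = (INF q\<in>{q \<in> \<rat>. 0 \<le> q \<and> depth (x + X q \<omega>) < 1 / real (Suc n)}. ereal q)"

text \<open>
  The first time at which the path or its left limit lies outside \<open>D\<close>. It is measurable without
  completing the probability space, which need not be true of the exit time.
\<close>

definition contact_time :: "'a \<Rightarrow> 'w \<Rightarrow> ereal" where
  "contact_time x \<omega> = (SUP n. approach_time x n \<omega>)"

lemma approach_time_less_iff:
  "approach_time x n \<omega> < ereal u \<longleftrightarrow> (\<exists>q\<in>\<rat>. 0 \<le> q \<and> q < u \<and> depth (x + X q \<omega>) < 1 / real (Suc n))"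
  unfolding approach_time_def by (auto simp: INF_less_iff)

lemma approach_time_nonneg: "0 \<le> approach_time x n \<omega>"
  unfolding approach_time_def by (intro INF_greatest) auto

lemma approach_time_incseq: "incseq (\<lambda>n. approach_time x n \<omega>)"
proof (rule incseq_SucI)
  fix n
  have "1 / real (Suc (Suc n)) \<le> 1 / real (Suc n)" by (intro divide_left_mono) auto
  thus "approach_time x n \<omega> \<le> approach_time x (Suc n) \<omega>"
    unfolding approach_time_def by (intro INF_superset_mono) auto
qed

lemma approach_time_past:
  "{\<omega> \<in> space M. approach_time x n \<omega> < ereal u} \<in> sets (past v)" if "u \<le> v"
proof -
  have "{\<omega> \<in> space M. approach_time x n \<omega> < ereal u} =
    (\<Union>q\<in>{q \<in> \<rat>. 0 \<le> q \<and> q < u}. {\<omega> \<in> space (past v). depth (x + X q \<omega>) < 1 / real (Suc n)})"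
    by (auto simp: approach_time_less_iff)
  also have "\<dots> \<in> sets (past v)"
  proof (rule sets.countable_UN'')
    show "countable {q \<in> \<rat>. 0 \<le> q \<and> q < u}" by (rule countable_subset[OF _ countable_rat]) auto
    fix q assume q: "q \<in> {q \<in> \<rat>. 0 \<le> q \<and> q < u}"
    hence [measurable]: "X q \<in> borel_measurable (past v)" using that
        by (intro measurable_past_X) auto
    have [measurable]: "depth \<in> borel_measurable borel"
        by (intro borel_measurable_continuous_onI continuous_intros)
    show "{\<omega> \<in> space (past v). depth (x + X q \<omega>) < 1 / real (Suc n)} \<in> sets (past v)" by measurable
  qed
  finally show ?thesis .
qed

lemma optional_approach_time: "optional_time t (approach_time x n)"
  unfolding optional_time_def using approach_time_nonneg approach_time_past[OF order_refl] by auto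

lemma contact_time_less_iff:
  "contact_time x \<omega> < ereal u \<longleftrightarrow> (\<exists>m. \<forall>n. approach_time x n \<omega> < ereal (u - 1 / real (Suc m)))"
proof
  assume *: "contact_time x \<omega> < ereal u"
  have "0 \<le> contact_time x \<omega>" unfolding contact_time_def using approach_time_nonneg
      by (auto intro: SUP_upper2)
  then obtain r where r: "contact_time x \<omega> = ereal r" using * by (cases "contact_time x \<omega>") auto
  hence "0 < u - r" using * by simp
  then obtain m where m: "inverse (real (Suc m)) < u - r" using reals_Archimedean by blast
  have "approach_time x n \<omega> < ereal (u - 1 / real (Suc m))" for n
  proof -
    have "approach_time x n \<omega> \<le> ereal r" unfolding r[symmetric] contact_time_def
        by (rule SUP_upper) simp
    also have "\<dots> < ereal (u - 1 / real (Suc m))" using m by (simp add: inverse_eq_divide)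
    finally show ?thesis .
  qed
  thus "\<exists>m. \<forall>n. approach_time x n \<omega> < ereal (u - 1 / real (Suc m))" by blast
next
  assume "\<exists>m. \<forall>n. approach_time x n \<omega> < ereal (u - 1 / real (Suc m))"
  then obtain m where "\<And>n. approach_time x n \<omega> < ereal (u - 1 / real (Suc m))" by blast
  hence "contact_time x \<omega> \<le> ereal (u - 1 / real (Suc m))"
    unfolding contact_time_def by (intro SUP_least) (auto intro: less_imp_le)
  also have "\<dots> < ereal u" by simp
  finally show "contact_time x \<omega> < ereal u" .
qed

lemma contact_time_nonneg: "0 \<le> contact_time x \<omega>"
  unfolding contact_time_def using approach_time_nonneg by (auto intro: SUP_upper2)

lemma optional_contact_time: "optional_time t (contact_time x)"
  unfolding optional_time_def
proof (intro conjI allI impI contact_time_nonneg)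
  fix u :: real
  have "{\<omega> \<in> space M. contact_time x \<omega> < ereal u}
      = (\<Union>m. \<Inter>n. {\<omega> \<in> space M. approach_time x n \<omega> < ereal (u - 1 / real (Suc m))})"
    by (auto simp: contact_time_less_iff)
  also have "\<dots> \<in> sets (past u)"
    by (intro sets.countable_UN sets.countable_INT) (auto intro!: approach_time_past)
  finally show "{\<omega> \<in> space M. contact_time x \<omega> < ereal u} \<in> sets (past u)" .
qed

lemma approach_time_le:
  assumes v: "0 \<le> v" and near: "depth (x + X v \<omega>) < 1 / real (Suc n)"
  shows "approach_time x n \<omega> \<le> ereal v"
proof (rule ccontr)
  assume "\<not> approach_time x n \<omega> \<le> ereal v"
  hence "ereal v < approach_time x n \<omega>" by simp
  then obtain r where r: "v < r" "ereal r < approach_time x n \<omega>"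
    using ereal_dense2[of "ereal v" "approach_time x n \<omega>"] by auto
  have "((\<lambda>v. depth (x + X v \<omega>)) \<longlongrightarrow> depth (x + X v \<omega>)) (at_right v)"
    using cadlag_X[of \<omega>] v by (intro tendsto_intros) (auto simp: cadlag_def)
  from order_tendstoD(2)[OF this near] obtain b
      where b: "v < b" "\<And>y. v < y \<Longrightarrow> y < b \<Longrightarrow> depth (x + X y \<omega>) < 1 / real (Suc n)"
    unfolding eventually_at_right_field by blast
  obtain q where q: "q \<in> \<rat>" "v < q" "q < min r b" using Rats_dense_in_real[of v "min r b"] r b
      by auto
  hence "approach_time x n \<omega> < ereal r" using b v
      by (auto simp: approach_time_less_iff intro!: bexI[of _ q])
  thus False using r by simp
qed

lemma depth_at_approach_time:
  assumes v: "approach_time x n \<omega> = ereal v"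
  shows "depth (x + X v \<omega>) \<le> 1 / real (Suc n)"
proof -
  have v0: "0 \<le> v" using approach_time_nonneg[of x n \<omega>] v by simp
  have "\<exists>q. v \<le> q \<and> q < v + 1 / real (Suc k) \<and> depth (x + X q \<omega>) < 1 / real (Suc n)" for k
  proof -
    have "approach_time x n \<omega> < ereal (v + 1 / real (Suc k))" using v by simp
    then obtain q where q: "q \<in> \<rat>" "0 \<le> q" "q < v + 1 / real (Suc k)"
        "depth (x + X q \<omega>) < 1 / real (Suc n)"
      unfolding approach_time_less_iff by blast
    have "v \<le> q" using approach_time_le[OF q(2,4)] v by simp
    thus ?thesis using q by blast
  qed
  then obtain q where q: "\<And>k. v \<le> q k" "\<And>k. q k < v + 1 / real (Suc k)"
      "\<And>k. depth (x + X (q k) \<omega>) < 1 / real (Suc n)"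
    by metis
  have "q \<longlonglongrightarrow> v"
  proof (rule tendsto_sandwich[OF _ _ tendsto_const])
    show "(\<lambda>k. v + 1 / real (Suc k)) \<longlonglongrightarrow> v"
      using tendsto_add[OF tendsto_const[of v] LIMSEQ_inverse_real_of_nat]
          by (simp add: inverse_eq_divide)
  qed (use q(1) less_imp_le[OF q(2)] in \<open>auto simp del: of_nat_Suc\<close>)
  hence "(\<lambda>k. X (q k) \<omega>) \<longlonglongrightarrow> X v \<omega>" by (intro cadlag_right_sequence[OF cadlag_X v0 q(1)])
  hence "(\<lambda>k. depth (x + X (q k) \<omega>)) \<longlonglongrightarrow> depth (x + X v \<omega>)" by (intro tendsto_intros)
  thus ?thesis by (rule LIMSEQ_le_const2) (use q(3) in \<open>auto intro: less_imp_le\<close>)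
qed

lemma contact_time_le:
  assumes "0 \<le> v" "x + X v \<omega> \<notin> D"
  shows "contact_time x \<omega> \<le> ereal v"
  unfolding contact_time_def
proof (rule SUP_least)
  fix n
  have "depth (x + X v \<omega>) < 1 / real (Suc n)" using assms depth_zero_iff by simp
  thus "approach_time x n \<omega> \<le> ereal v" by (rule approach_time_le[OF assms(1)])
qed

lemma in_D_before_contact:
  assumes "0 \<le> v" "ereal v < contact_time x \<omega>"
  shows "x + X v \<omega> \<in> D"
  using contact_time_le[OF assms(1), of x \<omega>] assms(2) by (meson not_less)

lemma contact_time_le_exit_time: "contact_time x \<omega> \<le> exit_time D (\<lambda>s. x + X s \<omega>)"
  unfolding exit_time_def by (intro INF_greatest) (auto intro: contact_time_le)

text \<open>
  Along the approach times the depth of the position tends to zero, and by quasi-left-continuity these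
  positions converge to the position at the contact time.
\<close>

lemma AE_contact_outside:
  "AE \<omega> in M. contact_time x \<omega> < \<infinity> \<longrightarrow> x + X (real_of_ereal (contact_time x \<omega>)) \<omega> \<notin> D"
proof -
  have "AE \<omega> in M. \<forall>m. (\<lambda>n. X (capped (real (Suc m)) (approach_time x n \<omega>)) \<omega>)
      \<longlonglongrightarrow> X (capped (real (Suc m)) (contact_time x \<omega>)) \<omega>"
    unfolding AE_all_countable
    by (intro allI quasi_left_continuity optional_approach_time approach_time_incseq
        optional_contact_time) (auto simp: contact_time_def)
  thus ?thesis
  proof eventually_elim
    case (elim \<omega>)
    show ?case
    proof
      assume fin: "contact_time x \<omega> < \<infinity>"
      then obtain c where c: "contact_time x \<omega> = ereal c" using contact_time_nonneg[of x \<omega>]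
          by (cases "contact_time x \<omega>") auto
      obtain m where m: "c < real (Suc m)" using reals_Archimedean2[of c]
          by (metis less_Suc_eq lessI of_nat_less_iff order_less_trans)
      have le: "approach_time x n \<omega> \<le> ereal c" for n unfolding c[symmetric] contact_time_def
          by (rule SUP_upper) simp
      define a where "a n = capped (real (Suc m)) (approach_time x n \<omega>)" for n
      have a: "approach_time x n \<omega> = ereal (a n)" for n
        unfolding a_def using le[of n] m
            by (intro capped_less approach_time_nonneg) (auto intro: le_less_trans)
      have cc: "capped (real (Suc m)) (contact_time x \<omega>) = c" using m
          by (simp add: c capped_def min_def del: of_nat_Suc)
      have lim: "(\<lambda>n. X (a n) \<omega>) \<longlonglongrightarrow> X c \<omega>" using elim[rule_format, of m] unfolding a_def cc .
      have "(\<lambda>n. depth (x + X (a n) \<omega>)) \<longlonglongrightarrow> depth (x + X c \<omega>)" using lim by (intro tendsto_intros)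
      moreover have "(\<lambda>n. depth (x + X (a n) \<omega>)) \<longlonglongrightarrow> 0"
      proof (rule tendsto_sandwich[OF _ _ tendsto_const])
        show "(\<lambda>n. 1 / real (Suc n)) \<longlonglongrightarrow> 0" using LIMSEQ_inverse_real_of_nat
            by (simp add: inverse_eq_divide)
        show "\<forall>\<^sub>F n in sequentially. depth (x + X (a n) \<omega>) \<le> 1 / real (Suc n)"
          using depth_at_approach_time[OF a] by simp
      qed (auto simp: infdist_nonneg)
      ultimately have "depth (x + X c \<omega>) = 0" by (rule LIMSEQ_unique)
      thus "x + X (real_of_ereal (contact_time x \<omega>)) \<omega> \<notin> D" using depth_zero_iff c by simp
    qed
  qed
qed

text \<open>
  The point \<open>x\<close> itself lies in \<open>D\<close>, so the contact does not happen at time \<open>0\<close>, which the exit time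
  ignores.
\<close>

lemma AE_exit_time_eq:
  assumes x: "x \<in> D"
  shows "AE \<omega> in M. exit_time D (\<lambda>s. x + X s \<omega>) = contact_time x \<omega>"
  using AE_contact_outside[of x]
proof eventually_elim
  case (elim \<omega>)
  have "exit_time D (\<lambda>s. x + X s \<omega>) \<le> contact_time x \<omega>"
  proof (cases "contact_time x \<omega> < \<infinity>")
    case True
    then obtain c where c: "contact_time x \<omega> = ereal c" using contact_time_nonneg[of x \<omega>]
        by (cases "contact_time x \<omega>") auto
    have out: "x + X c \<omega> \<notin> D" using elim True c by simp
    have "0 \<le> c" using contact_time_nonneg[of x \<omega>] c by simp
    moreover have "c \<noteq> 0" using out x X_zero by auto
    ultimately show ?thesis unfolding exit_time_def c using out by (intro INF_lower) auto
  qed auto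
  thus ?case using contact_time_le_exit_time[of x \<omega>] by (rule antisym)
qed

end

section \<open>The killed density as a limit of mollified survival laws\<close>

definition tent :: "nat \<Rightarrow> 'a::euclidean_space \<Rightarrow> real" where
  "tent n v = max 0 (1 - real (Suc n) * norm v)"

text \<open>
  An approximate identity built from compactly supported continuous functions, so that mollifications
  are covered by statements about bounded continuous functions.
\<close>

definition bump_kernel :: "nat \<Rightarrow> 'a::euclidean_space \<Rightarrow> real" where
  "bump_kernel n v = tent n v / integral\<^sup>L lborel (tent n :: 'a \<Rightarrow> real)"

lemma continuous_tent: "continuous_on S (tent n)"
  unfolding tent_def by (intro continuous_intros)

lemma tent_bounds: "0 \<le> tent n v" "tent n v \<le> 1"
  by (auto simp: tent_def)

lemma tent_support: "1 / real (Suc n) \<le> norm v \<Longrightarrow> tent n v = 0"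
  unfolding tent_def by (simp add: pos_divide_le_eq mult.commute del: of_nat_Suc)

lemma measurable_tent [measurable]: "tent n \<in> borel_measurable borel"
  by (intro borel_measurable_continuous_onI continuous_tent)

lemma integrable_tent: "integrable lborel (tent n :: 'a::euclidean_space \<Rightarrow> real)"
proof (rule Bochner_Integration.integrable_bound[of _ "indicator (cball 0 1)"])
  show "integrable lborel (indicator (cball 0 1) :: 'a \<Rightarrow> real)"
    using emeasure_lborel_cball_finite[of "0::'a" 1] by (intro integrable_real_indicator) auto
  show "AE v::'a in lborel. norm (tent n v) \<le> norm (indicator (cball 0 1) v :: real)"
  proof (intro AE_I2)
    fix v :: 'a
    have "tent n v = 0" if "norm v > 1"
    proof (rule tent_support)
      have "1 / real (Suc n) \<le> 1" by simp
      thus "1 / real (Suc n) \<le> norm v" using that by linarith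
    qed
    thus "norm (tent n v) \<le> norm (indicator (cball 0 1) v :: real)"
      using tent_bounds[of n v] by (auto simp: indicator_def)
  qed
qed simp

lemma integral_tent_pos: "0 < integral\<^sup>L lborel (tent n :: 'a::euclidean_space \<Rightarrow> real)"
proof -
  let ?B = "ball (0::'a) (1 / (2 * real (Suc n)))"
  have "0 < measure lborel ?B" by (intro content_ball_pos) simp
  hence "0 < integral\<^sup>L lborel (\<lambda>v::'a. (1/2) * indicator ?B v :: real)"
    by simp
  also have "\<dots> \<le> integral\<^sup>L lborel (tent n :: 'a \<Rightarrow> real)"
  proof (rule integral_mono[OF _ integrable_tent])
    show "integrable lborel (\<lambda>v::'a. (1/2) * indicator ?B v :: real)"
      using emeasure_lborel_ball_finite[of "0::'a" "1 / (2 * real (Suc n))"]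
      by (intro integrable_mult_right integrable_real_indicator) (auto simp del: of_nat_Suc)
    fix v :: 'a
    show "(1/2) * indicator ?B v \<le> tent n v"
    proof (cases "v \<in> ?B")
      case True
      hence "real (Suc n) * norm v \<le> 1/2" by (simp add: field_simps)
      thus ?thesis using True by (simp add: tent_def)
    qed (use tent_bounds[of n v] in simp)
  qed
  finally show ?thesis .
qed

lemma bump_kernel_nonneg: "0 \<le> bump_kernel n v"
  unfolding bump_kernel_def using tent_bounds integral_tent_pos by (intro divide_nonneg_pos) auto

lemma bump_kernel_bound: "\<bar>bump_kernel n v\<bar> \<le> 1 / integral\<^sup>L lborel (tent n :: 'a \<Rightarrow> real)"
    for v :: "'a::euclidean_space"
  using bump_kernel_nonneg[of n v] tent_bounds[of n v] integral_tent_pos[where 'a='a, of n]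
  by (simp add: bump_kernel_def divide_right_mono)

lemma continuous_bump_kernel: "continuous_on S (bump_kernel n :: 'a::euclidean_space \<Rightarrow> real)"
  unfolding bump_kernel_def using integral_tent_pos[where 'a='a, of n]
  by (intro continuous_intros continuous_tent) auto

lemma measurable_bump_kernel [measurable]: "bump_kernel n \<in> borel_measurable borel"
  by (intro borel_measurable_continuous_onI continuous_bump_kernel)

lemma bump_kernel_support: "1 / real (Suc n) \<le> norm v \<Longrightarrow> bump_kernel n v = 0"
  by (simp add: bump_kernel_def tent_support)

lemma bump_kernel_minus: "bump_kernel n (- v) = bump_kernel n v"
  by (simp add: bump_kernel_def tent_def)

lemma integral_bump_kernel:
  fixes w :: "'a::euclidean_space"
  shows "integrable lborel (\<lambda>v. bump_kernel n (w - v))"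
      "integral\<^sup>L lborel (\<lambda>v. bump_kernel n (w - v)) = 1"
proof -
  have i: "integrable lborel (bump_kernel n :: 'a \<Rightarrow> real)"
    unfolding bump_kernel_def using integrable_tent by auto
  have e: "integral\<^sup>L lborel (bump_kernel n :: 'a \<Rightarrow> real) = 1"
    unfolding bump_kernel_def using integral_tent_pos[where 'a='a, of n] by simp
  have eq: "bump_kernel n (w - v) = bump_kernel n (- w + v)" for v
    using bump_kernel_minus[of n "w - v"] by simp
  show "integrable lborel (\<lambda>v. bump_kernel n (w - v))"
    unfolding eq using lborel_integrable_real_affine_iff[of 1] i
    by (subst lborel_distr_plus[symmetric, of w]) (auto simp: integrable_distr_eq)
  have "integral\<^sup>L lborel (\<lambda>v. bump_kernel n (- w + v))
      = integral\<^sup>L (distr lborel borel ((+) (- w))) (bump_kernel n)"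
    by (subst integral_distr) auto
  thus "integral\<^sup>L lborel (\<lambda>v. bump_kernel n (w - v)) = 1"
    unfolding eq lborel_distr_plus e .
qed

lemma bump_kernel_average:
  fixes g :: "'a::euclidean_space \<Rightarrow> real"
  assumes [measurable]: "g \<in> borel_measurable borel"
    and B: "\<And>v. dist w v < 1 / real (Suc n) \<Longrightarrow> \<bar>g v\<bar> \<le> B" "0 \<le> B"
  shows "integrable lborel (\<lambda>v. g v * bump_kernel n (w - v))"
    and "\<bar>integral\<^sup>L lborel (\<lambda>v. g v * bump_kernel n (w - v))\<bar> \<le> B"
proof -
  have bd: "\<bar>g v * bump_kernel n (w - v)\<bar> \<le> B * bump_kernel n (w - v)" for v
  proof (cases "dist w v < 1 / real (Suc n)")
    case True
    thus ?thesis using B(1)[OF True] bump_kernel_nonneg[of n "w - v"]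
        by (simp add: abs_mult mult_right_mono)
  next
    case False
    hence "bump_kernel n (w - v) = 0" by (intro bump_kernel_support) (simp add: dist_norm)
    thus ?thesis by simp
  qed
  have i: "integrable lborel (\<lambda>v. B * bump_kernel n (w - v))"
      by (intro integrable_mult_right integral_bump_kernel)
  show int: "integrable lborel (\<lambda>v. g v * bump_kernel n (w - v))"
    by (rule Bochner_Integration.integrable_bound[OF i])
        (use bd in \<open>auto intro: order_trans[OF _ abs_ge_self]\<close>)
  have "\<bar>integral\<^sup>L lborel (\<lambda>v. g v * bump_kernel n (w - v))\<bar>
      \<le> integral\<^sup>L lborel (\<lambda>v. \<bar>g v * bump_kernel n (w - v)\<bar>)"
    by (rule integral_abs_bound)
  also have "\<dots> \<le> integral\<^sup>L lborel (\<lambda>v. B * bump_kernel n (w - v))"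
    using bd by (intro integral_mono integrable_abs int i) auto
  also have "\<dots> = B" by (simp add: integral_bump_kernel)
  finally show "\<bar>integral\<^sup>L lborel (\<lambda>v. g v * bump_kernel n (w - v))\<bar> \<le> B" .
qed

lemma bump_kernel_approximation:
  fixes g :: "'a::euclidean_space \<Rightarrow> real"
  assumes g: "continuous_on UNIV g"
  shows "(\<lambda>n. integral\<^sup>L lborel (\<lambda>v. g v * bump_kernel n (w - v))) \<longlonglongrightarrow> g w"
proof (rule LIMSEQ_I)
  fix e :: real assume e: "e > 0"
  have [measurable]: "g \<in> borel_measurable borel" by (rule borel_measurable_continuous_onI[OF g])
  obtain d where d: "d > 0" "\<And>v. dist v w < d \<Longrightarrow> dist (g v) (g w) < e / 2"
    using g e unfolding continuous_on_iff by (metis UNIV_I half_gt_zero)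
  obtain N where N: "inverse (real (Suc N)) < d" using reals_Archimedean[OF d(1)] by blast
  have "norm (integral\<^sup>L lborel (\<lambda>v. g v * bump_kernel n (w - v)) - g w) < e" if n: "n \<ge> N" for n
  proof -
    have le: "1 / real (Suc n) < d"
    proof -
      have "1 / real (Suc n) \<le> inverse (real (Suc N))" using n by (simp add: field_simps)
      thus ?thesis using N by linarith
    qed
    have cl: "\<bar>g v - g w\<bar> \<le> e / 2" if "dist w v < 1 / real (Suc n)" for v
      using d(2)[of v] that le by (simp add: dist_real_def dist_commute)
    have gb: "\<bar>g v\<bar> \<le> \<bar>g w\<bar> + e / 2" if "dist w v < 1 / real (Suc n)" for v
      using cl[OF that] by linarith
    have i1: "integrable lborel (\<lambda>v. g v * bump_kernel n (w - v))"
      by (rule bump_kernel_average(1)[OF _ gb]) (use e in auto)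
    have "integral\<^sup>L lborel (\<lambda>v. g v * bump_kernel n (w - v)) - g w =
      integral\<^sup>L lborel (\<lambda>v. g v * bump_kernel n (w - v)) - integral\<^sup>L lborel
          (\<lambda>v. g w * bump_kernel n (w - v))"
      by (simp add: integral_bump_kernel)
    also have "\<dots> = integral\<^sup>L lborel (\<lambda>v. (g v - g w) * bump_kernel n (w - v))"
      using i1 e by (subst Bochner_Integration.integral_diff[symmetric])
          (auto simp: integral_bump_kernel left_diff_distrib)
    also have "\<bar>\<dots>\<bar> \<le> e / 2"
      by (rule bump_kernel_average(2)[OF _ cl]) (use e in auto)
    finally have "\<bar>integral\<^sup>L lborel (\<lambda>v. g v * bump_kernel n (w - v)) - g w\<bar> \<le> e / 2" .
    thus ?thesis using e by simp
  qed
  thus "\<exists>no. \<forall>n\<ge>no. norm (integral\<^sup>L lborel (\<lambda>v. g v * bump_kernel n (w - v)) - g w) < e" by blast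
qed

text \<open>
  In a complete measure space a function that agrees almost everywhere with a measurable one is
  measurable; hence either both integrands are measurable or both integrals are zero by convention.
\<close>

lemma integral_completion_cong_AE:
  fixes f g :: "'w \<Rightarrow> real"
  assumes eq: "AE \<omega> in M. f \<omega> = g \<omega>"
  shows "integral\<^sup>L (completion M) f = integral\<^sup>L (completion M) g"
proof -
  have eq': "AE \<omega> in completion M. f \<omega> = g \<omega>" using eq by (rule AE_completion)
  have meas: "k \<in> borel_measurable (completion M)"
      if "h \<in> borel_measurable (completion M)" "AE \<omega> in completion M. h \<omega> = k \<omega>"
      for h k :: "'w \<Rightarrow> real"
  proof (rule measurableI)
    fix A :: "real set" assume "A \<in> sets borel"
    hence A: "h -` A \<inter> space (completion M) \<in> sets (completion M)" using that(1)
        by (rule measurable_sets[rotated])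
    have ae: "AE \<omega> in completion M. \<omega> \<in> h -` A \<inter> space (completion M) \<longleftrightarrow> \<omega>
        \<in> k -` A \<inter> space (completion M)"
      using that(2) by eventually_elim auto
    show "k -` A \<inter> space (completion M) \<in> sets (completion M)"
      by (rule completion.in_sets_AE[OF ae A]) auto
  qed simp
  show ?thesis
  proof (cases "f \<in> borel_measurable (completion M)")
    case True
    thus ?thesis using meas[OF True eq'] eq' by (intro integral_cong_AE)
  next
    case False
    hence "g \<notin> borel_measurable (completion M)" using meas[of g f] eq' by (auto simp: eq_commute)
    hence "\<not> integrable (completion M) f" "\<not> integrable (completion M) g" using False
        by (auto dest: borel_measurable_integrable)
    thus ?thesis by (simp add: not_integrable_integral_eq)
  qed
qed

locale levy_density_in_domain = levy_in_domain M X \<eta> D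
  for M :: "'w measure" and X :: "real \<Rightarrow> 'w \<Rightarrow> 'a::euclidean_space" and \<eta> D +
  fixes p :: "real \<Rightarrow> 'a \<Rightarrow> real"
  assumes density: "continuous_transition_density M X p"
    and density_bound: "\<And>\<delta>. \<delta> > 0 \<Longrightarrow> \<exists>c. \<forall>t>0. \<forall>z. norm z \<ge> \<delta> \<longrightarrow> p t z \<le> c"
begin

lemma p_nonneg: "t > 0 \<Longrightarrow> 0 \<le> p t z"
  and p_continuous: "t > 0 \<Longrightarrow> continuous_on S (p t)"
  and p_distributed: "t > 0 \<Longrightarrow> distributed M lborel (X t) (\<lambda>z. ennreal (p t z))"
  using density by (auto simp: continuous_transition_density_def intro: continuous_on_subset)

lemma measurable_p: "t > 0 \<Longrightarrow> p t \<in> borel_measurable borel"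
  by (intro borel_measurable_continuous_onI p_continuous)

lemma p_bounded:
  assumes "t > 0"
  obtains B where "B \<ge> 0" "\<And>z. p t z \<le> B"
proof -
  obtain c where c: "\<And>z. norm z \<ge> 1 \<Longrightarrow> p t z \<le> c" using density_bound[of 1] assms by auto
  have "compact (p t ` cball 0 1)" by (intro compact_continuous_image p_continuous assms) auto
  then obtain b where b: "\<And>z. z \<in> cball 0 1 \<Longrightarrow> \<bar>p t z\<bar> \<le> b" using compact_imp_bounded
      by (fastforce simp: bounded_iff)
  have "p t z \<le> max 0 (max b c)" for z
    using c[of z] b[of z] by (cases "norm z \<le> 1")
        (auto simp: le_max_iff_disj intro: order_trans[OF abs_ge_self])
  thus thesis by (intro that[of "max 0 (max b c)"]) auto
qed

text \<open>
  Reflecting the increment turns the mollified semigroup into a convolution of \<open>p u\<close> at \<open>w - y\<close>.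
\<close>

lemma semigroup_bump_kernel:
  assumes "u > 0"
  shows "semigroup u (\<lambda>z. bump_kernel n (z - y)) w
      = integral\<^sup>L lborel (\<lambda>v. p u v * bump_kernel n ((w - y) - v))"
proof -
  have [measurable]: "(\<lambda>v. bump_kernel n ((w - y) - v)) \<in> borel_measurable borel" by measurable
  have "semigroup u (\<lambda>z. bump_kernel n (z - y)) w
      = expectation (\<lambda>\<omega>. bump_kernel n ((w - y) - (- X u \<omega>)))"
    unfolding semigroup_def by (simp add: algebra_simps)
  also have "\<dots> = expectation (\<lambda>\<omega>. bump_kernel n ((w - y) - X u \<omega>))"
    using assms by (intro expectation_reflect[where f = "\<lambda>v. bump_kernel n ((w - y) - v)"]) auto
  also have "\<dots> = integral\<^sup>L lborel (\<lambda>v. p u v * bump_kernel n ((w - y) - v))"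
    using p_nonneg[OF assms] by
        (intro distributed_integral[OF p_distributed[OF assms], symmetric]) auto
  finally show ?thesis .
qed

lemma semigroup_bump_kernel_tendsto:
  assumes "u > 0"
  shows "(\<lambda>n. semigroup u (\<lambda>z. bump_kernel n (z - y)) w) \<longlonglongrightarrow> p u (w - y)"
  unfolding semigroup_bump_kernel[OF assms] by (intro bump_kernel_approximation p_continuous assms)

lemma semigroup_bump_kernel_le:
  assumes u: "u > 0" and c: "0 \<le> c" "\<And>v. dist (w - y) v < 1 / real (Suc n) \<Longrightarrow> p u v \<le> c"
  shows "\<bar>semigroup u (\<lambda>z. bump_kernel n (z - y)) w\<bar> \<le> c"
  unfolding semigroup_bump_kernel[OF u]
  using c p_nonneg[OF u] by (intro bump_kernel_average(2) measurable_p u) auto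

text \<open>
  Contact at time \<open>t\<close> itself counts as survival, which matches the strict inequality in the definition
  of the killed density.
\<close>

definition alive :: "'a \<Rightarrow> real \<Rightarrow> 'w set" where
  "alive x t = {\<omega> \<in> space M. ereal t \<le> contact_time x \<omega>}"

lemma alive_past: "t > 0 \<Longrightarrow> alive x t \<in> sets (past t)"
proof -
  assume t: "t > 0"
  have "alive x t = space (past t) - {\<omega> \<in> space M. contact_time x \<omega> < ereal t}"
      by (auto simp: alive_def)
  moreover have "{\<omega> \<in> space M. contact_time x \<omega> < ereal t} \<in> sets (past t)"
    using optional_contact_time[of t x] t by (auto simp: optional_time_def)
  ultimately show ?thesis by (simp only: sets.Diff sets.top)
qed

lemma alive_events: "t > 0 \<Longrightarrow> alive x t \<in> events"
  using alive_past sets_past_subset by blast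

definition killed_mollified :: "'a \<Rightarrow> real \<Rightarrow> nat \<Rightarrow> 'a \<Rightarrow> real" where
  "killed_mollified x t n y = expectation
      (\<lambda>\<omega>. indicator (alive x t) \<omega> * bump_kernel n (x + X t \<omega> - y))"

text \<open>
  By the strong Markov property at the contact time, the mollified law of \<open>X t\<close> on the event of contact
  before \<open>t\<close> is the expectation of a mollified transition density started at the place of contact.
  That place is outside \<open>D\<close>, at a positive distance from \<open>y\<close>, where the densities are bounded uniformly
  in time; so dominated convergence removes the mollification.
\<close>

lemma killed_mollified_tendsto:
  assumes t: "t > 0" and x: "x \<in> D" and y: "y \<in> D"
  shows "(\<lambda>n. killed_mollified x t n y) \<longlonglongrightarrow> killed_density M X p D t x y"
proof -
  let ?T = "contact_time x"
  define A where "A = {\<omega> \<in> space M. ?T \<omega> < ereal t}"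
  have "A \<in> sets (past t)" using optional_contact_time[of t x] t
      by (auto simp: A_def optional_time_def)
  hence [measurable]: "A \<in> events" using sets_past_subset by blast
  have [measurable]: "X t \<in> borel_measurable M" using t by (intro measurable_X) auto
  define f where "f n z = bump_kernel n (z - (y - x))" for n z
  have fc: "continuous_on UNIV (f n)" for n
    unfolding f_def by (intro continuous_on_compose2[OF continuous_bump_kernel] continuous_intros)
        auto
  have fb: "\<bar>f n z\<bar> \<le> 1 / integral\<^sup>L lborel (tent n :: 'a \<Rightarrow> real)" for n z
    unfolding f_def by (rule bump_kernel_bound)
  have [measurable]: "f n \<in> borel_measurable borel" for n
      by (rule borel_measurable_continuous_onI[OF fc])
  define R where "R n \<omega> = indicator A \<omega> * semigroup (t - capped t (?T \<omega>)) (f n)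
      (X (capped t (?T \<omega>)) \<omega>)" for n \<omega>
  define R' where "R' \<omega> = indicator A \<omega> * p (t - capped t (?T \<omega>))
      (X (capped t (?T \<omega>)) \<omega> - (y - x))" for \<omega>
  note sm = strong_markov[OF optional_contact_time t fc fb, of x, folded A_def]
  have Rm: "R n \<in> borel_measurable M" for n using sm(2)[of n] by (simp add: R_def[abs_def])
  have cap: "0 < t - capped t (?T \<omega>)" "?T \<omega> = ereal (capped t (?T \<omega>))" if "\<omega> \<in> A" for \<omega>
  proof -
    have "?T \<omega> < ereal t" using that by (simp add: A_def)
    note eq = capped_less[OF contact_time_nonneg this]
    show "?T \<omega> = ereal (capped t (?T \<omega>))" by (rule eq)
    have "ereal (capped t (?T \<omega>)) < ereal t" using \<open>?T \<omega> < ereal t\<close> by (subst (asm) eq)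
    thus "0 < t - capped t (?T \<omega>)" by simp
  qed
  have Rlim: "(\<lambda>n. R n \<omega>) \<longlonglongrightarrow> R' \<omega>" for \<omega>
  proof (cases "\<omega> \<in> A")
    case True
    have "(\<lambda>n. semigroup (t - capped t (?T \<omega>)) (f n) (X (capped t (?T \<omega>)) \<omega>))
        \<longlonglongrightarrow> p (t - capped t (?T \<omega>)) (X (capped t (?T \<omega>)) \<omega> - (y - x))"
      unfolding f_def by (rule semigroup_bump_kernel_tendsto[OF cap(1)[OF True]])
    thus ?thesis unfolding R_def R'_def by (intro tendsto_intros)
  qed (simp add: R_def R'_def)
  have R'm: "R' \<in> borel_measurable M" by (rule borel_measurable_LIMSEQ_metric[OF Rm Rlim])
  \<comment> \<open>Places of contact have distance at least \<open>2 * \<delta>\<close> from \<open>y\<close>; mollification at a scale below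
    \<open>\<delta>\<close> keeps the argument of the density outside the ball of radius \<open>\<delta>\<close>.\<close>
  define \<delta> where "\<delta> = depth y / 2"
  have \<delta>: "\<delta> > 0" using y depth_pos_iff by (simp add: \<delta>_def)
  obtain c0 where c0: "\<And>u z. u > 0 \<Longrightarrow> norm z \<ge> \<delta> \<Longrightarrow> p u z \<le> c0" using density_bound[OF \<delta>] by blast
  define c where "c = max 0 c0"
  have c: "0 \<le> c" "\<And>u z. u > 0 \<Longrightarrow> norm z \<ge> \<delta> \<Longrightarrow> p u z \<le> c" using c0
      by (auto simp: c_def le_max_iff_disj)
  obtain N where N: "inverse (real (Suc N)) < \<delta>" using reals_Archimedean[OF \<delta>] by blast
  have Rb: "AE \<omega> in M. \<bar>R (n + N) \<omega>\<bar> \<le> c" for n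
    using AE_contact_outside[of x]
  proof eventually_elim
    case (elim \<omega>)
    show ?case
    proof (cases "\<omega> \<in> A")
      case True
      let ?u = "capped t (?T \<omega>)"
      have "?T \<omega> < \<infinity>" by (subst cap(2)[OF True]) simp
      hence out: "x + X ?u \<omega> \<notin> D" using elim cap(2)[OF True] by (metis real_of_ereal.simps(1))
      have far: "2 * \<delta> \<le> dist y (x + X ?u \<omega>)" unfolding \<delta>_def using out by (simp add: infdist_le)
      have small: "1 / real (Suc (n + N)) < \<delta>"
      proof -
        have "1 / real (Suc (n + N)) \<le> inverse (real (Suc N))" by (simp add: field_simps)
        thus ?thesis using N by linarith
      qed
      have "\<bar>semigroup (t - ?u) (f (n + N)) (X ?u \<omega>)\<bar> \<le> c"
        unfolding f_def
      proof (rule semigroup_bump_kernel_le[OF cap(1)[OF True] c(1)])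
        fix v assume v: "dist (X ?u \<omega> - (y - x)) v < 1 / real (Suc (n + N))"
        have "dist y (x + X ?u \<omega>) = norm (X ?u \<omega> - (y - x))"
            by (simp add: dist_norm norm_minus_commute algebra_simps)
        moreover have "norm (X ?u \<omega> - (y - x)) \<le> dist (X ?u \<omega> - (y - x)) v + norm v"
          using norm_triangle_ineq[of "X ?u \<omega> - (y - x) - v" v] by (simp add: dist_norm)
        ultimately have "\<delta> \<le> norm v" using far v small by linarith
        thus "p (t - ?u) v \<le> c" by (intro c(2) cap(1)[OF True])
      qed
      thus ?thesis using True by (simp add: R_def)
    qed (use c in \<open>simp add: R_def\<close>)
  qed
  have lim1: "(\<lambda>n. expectation (R (n + N))) \<longlonglongrightarrow> expectation R'"
  proof (rule integral_dominated_convergence[where w="\<lambda>_. c"])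
    show "AE \<omega> in M. (\<lambda>n. R (n + N) \<omega>) \<longlonglongrightarrow> R' \<omega>" using LIMSEQ_ignore_initial_segment[OF Rlim] by auto
  qed (use Rm R'm Rb in auto)
  have lim2: "(\<lambda>n. semigroup t (f (n + N)) 0) \<longlonglongrightarrow> p t (x - y)"
    using LIMSEQ_ignore_initial_segment[OF semigroup_bump_kernel_tendsto[OF t, of "y - x" 0], of N]
    by (simp add: f_def[abs_def])
  have kd: "killed_density M X p D t x y = p t (x - y) - expectation R'"
  proof -
    have "(LINT \<omega>|completion M. (let \<tau> = exit_time D (\<lambda>s. x + X s \<omega>); u = real_of_ereal \<tau>
         in if \<tau> < ereal t then p (t - u) (x + X u \<omega> - y) else 0)) = expectation R'"
    proof (subst integral_completion[OF R'm, symmetric], rule integral_completion_cong_AE)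
      show "AE \<omega> in M. (let \<tau> = exit_time D (\<lambda>s. x + X s \<omega>); u = real_of_ereal \<tau>
         in if \<tau> < ereal t then p (t - u) (x + X u \<omega> - y) else 0) = R' \<omega>"
        using AE_exit_time_eq[OF x] AE_space
      proof eventually_elim
        case (elim \<omega>)
        show ?case
        proof (cases "\<omega> \<in> A")
          case True
          have "real_of_ereal (?T \<omega>) = capped t (?T \<omega>)" by (subst cap(2)[OF True]) simp
          moreover have "?T \<omega> < ereal t" using True by (simp add: A_def)
          ultimately show ?thesis using True by (simp add: elim(1) R'_def Let_def algebra_simps)
        next
          case False
          hence "\<not> ?T \<omega> < ereal t" using elim(2) by (simp add: A_def)
          thus ?thesis using False by (simp add: elim(1) R'_def Let_def)
        qed
      qed
    qed
    thus ?thesis by (simp add: killed_density_def)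
  qed
  have km: "killed_mollified x t n y = semigroup t (f n) 0 - expectation (R n)" for n
  proof -
    have "killed_mollified x t n y = expectation (\<lambda>\<omega>. f n (X t \<omega>) - indicator A \<omega> * f n (X t \<omega>))"
      unfolding killed_mollified_def
      by (intro Bochner_Integration.integral_cong refl)
          (auto simp: alive_def A_def f_def indicator_def not_less algebra_simps)
    also have "\<dots> = expectation (\<lambda>\<omega>. f n (X t \<omega>)) - expectation (\<lambda>\<omega>. indicator A \<omega> * f n (X t \<omega>))"
    proof (intro Bochner_Integration.integral_diff
        integrable_bounded[of _ "1 / integral\<^sup>L lborel (tent n :: 'a \<Rightarrow> real)"])
      show "\<bar>indicator A \<omega> * f n (X t \<omega>)\<bar> \<le> 1 / integral\<^sup>L lborel (tent n :: 'a \<Rightarrow> real)" for \<omega>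
        using fb[of n "X t \<omega>"] less_imp_le[OF integral_tent_pos[where 'a='a, of n]]
            by (auto simp: indicator_def)
    qed (use fb in auto)
    finally show ?thesis using sm(1)[of n] by (simp add: R_def[abs_def] semigroup_def)
  qed
  have "(\<lambda>n. killed_mollified x t (n + N) y) \<longlonglongrightarrow> killed_density M X p D t x y"
    unfolding km kd by (intro tendsto_diff lim1 lim2)
  thus ?thesis by (rule LIMSEQ_offset)
qed

end

section \<open>The killed transition density\<close>

text \<open>
  A nonempty open set is not negligible.
\<close>

lemma nonneg_of_AE_nonneg:
  fixes h :: "'a::euclidean_space \<Rightarrow> real"
  assumes D: "open D" and h: "continuous_on D h" and AE: "AE y in lborel. y \<in> D \<longrightarrow> 0 \<le> h y"
      and y: "y \<in> D"
  shows "0 \<le> h y"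
proof (rule ccontr)
  assume "\<not> 0 \<le> h y"
  hence ne: "D \<inter> h -` {..<0} \<noteq> {}" using y by auto
  have op: "open (D \<inter> h -` {..<0})" by (rule continuous_open_preimage[OF h D]) simp
  have "AE y in lborel. y \<notin> D \<inter> h -` {..<0}" using AE by eventually_elim auto
  hence "D \<inter> h -` {..<0} \<in> null_sets lborel" using op by (subst AE_iff_null_sets) auto
  hence "negligible (D \<inter> h -` {..<0})"
    by (simp add: negligible_iff_null_sets null_sets_completionI)
  thus False using open_not_negligible[OF op ne] by blast
qed

locale killed_levy = levy_density_in_domain M X \<eta> D p
  for M :: "'w measure" and X :: "real \<Rightarrow> 'w \<Rightarrow> 'a::euclidean_space" and \<eta> D p +
  fixes pD :: "real \<Rightarrow> 'a \<Rightarrow> 'a \<Rightarrow> real"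
  assumes regular: "regular_killed_density M X p D pD"
    and bounded_D: "bounded D"
begin

lemma D_sets [measurable]: "D \<in> sets borel" using open_D by simp

lemma emeasure_D_finite: "emeasure lborel D < \<infinity>"
  using emeasure_bounded_finite[OF bounded_D] .

lemma pD_AE: "t > 0 \<Longrightarrow> x \<in> D \<Longrightarrow> AE y in lborel. y \<in> D \<longrightarrow> pD t x y = killed_density M X p D t x y"
  and pD_continuous: "t > 0 \<Longrightarrow> continuous_on (D \<times> D) (\<lambda>(x, y). pD t x y)"
  and pD_symmetric: "t > 0 \<Longrightarrow> x \<in> D \<Longrightarrow> y \<in> D \<Longrightarrow> pD t x y = pD t y x"
  using regular unfolding regular_killed_density_def by blast+

lemma pD_continuous_right: "t > 0 \<Longrightarrow> x \<in> D \<Longrightarrow> continuous_on D (pD t x)"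
  by (rule continuous_on_compose2[OF pD_continuous, of t D "\<lambda>y. (x, y)", simplified])
     (auto intro!: continuous_intros)

lemma killed_mollified_bounds:
  assumes t: "t > 0" and B: "B \<ge> 0" "\<And>z. p t z \<le> B"
  shows "0 \<le> killed_mollified x t n y" "killed_mollified x t n y \<le> B"
proof -
  note alive_events[OF t, measurable]
  have [measurable]: "X t \<in> borel_measurable M" using t by (intro measurable_X) auto
  show "0 \<le> killed_mollified x t n y"
    unfolding killed_mollified_def by (intro integral_nonneg_AE) (auto simp: bump_kernel_nonneg)
  have "killed_mollified x t n y \<le> semigroup t (\<lambda>z. bump_kernel n (z - y)) x"
    unfolding killed_mollified_def semigroup_def
  proof (intro integral_mono integrable_bounded[of _ "1 / integral\<^sup>L lborel (tent n :: 'a \<Rightarrow> real)"])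
    show "\<bar>indicator (alive x t) \<omega> * bump_kernel n (x + X t \<omega> - y)\<bar>
        \<le> 1 / integral\<^sup>L lborel (tent n :: 'a \<Rightarrow> real)" for \<omega>
      using bump_kernel_bound[of n "x + X t \<omega> - y"]
          less_imp_le[OF integral_tent_pos[where 'a='a, of n]] by (auto simp: indicator_def)
    show "indicator (alive x t) \<omega> * bump_kernel n (x + X t \<omega> - y) \<le> bump_kernel n (x + X t \<omega> - y)"
        for \<omega>
      using bump_kernel_nonneg[of n "x + X t \<omega> - y"] by (auto simp: indicator_def)
  qed (use bump_kernel_bound in auto)
  also have "\<dots> \<le> B" using semigroup_bump_kernel_le[OF t B(1), of x y n] B(2) by (meson abs_le_D1)
  finally show "killed_mollified x t n y \<le> B" .
qed

lemma killed_density_bounds: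
  assumes t: "t > 0" and B: "B \<ge> 0" "\<And>z. p t z \<le> B" and xy: "x \<in> D" "y \<in> D"
  shows "0 \<le> killed_density M X p D t x y" "killed_density M X p D t x y \<le> B"
proof -
  note lim = killed_mollified_tendsto[OF t xy]
  show "0 \<le> killed_density M X p D t x y" "killed_density M X p D t x y \<le> B"
    using LIMSEQ_le_const[OF lim] LIMSEQ_le_const2[OF lim] killed_mollified_bounds[OF t B] by blast+
qed

lemma pD_bounds:
  assumes t: "t > 0" and B: "B \<ge> 0" "\<And>z. p t z \<le> B" and xy: "x \<in> D" "y \<in> D"
  shows "0 \<le> pD t x y" "pD t x y \<le> B"
proof -
  note c = pD_continuous_right[OF t xy(1)]
  have "AE y in lborel. y \<in> D \<longrightarrow> 0 \<le> pD t x y"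
    using pD_AE[OF t xy(1)] killed_density_bounds(1)[OF t B xy(1)] by (auto elim!: eventually_mono)
  from nonneg_of_AE_nonneg[OF open_D c this xy(2)] show "0 \<le> pD t x y" .
  have "AE y in lborel. y \<in> D \<longrightarrow> 0 \<le> B - pD t x y"
    using pD_AE[OF t xy(1)] killed_density_bounds(2)[OF t B xy(1)] by (auto elim!: eventually_mono)
  from nonneg_of_AE_nonneg[OF open_D continuous_on_diff[OF continuous_on_const c] this xy(2)]
  show "pD t x y \<le> B" by simp
qed

lemma pD_nonneg: "t > 0 \<Longrightarrow> x \<in> D \<Longrightarrow> y \<in> D \<Longrightarrow> 0 \<le> pD t x y"
  using p_bounded[of t] pD_bounds(1)[of t] by metis

lemma measurable_pD: "t > 0 \<Longrightarrow> x \<in> D \<Longrightarrow> (\<lambda>y. indicator D y * pD t x y) \<in> borel_measurable borel"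
  using borel_measurable_continuous_on_indicator[OF D_sets pD_continuous_right] by simp

lemma integrable_pD_mult:
  assumes t: "t > 0" and x: "x \<in> D" and f: "set_integrable lborel D f"
  shows "set_integrable lborel D (\<lambda>y. pD t x y * f y)"
proof -
  obtain B where B: "B \<ge> 0" "\<And>z. p t z \<le> B" using p_bounded[OF t] by blast
  have [measurable]: "(\<lambda>y. indicator D y * f y) \<in> borel_measurable borel"
    using f unfolding set_integrable_def by (auto dest: borel_measurable_integrable)
  have "integrable lborel (\<lambda>y. B * (indicator D y * f y))" using f by (simp add: set_integrable_def)
  hence "integrable lborel (\<lambda>y. (indicator D y * pD t x y) * (indicator D y * f y))"
  proof (rule Bochner_Integration.integrable_bound)
    show "(\<lambda>y. (indicator D y * pD t x y) * (indicator D y * f y)) \<in> borel_measurable lborel"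
      using measurable_pD[OF t x] by simp
    show "AE y in lborel. norm ((indicator D y * pD t x y) * (indicator D y * f y))
        \<le> norm (B * (indicator D y * f y))"
    proof (intro AE_I2)
      fix y
      show "norm ((indicator D y * pD t x y) * (indicator D y * f y))
          \<le> norm (B * (indicator D y * f y))"
        using pD_bounds[OF t B x, of y] B(1)
            by (auto simp: indicator_def abs_mult intro!: mult_right_mono)
    qed
  qed
  moreover have "(indicator D y * pD t x y) * (indicator D y * f y)
      = indicator D y * (pD t x y * f y)" for y
    by (simp add: indicator_def)
  ultimately show ?thesis by (simp add: set_integrable_def)
qed

lemma measurable_killed_mollified: "t > 0 \<Longrightarrow> killed_mollified x t n \<in> borel_measurable borel"
proof -
  assume t: "t > 0"
  note alive_events[OF t, measurable]
  have [measurable]: "X t \<in> borel_measurable M" using t by (intro measurable_X) auto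
  show ?thesis unfolding killed_mollified_def[abs_def] by measurable
qed

text \<open>
  Fatou's lemma for the mollified survival laws, each of which has the total mass of the event of
  survival.
\<close>

lemma pD_mass_le_alive:
  assumes t: "t > 0" and x: "x \<in> D"
  shows "set_lebesgue_integral lborel D (pD t x) \<le> prob (alive x t)"
proof -
  note alive_events[OF t, measurable]
  have [measurable]: "X t \<in> borel_measurable M" using t by (intro measurable_X) auto
  note measurable_killed_mollified[OF t, measurable]
  obtain B where B: "B \<ge> 0" "\<And>z. p t z \<le> B" using p_bounded[OF t] by blast
  interpret L: pair_sigma_finite lborel M ..
  have "(\<integral>\<^sup>+y. ennreal (indicator D y * pD t x y) \<partial>lborel) =
    (\<integral>\<^sup>+y. liminf (\<lambda>n. ennreal (indicator D y * killed_mollified x t n y)) \<partial>lborel)"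
  proof (rule nn_integral_cong_AE)
    show "AE y in lborel. ennreal (indicator D y * pD t x y)
        = liminf (\<lambda>n. ennreal (indicator D y * killed_mollified x t n y))"
      using pD_AE[OF t x]
    proof eventually_elim
      case (elim y)
      show ?case
      proof (cases "y \<in> D")
        case True
        have "(\<lambda>n. ennreal (killed_mollified x t n y)) \<longlonglongrightarrow> ennreal (killed_density M X p D t x y)"
          by (intro tendsto_ennrealI killed_mollified_tendsto t x True)
        from lim_imp_Liminf[OF _ this] show ?thesis using True elim by simp
      qed (simp add: Liminf_const)
    qed
  qed
  also have "\<dots> \<le> liminf (\<lambda>n. (\<integral>\<^sup>+y. ennreal (indicator D y * killed_mollified x t n y) \<partial>lborel))"
    by (rule nn_integral_liminf) measurable
  also have "\<dots> \<le> liminf (\<lambda>n::nat. ennreal (prob (alive x t)))"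
  proof (rule Liminf_mono, intro always_eventually allI)
    fix n
    have "(\<integral>\<^sup>+y. ennreal (indicator D y * killed_mollified x t n y) \<partial>lborel) \<le>
       (\<integral>\<^sup>+y. (\<integral>\<^sup>+\<omega>. ennreal (indicator (alive x t) \<omega> * bump_kernel n (x + X t \<omega> - y)) \<partial>M) \<partial>lborel)"
    proof (intro nn_integral_mono)
      fix y
      have "ennreal (indicator D y * killed_mollified x t n y) \<le> ennreal (killed_mollified x t n y)"
        using killed_mollified_bounds(1)[OF t B, of x n y]
            by (intro ennreal_leI) (auto simp: indicator_def)
      also have "\<dots> = (\<integral>\<^sup>+\<omega>. ennreal (indicator (alive x t) \<omega> * bump_kernel n (x + X t \<omega> - y)) \<partial>M)"
        unfolding killed_mollified_def
      proof (intro nn_integral_eq_integral[symmetric]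
          integrable_bounded[of _ "1 / integral\<^sup>L lborel (tent n :: 'a \<Rightarrow> real)"])
        show "\<bar>indicator (alive x t) \<omega> * bump_kernel n (x + X t \<omega> - y)\<bar>
            \<le> 1 / integral\<^sup>L lborel (tent n :: 'a \<Rightarrow> real)" for \<omega>
          using bump_kernel_bound[of n "x + X t \<omega> - y"]
              less_imp_le[OF integral_tent_pos[where 'a='a, of n]] by (auto simp: indicator_def)
      qed (auto simp: bump_kernel_nonneg)
      finally show "ennreal (indicator D y * killed_mollified x t n y)
          \<le> (\<integral>\<^sup>+\<omega>. ennreal (indicator (alive x t) \<omega> * bump_kernel n (x + X t \<omega> - y)) \<partial>M)" .
    qed
    also have "\<dots> = (\<integral>\<^sup>+\<omega>. (\<integral>\<^sup>+y. ennreal (indicator (alive x t) \<omega> * bump_kernel n (x + X t \<omega> - y))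
        \<partial>lborel) \<partial>M)"
      by (rule L.Fubini'[symmetric]) measurable
    also have "\<dots> = (\<integral>\<^sup>+\<omega>. indicator (alive x t) \<omega> \<partial>M)"
    proof (intro nn_integral_cong)
      fix \<omega>
      have "(\<integral>\<^sup>+y. ennreal (bump_kernel n (x + X t \<omega> - y)) \<partial>lborel) = ennreal 1"
        by (subst nn_integral_eq_integral) (auto simp: integral_bump_kernel bump_kernel_nonneg)
      thus "(\<integral>\<^sup>+y. ennreal (indicator (alive x t) \<omega> * bump_kernel n (x + X t \<omega> - y)) \<partial>lborel)
          = indicator (alive x t) \<omega>"
        by (cases "\<omega> \<in> alive x t") auto
    qed
    also have "\<dots> = ennreal (prob (alive x t))" by (simp add: emeasure_eq_measure)
    finally show "(\<integral>\<^sup>+y. ennreal (indicator D y * killed_mollified x t n y) \<partial>lborel)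
        \<le> ennreal (prob (alive x t))" .
  qed
  also have "\<dots> = ennreal (prob (alive x t))" by (simp add: Liminf_const)
  finally have le: "(\<integral>\<^sup>+y. ennreal (indicator D y * pD t x y) \<partial>lborel)
      \<le> ennreal (prob (alive x t))" .
  have nn: "0 \<le> indicator D y * pD t x y" for y using pD_nonneg[OF t x, of y]
      by (auto simp: indicator_def)
  have "set_lebesgue_integral lborel D (pD t x)
      = enn2real (\<integral>\<^sup>+y. ennreal (indicator D y * pD t x y) \<partial>lborel)"
    unfolding set_lebesgue_integral_def real_scaleR_def
    using measurable_pD[OF t x] nn by (intro integral_eq_nn_integral) auto
  also have "\<dots> \<le> prob (alive x t)" using le by (intro enn2real_leI) auto
  finally show ?thesis .
qed

text \<open>
  Mollifying the law is the same as mollifying \<open>f\<close>, and a continuous function is the limit of its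
  mollifications. Vanishing of \<open>f\<close> outside \<open>D\<close> confines the dominating function to the bounded set
  \<open>D\<close>.
\<close>

lemma alive_expectation_eq:
  assumes t: "t > 0" and x: "x \<in> D"
      and f: "continuous_on UNIV f" "\<And>z. \<bar>f z\<bar> \<le> 1" "\<And>z. z \<notin> D \<Longrightarrow> f z = 0"
  shows "expectation (\<lambda>\<omega>. indicator (alive x t) \<omega> * f (x + X t \<omega>))
      = (LINT y:D|lborel. pD t x y * f y)"
proof -
  note alive_events[OF t, measurable]
  have [measurable]: "X t \<in> borel_measurable M" using t by (intro measurable_X) auto
  have [measurable]: "f \<in> borel_measurable borel" by (rule borel_measurable_continuous_onI[OF f(1)])
  note measurable_killed_mollified[OF t, measurable]
  obtain B where B: "B \<ge> 0" "\<And>z. p t z \<le> B" using p_bounded[OF t] by blast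
  interpret L: pair_sigma_finite lborel M ..
  define avg where "avg n w = integral\<^sup>L lborel (\<lambda>y. f y * bump_kernel n (w - y))" for n w
  have avg_m[measurable]: "avg n \<in> borel_measurable borel" for n unfolding avg_def[abs_def]
      by measurable
  have iD: "integrable lborel (\<lambda>y. C * indicator D y :: real)" for C
    using emeasure_D_finite by (intro integrable_mult_right integrable_real_indicator) auto
  have fubini: "integral\<^sup>L lborel (\<lambda>y. f y * killed_mollified x t n y)
      = expectation (\<lambda>\<omega>. indicator (alive x t) \<omega> * avg n (x + X t \<omega>))" for n
  proof -
    define C where "C = 1 / integral\<^sup>L lborel (tent n :: 'a \<Rightarrow> real)"
    have C: "0 \<le> C" "\<And>v::'a. \<bar>bump_kernel n v\<bar> \<le> C"
      using less_imp_le[OF integral_tent_pos[where 'a='a, of n]] bump_kernel_bound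
          by (auto simp: C_def)
    let ?F = "\<lambda>(y, \<omega>). f y * (indicator (alive x t) \<omega> * bump_kernel n (x + X t \<omega> - y))"
    have int: "integrable (lborel \<Otimes>\<^sub>M M) ?F"
    proof (rule Bochner_Integration.integrable_bound)
      have "integrable (lborel \<Otimes>\<^sub>M M) (\<lambda>(y, \<omega>::'w). (C * indicator D y) * (1::real))"
      proof (rule L.Fubini_integrable)
        show "integrable lborel (\<lambda>y. LINT \<omega>|M. norm
            (case (y, \<omega>) of (y, \<omega>::'w) \<Rightarrow> (C * indicator D y) * (1::real)))"
          using iD[of C] C by (simp add: prob_space)
      qed (auto simp: prob_space)
      thus "integrable (lborel \<Otimes>\<^sub>M M) (\<lambda>(y, \<omega>::'w). (C * indicator D y) * (1::real))" .
      have pt: "\<bar>f y * (indicator (alive x t) \<omega> * bump_kernel n (x + X t \<omega> - y))\<bar>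
          \<le> C * indicator D y" for y \<omega>
      proof (cases "y \<in> D")
        case True
        have "\<bar>f y\<bar> * (\<bar>indicator (alive x t) \<omega>\<bar> * \<bar>bump_kernel n (x + X t \<omega> - y)\<bar>) \<le> 1 * (1 * C)"
          using f(2)[of y] C by (intro mult_mono) (auto simp: indicator_def)
        thus ?thesis using True by (simp add: abs_mult)
      qed (simp add: f(3))
      show "AE z in lborel \<Otimes>\<^sub>M M. norm (?F z)
          \<le> norm ((\<lambda>(y, \<omega>::'w). (C * indicator D y) * (1::real)) z)"
        using pt by (intro AE_I2) (auto simp: split_def intro: order_trans[OF _ abs_ge_self])
    qed measurable
    have "integral\<^sup>L lborel (\<lambda>y. f y * killed_mollified x t n y) = (\<integral>y. (\<integral>\<omega>. ?F (y, \<omega>) \<partial>M) \<partial>lborel)"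
      by (simp add: killed_mollified_def)
    also have "\<dots> = (\<integral>\<omega>. (\<integral>y. ?F (y, \<omega>) \<partial>lborel) \<partial>M)"
      using L.Fubini_integral[of "\<lambda>y \<omega>. ?F (y, \<omega>)"] int by (simp add: split_def)
    also have "\<dots> = expectation (\<lambda>\<omega>. indicator (alive x t) \<omega> * avg n (x + X t \<omega>))"
    proof (intro Bochner_Integration.integral_cong refl)
      fix \<omega>
      have "(\<integral>y. ?F (y, \<omega>) \<partial>lborel)
          = (\<integral>y. indicator (alive x t) \<omega> * (f y * bump_kernel n (x + X t \<omega> - y)) \<partial>lborel)"
        by (simp add: mult_ac)
      thus "(\<integral>y. ?F (y, \<omega>) \<partial>lborel) = indicator (alive x t) \<omega> * avg n (x + X t \<omega>)"
        by (simp only: avg_def integral_mult_right_zero)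
    qed
    finally show ?thesis .
  qed
  have rhs: "(\<lambda>n. expectation (\<lambda>\<omega>. indicator (alive x t) \<omega> * avg n (x + X t \<omega>)))
      \<longlonglongrightarrow> expectation (\<lambda>\<omega>. indicator (alive x t) \<omega> * f (x + X t \<omega>))"
  proof (rule integral_dominated_convergence[where w="\<lambda>_. 1"])
    show "AE \<omega> in M. (\<lambda>n. indicat_real (alive x t) \<omega> * avg n (x + X t \<omega>))
        \<longlonglongrightarrow> indicator (alive x t) \<omega> * f (x + X t \<omega>)"
      unfolding avg_def by (intro AE_I2 tendsto_intros bump_kernel_approximation f)
    show "AE \<omega> in M. norm (indicat_real (alive x t) \<omega> * avg n (x + X t \<omega>)) \<le> 1" for n
    proof (intro AE_I2)
      fix \<omega>
      have "\<bar>avg n (x + X t \<omega>)\<bar> \<le> 1" unfolding avg_def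
          by (rule bump_kernel_average(2)) (use f(2) in auto)
      thus "norm (indicat_real (alive x t) \<omega> * avg n (x + X t \<omega>)) \<le> 1" by (simp add: indicator_def)
    qed
  qed auto
  have lhs: "(\<lambda>n. integral\<^sup>L lborel (\<lambda>y. f y * killed_mollified x t n y))
      \<longlonglongrightarrow> integral\<^sup>L lborel (\<lambda>y. f y * (indicator D y * pD t x y))"
  proof (rule integral_dominated_convergence[where w="\<lambda>y. B * indicator D y"])
    show "AE y in lborel. (\<lambda>n. f y * killed_mollified x t n y) \<longlonglongrightarrow> f y * (indicator D y * pD t x y)"
      using pD_AE[OF t x]
    proof eventually_elim
      case (elim y)
      show ?case
      proof (cases "y \<in> D")
        case True
        thus ?thesis using elim killed_mollified_tendsto[OF t x True]
            by (auto intro!: tendsto_intros)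
      qed (simp add: f(3))
    qed
    show "AE y in lborel. norm (f y * killed_mollified x t n y) \<le> B * indicator D y" for n
    proof (intro AE_I2)
      fix y
      show "norm (f y * killed_mollified x t n y) \<le> B * indicator D y"
      proof (cases "y \<in> D")
        case True
        have "\<bar>f y\<bar> * \<bar>killed_mollified x t n y\<bar> \<le> 1 * B"
          using f(2)[of y] killed_mollified_bounds[OF t B, of x n y] by (intro mult_mono) auto
        thus ?thesis using True by (simp add: abs_mult)
      qed (simp add: f(3))
    qed
    show "(\<lambda>y. f y * (indicator D y * pD t x y)) \<in> borel_measurable lborel"
        using measurable_pD[OF t x] by simp
  qed (use iD in auto)
  from LIMSEQ_unique[OF lhs[unfolded fubini] rhs] show ?thesis
    by (simp add: set_lebesgue_integral_def mult_ac)
qed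

end

section \<open>Dynkin inequality for a bump\<close>

context levy_density_in_domain
begin

text \<open>
  Up to the first grid point after the contact time, the increments of \<open>\<psi> (x + X u)\<close> over the steps of
  a grid of width \<open>h\<close> telescope. By the Markov property each has the conditional expectation
  \<open>semigroup h \<psi> - \<psi>\<close> at the present position, which \<open>gen\<close> bounds from below. On survival up to \<open>t\<close>
  the position at every earlier grid point is in \<open>D\<close>, so the terms with \<open>c\<close> add up to at least \<open>c * t\<close>
  times the survival probability. As the grid is refined, the terminal value of \<open>\<psi>\<close> is taken at the
  contact time, where \<open>\<psi>\<close> vanishes, or at \<open>t\<close>.
\<close>

lemma dynkin_inequality:
  assumes t: "t > 0" and x: "x \<in> D"
    and \<psi>: "continuous_on UNIV \<psi>" "\<And>z. 0 \<le> \<psi> z" "\<And>z. \<psi> z \<le> 1" "\<And>z. z \<notin> D \<Longrightarrow> \<psi> z = 0"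
    and K: "K \<in> sets borel" "\<And>z. z \<notin> K \<Longrightarrow> \<psi> z = 0"
    and c: "0 < c" "0 \<le> C" and h0: "h0 > 0"
    and gen: "\<And>h z. 0 < h \<Longrightarrow> h < h0 \<Longrightarrow> h * (c * indicator D z - C * indicator K z) \<le> semigroup h \<psi> z
        - \<psi> z"
    and Q: "indicator K x \<le> Q" "\<And>u. 0 < u \<Longrightarrow> u \<le> t \<Longrightarrow> prob {\<omega> \<in> alive x u. x + X u \<omega> \<in> K} \<le> Q"
  shows "c * t * prob (alive x t) \<le> (1 + C * t) * Q"
proof -
  let ?T = "contact_time x"
  define f where "f z = \<psi> (x + z)" for z
  have fc: "continuous_on UNIV f"
    unfolding f_def by (intro continuous_on_compose2[OF \<psi>(1)] continuous_intros) auto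
  have fb: "\<bar>f z\<bar> \<le> 1" for z using \<psi>(2,3) by (simp add: f_def)
  have fm[measurable]: "f \<in> borel_measurable borel" by (rule borel_measurable_continuous_onI[OF fc])
  have [measurable]: "D \<in> sets borel" "K \<in> sets borel" using open_D K by auto
  have sf: "semigroup h f z = semigroup h \<psi> (x + z)" for h z
    by (simp add: semigroup_def f_def add.assoc)
  have T: "optional_time t ?T" by (rule optional_contact_time)
  note alive_events[OF t, measurable]
  have [measurable]: "X t \<in> borel_measurable M" using t by (intro measurable_X) auto
  define u where "u N j = t * real j / real N" for N j :: nat
  define Y where "Y n \<omega> = f (X (u (Suc n) (grid_index t (Suc n) (?T \<omega>))) \<omega>)" for n \<omega>
  define Y' where "Y' \<omega> = f (X (capped t (?T \<omega>)) \<omega>)" for \<omega>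
  have Ym[measurable]: "Y n \<in> borel_measurable M" for n
    using measurable_compose[OF measurable_X_grid[OF T t, of "Suc n"] fm]
        by (simp add: Y_def[abs_def] u_def)
  have Ylim: "(\<lambda>n. Y n \<omega>) \<longlonglongrightarrow> Y' \<omega>" for \<omega>
    unfolding Y_def Y'_def u_def
    by (intro continuous_on_tendsto_compose[OF fc] X_grid_tendsto contact_time_nonneg t) auto
  have Y'm[measurable]: "Y' \<in> borel_measurable M"
      by (rule borel_measurable_LIMSEQ_metric[OF Ym Ylim])
  have lim: "(\<lambda>n. expectation (Y n)) \<longlonglongrightarrow> expectation Y'"
    by (rule integral_dominated_convergence[where w="\<lambda>_. 1"]) (use Ylim fb in \<open>auto simp: Y_def\<close>)
  have upper: "expectation Y' \<le> Q"
  proof -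
    let ?E = "{\<omega> \<in> alive x t. x + X t \<omega> \<in> K}"
    have E[measurable]: "?E \<in> events"
    proof -
      have "?E = alive x t \<inter> {\<omega> \<in> space M. x + X t \<omega> \<in> K}" by (auto simp: alive_def)
      thus ?thesis by simp
    qed
    have "expectation Y' \<le> expectation (\<lambda>\<omega>. indicator ?E \<omega>)"
    proof (rule integral_mono_AE)
      show "integrable M Y'" by (rule integrable_bounded[of _ 1]) (use fb in \<open>auto simp: Y'_def\<close>)
      show "AE \<omega> in M. Y' \<omega> \<le> indicator ?E \<omega>"
        using AE_contact_outside[of x] AE_space
      proof eventually_elim
        case (elim \<omega>)
        show ?case
        proof (cases "?T \<omega> < ereal t")
          case True
          note c = capped_less[OF contact_time_nonneg True]
          have "?T \<omega> < \<infinity>" using True by (rule less_trans) simp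
          hence "x + X (capped t (?T \<omega>)) \<omega> \<notin> D" using elim(1) c by (metis real_of_ereal.simps(1))
          thus ?thesis using \<psi>(4) by (simp add: Y'_def f_def)
        next
          case False
          have "\<psi> (x + X t \<omega>) \<le> indicator K (x + X t \<omega>)" using \<psi>(3) K(2)
              by (auto simp: indicator_def)
          thus ?thesis using False elim(2)
              by (auto simp: Y'_def f_def capped_not_less[OF False] alive_def indicator_def
              not_less)
        qed
      qed
    qed (simp add: emeasure_eq_measure)
    also have "\<dots> \<le> Q" using Q(2)[OF t] by simp
    finally show ?thesis .
  qed
  have lower: "t * (c * prob (alive x t) - C * Q) \<le> expectation (Y n)"
      if n: "t / real (Suc n) < h0" for n
  proof -
    define N where "N = Suc n"
    have N: "N > 0" by (simp add: N_def)
    define h where "h = t / real N"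
    have h: "0 < h" "h < h0" using n t by (auto simp: h_def N_def)
    have ustep: "u N (Suc j) - u N j = h" for j
        by (simp add: u_def h_def diff_divide_distrib[symmetric] algebra_simps)
    have u0: "0 \<le> u N j" for j using t by (simp add: u_def)
    have ut: "u N j < t" if "j < N" for j using that t by (simp add: u_def pos_divide_less_eq)
    \<comment> \<open>Step \<open>j\<close> is taken on the event that there is no contact before \<open>u N j\<close>; it is known at that
      time.\<close>
    define E where "E j = {\<omega> \<in> space M. \<not> ?T \<omega> < ereal (u N j)}" for j
    have Ep: "E j \<in> sets (past (u N j))" if "j < N" for j
    proof (cases "j = 0")
      case True
      have "\<not> ?T \<omega> < 0" for \<omega> using contact_time_nonneg[of x \<omega>] by (simp add: not_less)
      hence "E j = space (past (u N j))" using True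
          by (auto simp: E_def u_def zero_ereal_def[symmetric])
      thus ?thesis by (simp only: sets.top)
    next
      case False
      have "0 < u N j" using False t N by (simp add: u_def)
      moreover have "u N j \<le> t" using ut[OF that] by simp
      ultimately have "{\<omega> \<in> space M. ?T \<omega> < ereal (u N j)} \<in> sets (past (u N j))"
        using T by (auto simp: optional_time_def)
      moreover have "E j = space (past (u N j)) - {\<omega> \<in> space M. ?T \<omega> < ereal (u N j)}"
          by (auto simp: E_def)
      ultimately show ?thesis by (simp only: sets.Diff sets.top)
    qed
    have Em: "E j \<in> events" if "j < N" for j using Ep[OF that] sets_past_subset by blast
    have Xm: "X (u N j) \<in> borel_measurable M" for j by (rule measurable_X[OF u0])
    have fX_int: "integrable M (\<lambda>\<omega>. indicator (E j) \<omega> * f (X (u N i) \<omega>))" if "j < N" for i j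
    proof (rule integrable_bounded[of _ 1])
      show "(\<lambda>\<omega>. indicat_real (E j) \<omega> * f (X (u N i) \<omega>)) \<in> borel_measurable M"
        by (intro borel_measurable_times borel_measurable_indicator Em that
            measurable_compose[OF Xm fm])
    qed (use fb in \<open>auto simp: indicator_def\<close>)
    have step: "h * (c * prob (alive x t) - C * Q)
        \<le> expectation (\<lambda>\<omega>. indicator (E j) \<omega> * (f (X (u N (Suc j)) \<omega>) - f (X (u N j) \<omega>)))"
      if j: "j < N" for j
    proof -
      have sm: "semigroup h f \<in> borel_measurable borel" using h
          by (intro measurable_semigroup fm) auto
      have sb: "\<bar>semigroup h f z\<bar> \<le> 1" for z using h by (intro semigroup_bound fm fb) auto
      have sX_int: "integrable M (\<lambda>\<omega>. indicator (E j) \<omega> * semigroup h f (X (u N j) \<omega>))"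
      proof (rule integrable_bounded[of _ 1])
        show "(\<lambda>\<omega>. indicat_real (E j) \<omega> * semigroup h f (X (u N j) \<omega>)) \<in> borel_measurable M"
          by (intro borel_measurable_times borel_measurable_indicator Em j
              measurable_compose[OF Xm sm])
      qed (use sb in \<open>auto simp: indicator_def\<close>)
      let ?B = "{\<omega> \<in> space M. x + X (u N j) \<omega> \<in> K} \<inter> E j"
      have Bm: "?B \<in> events" using measurable_sets_Collect Em[OF j] Xm[of j] K(1)
          by (intro sets.Int) auto
      have PB: "prob ?B \<le> Q"
      proof (cases "j = 0")
        case True
        have "?B = (if x \<in> K then E j else {})" using True by (auto simp: u_def X_zero E_def)
        thus ?thesis using Q(1) by (cases "x \<in> K") (auto intro: order_trans[OF prob_le_1])
      next
        case False
        have "0 < u N j" using False t N by (simp add: u_def)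
        moreover have "?B = {\<omega> \<in> alive x (u N j). x + X (u N j) \<omega> \<in> K}"
            by (auto simp: alive_def E_def not_less)
        ultimately show ?thesis using Q(2)[of "u N j"] ut[OF j] by simp
      qed
      have "h * (c * prob (alive x t) - C * Q) \<le> h * (c * prob (alive x t) - C * prob ?B)"
        using PB h c by (intro mult_left_mono diff_left_mono) auto
      also have "\<dots> = expectation (\<lambda>\<omega>. h * (c * indicator (alive x t) \<omega> - C * indicator ?B \<omega>))"
        using Bm by (subst integral_mult_right_zero, subst Bochner_Integration.integral_diff)
          (auto simp: emeasure_eq_measure)
      also have "\<dots> \<le> expectation
          (\<lambda>\<omega>. indicator (E j) \<omega> * semigroup h f (X (u N j) \<omega>) - indicator (E j) \<omega> * f
          (X (u N j) \<omega>))"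
      proof (rule integral_mono)
        show "integrable M (\<lambda>\<omega>. h * (c * indicator (alive x t) \<omega> - C * indicator ?B \<omega>))"
          using Bm by (intro integrable_mult_right Bochner_Integration.integrable_diff)
              (auto simp: emeasure_eq_measure)
        show "integrable M (\<lambda>\<omega>. indicator (E j) \<omega> * semigroup h f (X (u N j) \<omega>)
            - indicator (E j) \<omega> * f (X (u N j) \<omega>))"
          by (intro Bochner_Integration.integrable_diff sX_int fX_int j)
        fix \<omega> assume \<omega>: "\<omega> \<in> space M"
        show "h * (c * indicator (alive x t) \<omega> - C * indicator ?B \<omega>)
            \<le> indicator (E j) \<omega> * semigroup h f (X (u N j) \<omega>) - indicator (E j) \<omega> * f (X (u N j) \<omega>)"
        proof (cases "\<omega> \<in> E j")
          case True
          have "indicator (alive x t) \<omega> \<le> (indicator D (x + X (u N j) \<omega>) :: real)"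
          proof (cases "\<omega> \<in> alive x t")
            case True
            have "ereal (u N j) < ereal t" using ut[OF j] by simp
            also have "\<dots> \<le> ?T \<omega>" using True by (simp add: alive_def)
            finally have "x + X (u N j) \<omega> \<in> D" by (rule in_D_before_contact[OF u0])
            thus ?thesis by simp
          qed simp
          moreover have "indicator ?B \<omega> = (indicator K (x + X (u N j) \<omega>) :: real)" using True \<omega>
              by (auto simp: indicator_def)
          ultimately have "h * (c * indicator (alive x t) \<omega> - C * indicator ?B \<omega>)
              \<le> h * (c * indicator D (x + X (u N j) \<omega>) - C * indicator K (x + X (u N j) \<omega>))"
            using h c by (intro mult_left_mono diff_right_mono) auto
          also have "\<dots> \<le> semigroup h f (X (u N j) \<omega>) - f (X (u N j) \<omega>)"
            using gen[OF h, of "x + X (u N j) \<omega>"] by (simp add: sf f_def)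
          finally show ?thesis using True by simp
        next
          case False
          have "\<omega> \<notin> alive x t"
          proof
            assume "\<omega> \<in> alive x t"
            hence "ereal t \<le> ?T \<omega>" by (simp add: alive_def)
            moreover have "?T \<omega> < ereal (u N j)" using False \<omega> by (simp add: E_def)
            ultimately have "ereal t < ereal (u N j)" by (rule le_less_trans)
            thus False using ut[OF j] by simp
          qed
          thus ?thesis using False by simp
        qed
      qed
      also have "\<dots> = expectation (\<lambda>\<omega>. indicator (E j) \<omega> * semigroup h f (X (u N j) \<omega>))
          - expectation (\<lambda>\<omega>. indicator (E j) \<omega> * f (X (u N j) \<omega>))"
        by (intro Bochner_Integration.integral_diff sX_int fX_int j)
      also have "expectation (\<lambda>\<omega>. indicator (E j) \<omega> * semigroup h f (X (u N j) \<omega>))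
          = expectation (\<lambda>\<omega>. indicator (E j) \<omega> * f (X (u N (Suc j)) \<omega>))"
      proof -
        have "u N j \<le> u N (Suc j)" using ustep[of j] h by linarith
        from markov_property[OF u0 this _ _ fm fb, of "\<lambda>\<omega>. indicator (E j) \<omega>" 1] Ep[OF j]
        show ?thesis unfolding ustep by simp
      qed
      also have "\<dots> - expectation (\<lambda>\<omega>. indicator (E j) \<omega> * f (X (u N j) \<omega>))
          = expectation (\<lambda>\<omega>. indicator (E j) \<omega> * (f (X (u N (Suc j)) \<omega>) - f (X (u N j) \<omega>)))"
        unfolding right_diff_distrib
        by (rule Bochner_Integration.integral_diff[symmetric]) (intro fX_int j)+
      finally show ?thesis .
    qed
    have "t * (c * prob (alive x t) - C * Q) = (\<Sum>j<N. h * (c * prob (alive x t) - C * Q))"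
      using N by (simp add: h_def)
    also have "\<dots> \<le> (\<Sum>j<N. expectation
        (\<lambda>\<omega>. indicator (E j) \<omega> * (f (X (u N (Suc j)) \<omega>) - f (X (u N j) \<omega>))))"
      by (intro sum_mono step) auto
    also have "\<dots> = expectation
        (\<lambda>\<omega>. \<Sum>j<N. indicator (E j) \<omega> * (f (X (u N (Suc j)) \<omega>) - f (X (u N j) \<omega>)))"
      by (rule Bochner_Integration.integral_sum[symmetric])
         (auto simp: right_diff_distrib intro!: Bochner_Integration.integrable_diff fX_int)
    also have "\<dots> \<le> expectation (Y n)"
    proof (rule integral_mono)
      show "integrable M (\<lambda>\<omega>. \<Sum>j<N. indicator (E j) \<omega> * (f (X (u N (Suc j)) \<omega>) - f (X (u N j) \<omega>)))"
        by (rule Bochner_Integration.integrable_sum)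
           (auto simp: right_diff_distrib intro!: Bochner_Integration.integrable_diff fX_int)
      show "integrable M (Y n)" by (rule integrable_bounded[of _ 1]) (use fb in \<open>auto simp: Y_def\<close>)
      fix \<omega> assume \<omega>: "\<omega> \<in> space M"
      let ?J = "grid_index t N (?T \<omega>)"
      let ?d = "\<lambda>j. f (X (u N (Suc j)) \<omega>) - f (X (u N j) \<omega>)"
      have "(\<Sum>j<N. indicator (E j) \<omega> * ?d j) = (\<Sum>j<?J. ?d j)"
      proof -
        have ind: "indicator (E j) \<omega> = (if j < ?J then 1 else 0 :: real)" if "j < N" for j
          using grid_index_le_iff[OF t that, of "?T \<omega>"] \<omega> by (auto simp: E_def u_def not_le)
        have "(\<Sum>j<N. indicator (E j) \<omega> * ?d j) = (\<Sum>j<N. if j < ?J then ?d j else 0)"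
          by (intro sum.cong refl) (auto simp: ind)
        also have "\<dots> = (\<Sum>j\<in>{..<N} \<inter> {j. j < ?J}. ?d j)" by (simp add: sum.inter_restrict)
        also have "{..<N} \<inter> {j. j < ?J} = {..<?J}" using grid_index_le[of t N "?T \<omega>"] by auto
        finally show ?thesis .
      qed
      also have "\<dots> = f (X (u N ?J) \<omega>) - f (X (u N 0) \<omega>)" by (rule sum_lessThan_telescope)
      also have "\<dots> \<le> Y n \<omega>" using \<psi>(2) by (simp add: Y_def N_def f_def)
      finally show "(\<Sum>j<N. indicator (E j) \<omega> * ?d j) \<le> Y n \<omega>" .
    qed
    finally show ?thesis .
  qed
  have "t * (c * prob (alive x t) - C * Q) \<le> expectation Y'"
  proof (rule LIMSEQ_le_const[OF lim])
    have "(\<lambda>n. t * inverse (real (Suc n))) \<longlonglongrightarrow> t * 0"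
        by (intro tendsto_intros LIMSEQ_inverse_real_of_nat)
    hence "\<forall>\<^sub>F n in sequentially. t / real (Suc n) < h0"
      using order_tendstoD(2)[of "\<lambda>n. t / real (Suc n)" 0 sequentially h0] h0
          by (simp add: divide_inverse)
    then obtain N where "\<And>n. n \<ge> N \<Longrightarrow> t / real (Suc n) < h0" by (auto simp: eventually_sequentially)
    thus "\<exists>N. \<forall>n\<ge>N. t * (c * prob (alive x t) - C * Q) \<le> expectation (Y n)" using lower by blast
  qed
  thus ?thesis using upper by (simp add: algebra_simps)
qed

end

section \<open>Jumps from the boundary layer of a Lipschitz domain\<close>

text \<open>
  The cone condition on \<open>\<nu>\<close> speaks of vertices at the exact distance \<open>\<rho>\<close>. From a point \<open>y\<close> of \<open>D\<close> close
  to the boundary, take a boundary point \<open>Q\<close> nearby and its interior cone with axis \<open>e\<close>, and move the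
  vertex from \<open>Q\<close> along the axis until its distance from \<open>y\<close> is \<open>\<rho>\<close>. The moved cone lies in the interior
  cone, and since it has been moved by at least \<open>\<rho> / 2\<close>, it keeps a fixed distance from the complement
  of \<open>D\<close>.
\<close>

lemma lipschitz_jump_target:
  fixes D :: "'a::euclidean_space set"
  assumes D: "lipschitz_domain D"
    and nu: "\<And>r \<gamma>. \<lbrakk>r > 0; 0 < \<gamma>; \<gamma> < pi\<rbrakk> \<Longrightarrow>
           \<exists>\<rho>>0. (INF (y, e)\<in>sphere 0 \<rho> \<times> sphere 0 1. emeasure \<nu> (circular_cone \<gamma> y e \<inter> ball 0 r))
               > 0"
    and sets_nu: "sets \<nu> = sets borel"
  obtains \<epsilon> \<rho> c where "0 < \<epsilon>" "0 < \<rho>" "0 < c"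
    "\<And>y. y \<in> D \<Longrightarrow> infdist y (- D) < \<rho> \<Longrightarrow> ennreal c < emeasure \<nu> {z. \<epsilon> < infdist (y + z) (- D)}"
proof -
  obtain g R where gR: "g > 0" "R > 0"
    and cone: "\<And>Q. Q \<in> frontier D \<Longrightarrow> \<exists>e. norm e = 1 \<and> lipschitz_cone g Q e \<inter> ball Q R \<subseteq> D"
    and openD: "open D" and bD: "bounded D"
    using D unfolding lipschitz_domain_def by blast
  define F where "F = - D"
  have "D \<noteq> UNIV" using bD not_bounded_UNIV[where 'a='a] by auto
  hence F: "closed F" "F \<noteq> {}" unfolding F_def using openD by auto
  \<comment> \<open>The opening angle at which a circular cone has the slope of the interior cones.\<close>
  define \<gamma> where "\<gamma> = 2 * arctan (1 / g)"
  have \<gamma>: "0 < \<gamma>" "\<gamma> < pi" using gR arctan_ubound[of "1 / g"] by (auto simp: \<gamma>_def)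
  define \<kappa> where "\<kappa> = cos (\<gamma> / 2)"
  have \<kappa>: "\<kappa> = 1 / sqrt (1 + (1 / g)\<^sup>2)" by (simp add: \<kappa>_def \<gamma>_def cos_arctan)
  have \<kappa>0: "\<kappa> > 0" unfolding \<kappa> by (simp add: add_pos_nonneg)
  have \<kappa>2: "\<kappa>\<^sup>2 * (g\<^sup>2 + 1) = g\<^sup>2"
  proof -
    have pos: "0 < 1 + (1 / g)\<^sup>2" by (simp add: add_pos_nonneg)
    hence "\<kappa>\<^sup>2 * (1 + (1 / g)\<^sup>2) = 1" unfolding \<kappa> by (simp add: power_divide)
    moreover have "g\<^sup>2 + 1 = (1 + (1 / g)\<^sup>2) * g\<^sup>2" using gR
        by (simp add: power_divide distrib_right)
    ultimately show ?thesis by (simp only: mult.assoc[symmetric] mult_1)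
  qed
  \<comment> \<open>A third of the localisation radius each for the distance to \<open>Q\<close>, for the jump, and for the
    safety margin.\<close>
  define r where "r = R / 3"
  have r: "r > 0" using gR by (simp add: r_def)
  obtain \<rho> where \<rho>: "\<rho> > 0" and INF:
      "(INF (y, e)\<in>sphere 0 \<rho> \<times> sphere 0 1. emeasure \<nu> (circular_cone \<gamma> y e \<inter> ball 0 r)) > 0"
    using nu[OF r \<gamma>] by blast
  obtain c where c: "0 < c" "ennreal c
      < (INF (y, e)\<in>sphere 0 \<rho> \<times> sphere 0 1. emeasure \<nu> (circular_cone \<gamma> y e \<inter> ball 0 r))"
  proof -
    obtain c' where c': "0 < c'"
        "c' < (INF (y, e)\<in>sphere 0 \<rho> \<times> sphere 0 1. emeasure \<nu> (circular_cone \<gamma> y e \<inter> ball 0 r))"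
      using dense[OF INF] by blast
    show thesis
    proof (rule that[of "enn2real c'"])
      have "c' < top" using c'(2) by (rule less_le_trans) simp
      thus "0 < enn2real c'" "ennreal (enn2real c')
          < (INF (y, e)\<in>sphere 0 \<rho> \<times> sphere 0 1. emeasure \<nu> (circular_cone \<gamma> y e \<inter> ball 0 r))"
        using c' by (auto simp: enn2real_positive_iff)
    qed
  qed
  have ball_cone: "ennreal c < emeasure \<nu> (circular_cone \<gamma> y e \<inter> ball 0 r)"
      if "norm y = \<rho>" "norm e = 1" for y e
    using c(2) that by (rule_tac less_le_trans[OF c(2)], intro INF_lower2[of "(y, e)"]) auto
  have \<rho>r: "\<rho> < r"
  proof -
    \<comment> \<open>A cone that points straight away from the origin only meets the ball of radius \<open>r\<close> if its
      vertex is in that ball.\<close>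
    obtain b :: 'a where b: "b \<in> Basis" by fastforce
    have "circular_cone \<gamma> (\<rho> *\<^sub>R b) b \<inter> ball 0 r \<noteq> {}"
      using ball_cone[of "\<rho> *\<^sub>R b" b] b \<rho> by auto
    then obtain z where z: "norm (z - \<rho> *\<^sub>R b) * \<kappa> < (z - \<rho> *\<^sub>R b) \<bullet> b" "norm z < r"
        by (auto simp: circular_cone_def \<kappa>_def)
    have "0 \<le> norm (z - \<rho> *\<^sub>R b) * \<kappa>" using \<kappa>0 by simp
    hence "\<rho> < z \<bullet> b" using z b by (simp add: inner_diff_left)
    also have "\<dots> \<le> norm z" using Basis_le_norm[OF b, of z] by simp
    finally show ?thesis using z by simp
  qed
  \<comment> \<open>A perturbation by \<open>\<epsilon>'\<close> can lower the axial coordinate by \<open>\<epsilon>'\<close> and raise \<open>g\<close> times the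
    transversal one by \<open>g * \<epsilon>'\<close>; the shift by more than \<open>\<rho> / 2\<close> pays for both.\<close>
  define \<epsilon>' where "\<epsilon>' = \<rho> / (4 * (1 + g))"
  have \<epsilon>': "0 < \<epsilon>'" "\<epsilon>' * (1 + g) < \<rho> / 2" "\<epsilon>' < \<rho> / 2"
    using \<rho> gR by (auto simp: \<epsilon>'_def field_simps add_pos_pos)
  have main: "ennreal c < emeasure \<nu> {z. \<epsilon>' / 2 < infdist (y + z) F}"
      if y: "y \<in> D" "infdist y F < \<rho> / 2" for y
  proof -
    obtain Q0 where Q0: "Q0 \<in> F" "infdist y F = dist y Q0" using infdist_attains_inf[OF F] by blast
    \<comment> \<open>The segment from \<open>y\<close> to a nearest point of the complement crosses the boundary.\<close>
    have "closed_segment y Q0 \<inter> frontier D \<noteq> {}"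
      using y Q0 by (intro connected_Int_frontier) (auto simp: F_def)
    then obtain Q where Q: "Q \<in> closed_segment y Q0" "Q \<in> frontier D" by blast
    have yQ: "dist y Q < \<rho> / 2"
      using dist_in_closed_segment(1)[OF Q(1)] y Q0 by (simp add: dist_commute)
    obtain e where e: "norm e = 1" "lipschitz_cone g Q e \<inter> ball Q R \<subseteq> D" using cone[OF Q(2)]
        by blast
    have "\<exists>s\<ge>0. s \<le> 2 * \<rho> \<and> norm (Q + s *\<^sub>R e - y) = \<rho>"
    proof (rule IVT')
      show "norm (Q + 0 *\<^sub>R e - y) \<le> \<rho>" using yQ \<rho> by (simp add: dist_norm norm_minus_commute)
      have "2 * \<rho> = norm ((Q + (2 * \<rho>) *\<^sub>R e - y) - (Q - y))" using e \<rho> by simp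
      also have "\<dots> \<le> norm (Q + (2 * \<rho>) *\<^sub>R e - y) + norm (Q - y)" by (rule norm_triangle_ineq4)
      finally show "\<rho> \<le> norm (Q + (2 * \<rho>) *\<^sub>R e - y)" using yQ \<rho>
          by (simp add: dist_norm norm_minus_commute)
      show "continuous_on {0..2 * \<rho>} (\<lambda>s. norm (Q + s *\<^sub>R e - y))" by (intro continuous_intros)
    qed (use \<rho> in auto)
    then obtain s where s: "0 \<le> s" "norm (Q + s *\<^sub>R e - y) = \<rho>" by blast
    have s2: "\<rho> / 2 < s"
    proof -
      have "\<rho> \<le> norm (Q - y) + norm (s *\<^sub>R e)" using norm_triangle_ineq[of "Q - y" "s *\<^sub>R e"] s(2)
          by (simp add: algebra_simps)
      thus ?thesis using yQ e s by (simp add: dist_norm norm_minus_commute)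
    qed
    have "circular_cone \<gamma> (Q + s *\<^sub>R e - y) e \<inter> ball 0 r \<subseteq> {z. \<epsilon>' / 2 < infdist (y + z) F}"
    proof
      fix z assume z: "z \<in> circular_cone \<gamma> (Q + s *\<^sub>R e - y) e \<inter> ball 0 r"
      define v where "v = z - (Q + s *\<^sub>R e - y)"
      define a where "a = v \<bullet> e"
      define w where "w = v - a *\<^sub>R e"
      have ee: "e \<bullet> e = 1" using e by (simp add: norm_eq_1)
      have zc: "norm v * \<kappa> < a" and zr: "norm z < r" using z
          by (auto simp: circular_cone_def v_def a_def \<kappa>_def)
      have "0 \<le> norm v * \<kappa>" using \<kappa>0 by simp
      hence a0: "a > 0" using zc by simp
      have w2: "(norm w)\<^sup>2 = (norm v)\<^sup>2 - a\<^sup>2"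
        unfolding w_def power2_norm_eq_inner
        by (simp add: inner_diff_left inner_diff_right ee a_def[symmetric] inner_commute[of e v]
            power2_eq_square)
      have "(norm v * \<kappa>)\<^sup>2 < a\<^sup>2" using zc \<open>0 \<le> norm v * \<kappa>\<close> by (intro power_strict_mono) auto
      hence "(norm v)\<^sup>2 * (\<kappa>\<^sup>2 * (g\<^sup>2 + 1)) < a\<^sup>2 * (g\<^sup>2 + 1)"
        using gR by (simp add: power_mult_distrib mult.assoc[symmetric] add_nonneg_pos)
      hence "(norm v)\<^sup>2 * g\<^sup>2 < a\<^sup>2 * (g\<^sup>2 + 1)" unfolding \<kappa>2 .
      moreover have "(g * norm w)\<^sup>2 = (norm v)\<^sup>2 * g\<^sup>2 - a\<^sup>2 * g\<^sup>2"
        unfolding power_mult_distrib w2 by (simp add: algebra_simps)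
      ultimately have "(g * norm w)\<^sup>2 < a\<^sup>2" unfolding distrib_left by linarith
      hence gw: "g * norm w < a" using a0 by (simp add: power_less_imp_less_base)
      have inD: "q \<in> D" if q: "dist (y + z) q < \<epsilon>'" for q
      proof -
        define d where "d = q - (y + z)"
        have d: "norm d < \<epsilon>'" using q by (simp add: d_def dist_norm norm_minus_commute)
        have de: "\<bar>d \<bullet> e\<bar> \<le> norm d" using Cauchy_Schwarz_ineq2[of d e] e by simp
        have qQ: "q - Q = s *\<^sub>R e + v + d" by (simp add: d_def v_def algebra_simps)
        have ax: "(q - Q) \<bullet> e = s + a + d \<bullet> e" unfolding qQ by (simp add: inner_add_left ee a_def)
        have perp: "(q - Q) - ((q - Q) \<bullet> e) *\<^sub>R e = w + (d - (d \<bullet> e) *\<^sub>R e)"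
          unfolding ax unfolding qQ w_def by (simp add: algebra_simps)
        have "(norm (d - (d \<bullet> e) *\<^sub>R e))\<^sup>2 = (norm d)\<^sup>2 - (d \<bullet> e)\<^sup>2"
          unfolding power2_norm_eq_inner
          by (simp add: inner_diff_left inner_diff_right ee inner_commute[of e d] power2_eq_square)
        hence "(norm (d - (d \<bullet> e) *\<^sub>R e))\<^sup>2 \<le> (norm d)\<^sup>2" by simp
        hence dperp: "norm (d - (d \<bullet> e) *\<^sub>R e) \<le> norm d" by (rule power2_le_imp_le) simp
        have "g * norm (w + (d - (d \<bullet> e) *\<^sub>R e)) \<le> g * (norm w + norm d)"
          using gR dperp norm_triangle_ineq[of w "d - (d \<bullet> e) *\<^sub>R e"] by (intro mult_left_mono) auto
        also have "\<dots> = g * norm w + g * norm d" by (simp add: distrib_left)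
        also have "\<dots> < a + g * \<epsilon>'" using gw d gR
            by (intro add_strict_mono mult_strict_left_mono) auto
        also have "\<dots> < s + a - \<epsilon>'" using \<epsilon>'(2) s2 by (simp add: algebra_simps)
        also have "\<dots> < (q - Q) \<bullet> e" unfolding ax using de d by linarith
        finally have 1: "g * norm ((q - Q) - ((q - Q) \<bullet> e) *\<^sub>R e) < (q - Q) \<bullet> e" unfolding perp .
        have "0 \<le> g * norm ((q - Q) - ((q - Q) \<bullet> e) *\<^sub>R e)" using gR by simp
        hence 2: "0 < (q - Q) \<bullet> e" using 1 by linarith
        have "dist Q q \<le> dist Q y + dist y (y + z) + dist (y + z) q"
          using dist_triangle[of Q q y] dist_triangle[of y q "y + z"] by linarith
        also have "\<dots> < \<rho> / 2 + r + \<epsilon>'" using yQ zr q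
            by (simp add: dist_commute[of Q y]) (simp add: dist_norm)
        also have "\<dots> < R" using \<rho>r \<epsilon>'(3) r unfolding r_def by linarith
        finally have 3: "q \<in> ball Q R" by simp
        show "q \<in> D" using e(2) 1 2 3 by (auto simp: lipschitz_cone_def)
      qed
      have "\<epsilon>' \<le> infdist (y + z) F"
      proof -
        obtain q where "q \<in> F" "infdist (y + z) F = dist (y + z) q"
            using infdist_attains_inf[OF F] by blast
        thus ?thesis using inD[of q] by (auto simp: F_def not_less[symmetric])
      qed
      thus "z \<in> {z. \<epsilon>' / 2 < infdist (y + z) F}" using \<epsilon>' by simp
    qed
    moreover have "{z. \<epsilon>' / 2 < infdist (y + z) F} \<in> sets \<nu>"
      unfolding sets_nu by (intro borel_open open_Collect_less continuous_intros)
    ultimately show ?thesis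
      using ball_cone[OF s(2) e(1)] by (meson emeasure_mono less_le_trans)
  qed
  show thesis
    by (rule that[of "\<epsilon>' / 2" "\<rho> / 2" c]) (use \<epsilon>' \<rho> c main in \<open>auto simp: F_def\<close>)
qed

section \<open>The ground state and the Chapman-Kolmogorov equation\<close>

lemma set_integrable_of_square_integrable:
  fixes f :: "'a::euclidean_space \<Rightarrow> real"
  assumes D: "D \<in> sets borel" "emeasure lborel D < \<infinity>" and f: "square_integrable_on f D"
  shows "set_integrable lborel D f"
  unfolding set_integrable_def
proof (rule Bochner_Integration.integrable_bound)
  show "integrable lborel (\<lambda>x. indicator D x *\<^sub>R (f x)\<^sup>2 + indicator D x)"
    using f D unfolding square_integrable_on_def set_integrable_def
    by (intro Bochner_Integration.integrable_add integrable_real_indicator) auto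
  show "(\<lambda>x. indicator D x *\<^sub>R f x) \<in> borel_measurable lborel"
    using f unfolding square_integrable_on_def set_borel_measurable_def by simp
  show "AE x in lborel. norm (indicator D x *\<^sub>R f x)
      \<le> norm (indicator D x *\<^sub>R (f x)\<^sup>2 + indicator D x)"
  proof (intro AE_I2)
    fix x
    have "\<bar>f x\<bar> \<le> (f x)\<^sup>2 + 1"
      using zero_le_power2[of "\<bar>f x\<bar> - 1"] by (simp add: power2_diff)
    thus "norm (indicator D x *\<^sub>R f x) \<le> norm (indicator D x *\<^sub>R (f x)\<^sup>2 + indicator D x)"
      by (auto simp: indicator_def)
  qed
qed

locale killed_levy_spectral = killed_levy M X \<eta> D p pD
  for M :: "'w measure" and X :: "real \<Rightarrow> 'w \<Rightarrow> 'a::euclidean_space" and \<eta> D p pD +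
  fixes \<phi> :: "nat \<Rightarrow> 'a \<Rightarrow> real" and eig :: "nat \<Rightarrow> real"
  assumes eigenbasis: "killed_eigenbasis D pD \<phi> eig"
begin

lemma basis: "L2_orthonormal_basis D \<phi>"
  and phi_continuous: "continuous_on D (\<phi> n)"
  and phi_eigen: "t > 0 \<Longrightarrow> x \<in> D \<Longrightarrow> (LINT y:D|lborel. pD t x y * \<phi> n y) = exp (- eig n * t) * \<phi> n x"
  and eig_pos: "0 < eig 0"
  and phi_pos: "x \<in> D \<Longrightarrow> 0 < \<phi> 0 x"
  using eigenbasis unfolding killed_eigenbasis_def killed_semigroup_def by blast+

lemma phi_integrable: "set_integrable lborel D (\<phi> n)"
proof -
  have "square_integrable_on (\<phi> n) D" using basis unfolding L2_orthonormal_basis_def by blast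
  thus ?thesis by (rule set_integrable_of_square_integrable[OF D_sets emeasure_D_finite])
qed

lemma AE_zero_of_orthogonal:
  assumes d: "square_integrable_on d D" and orth: "\<And>n. (LINT y:D|lborel. d y * \<phi> n y) = 0"
  shows "AE y in lborel. y \<in> D \<longrightarrow> d y = 0"
proof -
  have "(\<lambda>N::nat. LINT x:D|lborel. (d x - (\<Sum>n<N. (LINT y:D|lborel. d y * \<phi> n y) * \<phi> n x))\<^sup>2) \<longlonglongrightarrow> 0"
    using basis d unfolding L2_orthonormal_basis_def by blast
  hence "(\<lambda>N::nat. LINT x:D|lborel. (d x)\<^sup>2) \<longlonglongrightarrow> 0" unfolding orth by simp
  hence "(LINT x:D|lborel. (d x)\<^sup>2) = 0" using LIMSEQ_unique tendsto_const by blast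
  moreover have "set_integrable lborel D (\<lambda>x. (d x)\<^sup>2)" using d
      by (simp add: square_integrable_on_def)
  ultimately have "AE x in lborel. indicator D x *\<^sub>R (d x)\<^sup>2 = 0"
    unfolding set_lebesgue_integral_def set_integrable_def
    by (subst (asm) integral_nonneg_eq_0_iff_AE) auto
  thus ?thesis by eventually_elim (auto simp: indicator_def)
qed

text \<open>
  As functions of \<open>y\<close>, both sides are bounded and have the inner product \<open>exp (- eig n * (t + s)) * \<phi> n x\<close>
  with every \<open>\<phi> n\<close>, so their difference is orthogonal to an orthonormal basis.
\<close>

lemma chapman_kolmogorov:
  assumes t: "t > 0" and s: "s > 0" and x: "x \<in> D"
  shows "AE y in lborel. y \<in> D \<longrightarrow> pD (t + s) x y = (LINT z:D|lborel. pD t x z * pD s z y)"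
proof -
  have ts: "t + s > 0" using t s by simp
  obtain B1 where B1: "B1 \<ge> 0" "\<And>z. p t z \<le> B1" using p_bounded[OF t] by blast
  obtain B2 where B2: "B2 \<ge> 0" "\<And>z. p s z \<le> B2" using p_bounded[OF s] by blast
  obtain B3 where B3: "B3 \<ge> 0" "\<And>z. p (t + s) z \<le> B3" using p_bounded[OF ts] by blast
  define k where "k y = (LINT z:D|lborel. pD t x z * pD s z y)" for y
  define H where "H = (\<lambda>(y, z). indicator D y * (indicator D z * (pD t x z * pD s z y)))"
  have Hm: "H \<in> borel_measurable (lborel \<Otimes>\<^sub>M lborel)"
  proof -
    have "continuous_on (D \<times> D) (\<lambda>(y, z). pD t x z * pD s z y)"
    proof -
      have "continuous_on (D \<times> D) (\<lambda>q. pD t x (snd q) * (\<lambda>(a, b). pD s a b) (snd q, fst q))"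
        by (intro continuous_intros continuous_on_compose2[OF pD_continuous_right[OF t x]]
             continuous_on_compose2[OF pD_continuous[OF s]]) auto
      thus ?thesis by (simp add: split_def)
    qed
    hence "(\<lambda>q. indicator (D \<times> D) q *\<^sub>R (\<lambda>(y, z). pD t x z * pD s z y) q) \<in> borel_measurable borel"
      by (intro borel_measurable_continuous_on_indicator)
          (auto intro!: borel_open open_Times open_D)
    also have "(\<lambda>q. indicator (D \<times> D) q *\<^sub>R (\<lambda>(y, z). pD t x z * pD s z y) q) = H"
      by (auto simp: H_def fun_eq_iff indicator_def)
    finally show ?thesis by (simp add: borel_prod[symmetric] lborel_prod)
  qed
  have Hb: "\<bar>H (y, z)\<bar> \<le> B1 * B2 * (indicator D y * indicator D z)" for y z
  proof (cases "y \<in> D \<and> z \<in> D")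
    case True
    have "\<bar>pD t x z * pD s z y\<bar> \<le> B1 * B2"
      unfolding abs_mult using pD_bounds[OF t B1 x, of z] pD_bounds[OF s B2, of z y] True B1
          by (intro mult_mono) auto
    thus ?thesis using True by (simp add: H_def)
  qed (auto simp: H_def)
  have kH: "indicator D y * k y = (\<integral>z. H (y, z) \<partial>lborel)" for y
    by (simp add: k_def H_def set_lebesgue_integral_def)
  have km: "(\<lambda>y. indicator D y * k y) \<in> borel_measurable lborel"
    unfolding kH using Hm by (intro lborel.borel_measurable_lebesgue_integral) simp
  have iD: "integrable lborel (\<lambda>z. C * indicator D z :: real)" for C
    using emeasure_D_finite by (intro integrable_mult_right integrable_real_indicator) auto
  define V where "V = measure lborel D"
  have kb: "\<bar>indicator D y * k y\<bar> \<le> (B1 * B2 * V) * indicator D y" for y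
  proof (cases "y \<in> D")
    case True
    have "\<bar>\<integral>z. H (y, z) \<partial>lborel\<bar> \<le> (\<integral>z. B1 * B2 * indicator D z \<partial>lborel)"
    proof (rule integral_abs_bound[THEN order_trans], rule integral_mono)
      have "(\<lambda>z. H (y, z)) \<in> borel_measurable lborel" using Hm by simp
      thus "integrable lborel (\<lambda>z. \<bar>H (y, z)\<bar>)"
        by (intro Bochner_Integration.integrable_bound[OF iD[of "B1 * B2"]])
           (use Hb[of y] True in \<open>auto intro: order_trans[OF _ abs_ge_self]\<close>)
    qed (use Hb[of y] True iD in auto)
    thus ?thesis using True unfolding kH[symmetric] by (simp add: V_def)
  qed simp
  define d where "d y = pD (t + s) x y - k y" for y
  have dm: "(\<lambda>y. indicator D y * d y) \<in> borel_measurable lborel"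
    using measurable_pD[OF ts x] km unfolding d_def right_diff_distrib by simp
  have db: "\<bar>indicator D y * d y\<bar> \<le> (B3 + B1 * B2 * V) * indicator D y" for y
  proof (cases "y \<in> D")
    case True
    thus ?thesis using kb[of y] pD_bounds[OF ts B3 x True] by (simp add: d_def)
  qed simp
  have sq: "square_integrable_on d D"
    unfolding square_integrable_on_def set_borel_measurable_def set_integrable_def
  proof
    show "(\<lambda>x. indicat_real D x *\<^sub>R d x) \<in> borel_measurable lborel" using dm by simp
    have eq: "indicat_real D y *\<^sub>R (d y)\<^sup>2 = (indicator D y * d y)\<^sup>2" for y
        by (simp add: indicator_def)
    show "integrable lborel (\<lambda>x. indicat_real D x *\<^sub>R (d x)\<^sup>2)"
      unfolding eq
    proof (rule Bochner_Integration.integrable_bound[OF iD[of "(B3 + B1 * B2 * V)\<^sup>2"]])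
      show "AE y in lborel. norm ((indicator D y * d y)\<^sup>2)
          \<le> norm ((B3 + B1 * B2 * V)\<^sup>2 * indicator D y :: real)"
      proof (intro AE_I2)
        fix y
        have "\<bar>indicator D y * d y\<bar>\<^sup>2 \<le> ((B3 + B1 * B2 * V) * indicator D y)\<^sup>2"
            by (intro power_mono db) simp
        thus "norm ((indicator D y * d y)\<^sup>2) \<le> norm ((B3 + B1 * B2 * V)\<^sup>2 * indicator D y :: real)"
          by (cases "y \<in> D") auto
      qed
    qed (use dm in simp)
  qed
  have orth: "(LINT y:D|lborel. d y * \<phi> n y) = 0" for n
  proof -
    have ph: "integrable lborel (\<lambda>y. indicator D y * \<phi> n y)" using phi_integrable[of n]
        by (simp add: set_integrable_def)
    let ?G = "\<lambda>(y, z). H (y, z) * (indicator D y * \<phi> n y)"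
    have G_int: "integrable (lborel \<Otimes>\<^sub>M lborel) ?G"
    proof (rule Bochner_Integration.integrable_bound)
      have "integrable (lborel \<Otimes>\<^sub>M lborel)
          (\<lambda>(y::'a, z::'a). (B1 * B2 * \<bar>indicator D y * \<phi> n y\<bar>) * indicator D z)"
      proof (rule lborel_pair.Fubini_integrable)
        have [measurable]: "(\<lambda>y. indicator D y * \<phi> n y) \<in> borel_measurable borel" using ph
            by (auto dest: borel_measurable_integrable)
        show "(\<lambda>(y, z). (B1 * B2 * \<bar>indicator D y * \<phi> n y\<bar>) * indicator D z)
            \<in> borel_measurable (lborel \<Otimes>\<^sub>M lborel)"
          by measurable
        show "integrable lborel (\<lambda>y. LINT z|lborel. norm
            (case (y, z) of (y, z) \<Rightarrow> (B1 * B2 * \<bar>indicator D y * \<phi> n y\<bar>) * indicator D z))"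
        proof -
          have "(LINT z|lborel. norm
              (case (y, z) of (y, z) \<Rightarrow> (B1 * B2 * \<bar>indicator D y * \<phi> n y\<bar>) * indicator D z)) =
              (B1 * B2 * V) * \<bar>indicator D y * \<phi> n y\<bar>" for y
            using B1 B2 by (simp add: abs_mult V_def mult_ac)
          thus ?thesis using ph by (simp only: integrable_mult_right integrable_abs)
        qed
        show "AE y in lborel. integrable lborel
            (\<lambda>z. case (y, z) of (y, z) \<Rightarrow> (B1 * B2 * \<bar>indicator D y * \<phi> n y\<bar>) * indicator D z)"
          using iD by simp
      qed
      thus "integrable (lborel \<Otimes>\<^sub>M lborel)
          (\<lambda>(y::'a, z::'a). (B1 * B2 * \<bar>indicator D y * \<phi> n y\<bar>) * indicator D z)" .
      have "(\<lambda>y. indicator D y * \<phi> n y) \<in> borel_measurable lborel" using ph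
          by (rule borel_measurable_integrable)
      thus "?G \<in> borel_measurable (lborel \<Otimes>\<^sub>M lborel)"
        using Hm by (auto simp: split_def intro!: borel_measurable_times
            measurable_compose[OF measurable_fst])
      have pt: "\<bar>H (y, z) * (indicator D y * \<phi> n y)\<bar>
          \<le> (B1 * B2 * \<bar>indicator D y * \<phi> n y\<bar>) * indicator D z" for y z
      proof -
        have "\<bar>H (y, z) * (indicator D y * \<phi> n y)\<bar>
            \<le> (B1 * B2 * (indicator D y * indicator D z)) * \<bar>indicator D y * \<phi> n y\<bar>"
          unfolding abs_mult[of "H (y, z)"] by (intro mult_right_mono Hb) auto
        also have "\<dots> = (B1 * B2 * \<bar>indicator D y * \<phi> n y\<bar>) * indicator D z"
            by (auto simp: indicator_def)
        finally show ?thesis .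
      qed
      show "AE q in lborel \<Otimes>\<^sub>M lborel. norm (?G q)
          \<le> norm ((\<lambda>(y, z). (B1 * B2 * \<bar>indicator D y * \<phi> n y\<bar>) * indicator D z) q)"
        using pt by (intro AE_I2) (auto simp: split_def intro: order_trans[OF _ abs_ge_self])
    qed
    have kphi: "(LINT y:D|lborel. k y * \<phi> n y) = exp (- eig n * s) * (exp (- eig n * t) * \<phi> n x)"
    proof -
      have "(LINT y:D|lborel. k y * \<phi> n y) = (\<integral>y. (\<integral>z. ?G (y, z) \<partial>lborel) \<partial>lborel)"
        unfolding set_lebesgue_integral_def
      proof (intro Bochner_Integration.integral_cong refl)
        fix y
        have G: "(\<integral>z. ?G (y, z) \<partial>lborel) = (indicator D y * k y) * (indicator D y * \<phi> n y)"
            unfolding kH by simp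
        show "indicat_real D y *\<^sub>R (k y * \<phi> n y) = (\<integral>z. ?G (y, z) \<partial>lborel)"
          unfolding G by (simp add: indicator_def)
      qed
      also have "\<dots> = (\<integral>z. (\<integral>y. ?G (y, z) \<partial>lborel) \<partial>lborel)"
        using lborel_pair.Fubini_integral[of "\<lambda>y z. ?G (y, z)"] G_int by (simp add: split_def)
      also have "\<dots> = (\<integral>z. exp (- eig n * s) * (indicator D z * (pD t x z * \<phi> n z)) \<partial>lborel)"
      proof (intro Bochner_Integration.integral_cong refl)
        fix z
        show "(\<integral>y. ?G (y, z) \<partial>lborel) = exp (- eig n * s) * (indicator D z * (pD t x z * \<phi> n z))"
        proof (cases "z \<in> D")
          case True
          have "(\<integral>y. ?G (y, z) \<partial>lborel)
              = (\<integral>y. pD t x z * (indicator D y *\<^sub>R (pD s z y * \<phi> n y)) \<partial>lborel)"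
            using True by (intro Bochner_Integration.integral_cong) (auto simp: H_def indicator_def)
          also have "\<dots> = pD t x z * (LINT y:D|lborel. pD s z y * \<phi> n y)"
            unfolding set_lebesgue_integral_def by (rule integral_mult_right_zero)
          also have "\<dots> = pD t x z * (exp (- eig n * s) * \<phi> n z)"
              by (simp only: phi_eigen[OF s True])
          finally show ?thesis using True by simp
        qed (simp add: H_def)
      qed
      also have "\<dots> = exp (- eig n * s) * (LINT z:D|lborel. pD t x z * \<phi> n z)"
        unfolding set_lebesgue_integral_def real_scaleR_def by (rule integral_mult_right_zero)
      finally show ?thesis by (simp only: phi_eigen[OF t x])
    qed
    have i1: "set_integrable lborel D (\<lambda>y. pD (t + s) x y * \<phi> n y)"
        by (rule integrable_pD_mult[OF ts x phi_integrable])
    have i2: "set_integrable lborel D (\<lambda>y. k y * \<phi> n y)"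
      unfolding set_integrable_def
    proof (rule Bochner_Integration.integrable_bound)
      show "integrable lborel (\<lambda>y. (B1 * B2 * V) * (indicator D y * \<phi> n y))" using ph
          by (rule integrable_mult_right)
      have eq: "indicat_real D y *\<^sub>R (k y * \<phi> n y)
          = (indicator D y * k y) * (indicator D y * \<phi> n y)" for y by (simp add: indicator_def)
      show "(\<lambda>y. indicat_real D y *\<^sub>R (k y * \<phi> n y)) \<in> borel_measurable lborel"
        unfolding eq by (rule borel_measurable_times[OF km borel_measurable_integrable[OF ph]])
      show "AE y in lborel. norm (indicat_real D y *\<^sub>R (k y * \<phi> n y))
          \<le> norm ((B1 * B2 * V) * (indicator D y * \<phi> n y))"
      proof (intro AE_I2)
        fix y
        have "norm (indicat_real D y *\<^sub>R (k y * \<phi> n y))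
            \<le> ((B1 * B2 * V) * indicator D y) * \<bar>indicator D y * \<phi> n y\<bar>"
          unfolding eq real_norm_def abs_mult[of "indicator D y * k y"]
              by (intro mult_right_mono kb) auto
        also have "\<dots> \<le> norm ((B1 * B2 * V) * (indicator D y * \<phi> n y))"
          using B1 B2 by (simp add: abs_mult indicator_def V_def)
        finally show "norm (indicat_real D y *\<^sub>R (k y * \<phi> n y))
            \<le> norm ((B1 * B2 * V) * (indicator D y * \<phi> n y))" .
      qed
    qed
    have "(LINT y:D|lborel. d y * \<phi> n y) = (LINT y:D|lborel. pD (t + s) x y * \<phi> n y)
        - (LINT y:D|lborel. k y * \<phi> n y)"
      unfolding d_def left_diff_distrib by (rule set_integral_diff(2)[OF i1 i2])
    also have "\<dots> = 0"
    proof -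
      have "exp (- eig n * (t + s)) = exp (- eig n * s) * exp (- eig n * t)"
        unfolding exp_add[symmetric] by (simp add: algebra_simps)
      thus ?thesis unfolding kphi phi_eigen[OF ts x] by simp
    qed
    finally show ?thesis .
  qed
  from AE_zero_of_orthogonal[OF sq orth] show ?thesis by eventually_elim (auto simp: d_def k_def)
qed

text \<open>
  Two factors give \<open>pD (2 * s) x y \<le> B * A * \<phi> 0 x\<close>, because one of them is bounded by \<open>B\<close>. By symmetry
  the bound holds with \<open>\<phi> 0 y\<close> instead, and a third factor supplies \<open>\<phi> 0 x\<close>. The Chapman-Kolmogorov
  equation holds for almost every \<open>y\<close>, and continuity extends the inequalities to all \<open>y\<close>.
\<close>

lemma intrinsic_bound_of_mass_bound:
  assumes s: "s > 0" and A: "A \<ge> 0"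
      "\<And>x. x \<in> D \<Longrightarrow> set_lebesgue_integral lborel D (pD s x) \<le> A * \<phi> 0 x"
  shows "\<exists>c. \<forall>x\<in>D. \<forall>y\<in>D. pD (3 * s) x y \<le> c * \<phi> 0 x * \<phi> 0 y"
proof -
  obtain B where B: "B \<ge> 0" "\<And>z. p s z \<le> B" using p_bounded[OF s] by blast
  have one: "set_integrable lborel D (\<lambda>y. 1::real)"
    using emeasure_D_finite by (simp add: set_integrable_def)
  have i: "set_integrable lborel D (pD s x)" if "x \<in> D" for x
    using integrable_pD_mult[OF s that one] by simp
  have bound: "(LINT z:D|lborel. pD s x z * w z) \<le> C * (A * \<phi> 0 x)"
    if x: "x \<in> D" and w: "\<And>z. z \<in> D \<Longrightarrow> 0 \<le> w z" "\<And>z. z \<in> D \<Longrightarrow> w z \<le> C" and C: "C \<ge> 0" for x w C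
  proof (cases "set_integrable lborel D (\<lambda>z. pD s x z * w z)")
    case True
    have "(LINT z:D|lborel. pD s x z * w z) \<le> (LINT z:D|lborel. C * pD s x z)"
    proof (rule set_integral_mono[OF True])
      show "set_integrable lborel D (\<lambda>z. C * pD s x z)" using i[OF x]
          by (intro set_integrable_mult_right) simp
      show "pD s x z * w z \<le> C * pD s x z" if "z \<in> D" for z
        using mult_right_mono[OF w(2)[OF that] pD_nonneg[OF s x that]] by (simp add: mult.commute)
    qed
    also have "\<dots> = C * set_lebesgue_integral lborel D (pD s x)" by (rule set_integral_mult_right)
    also have "\<dots> \<le> C * (A * \<phi> 0 x)" using A(2)[OF x] C by (intro mult_left_mono)
    finally show ?thesis .
  next
    case False
    hence "(LINT z:D|lborel. pD s x z * w z) = 0"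
      unfolding set_integrable_def set_lebesgue_integral_def by (rule not_integrable_integral_eq)
    thus ?thesis using C A(1) phi_pos[OF x] by simp
  qed
  have s2: "2 * s > 0" "s + s > 0" "3 * s > 0" "s + 2 * s > 0" using s by auto
  have two: "pD (2 * s) x y \<le> B * (A * \<phi> 0 x)" if x: "x \<in> D" and y: "y \<in> D" for x y
  proof -
    have "AE y in lborel. y \<in> D \<longrightarrow> 0 \<le> B * (A * \<phi> 0 x) - pD (2 * s) x y"
      using chapman_kolmogorov[OF s s x]
    proof eventually_elim
      case (elim y)
      show ?case
      proof
        assume y: "y \<in> D"
        have "pD (s + s) x y \<le> B * (A * \<phi> 0 x)"
          unfolding elim[rule_format, OF y]
        proof (rule bound[OF x])
          fix z assume z: "z \<in> D"
          show "0 \<le> pD s z y" by (rule pD_nonneg[OF s z y])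
          show "pD s z y \<le> B" by (rule pD_bounds(2)[OF s B z y])
        next
          show "0 \<le> B" by (rule B(1))
        qed
        moreover have "s + s = 2 * s" by simp
        ultimately show "0 \<le> B * (A * \<phi> 0 x) - pD (2 * s) x y" by simp
      qed
    qed
    from nonneg_of_AE_nonneg[OF open_D
        continuous_on_diff[OF continuous_on_const pD_continuous_right[OF s2(1) x]] this y]
    show ?thesis by simp
  qed
  have three: "pD (3 * s) x y \<le> (B * A * A) * \<phi> 0 x * \<phi> 0 y" if x: "x \<in> D" and y: "y \<in> D" for x y
  proof -
    have "AE y in lborel. y \<in> D \<longrightarrow> 0 \<le> (B * A * A * \<phi> 0 x) * \<phi> 0 y - pD (3 * s) x y"
      using chapman_kolmogorov[OF s s2(1) x]
    proof eventually_elim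
      case (elim y)
      show ?case
      proof
        assume y: "y \<in> D"
        have "pD (s + 2 * s) x y \<le> (B * (A * \<phi> 0 y)) * (A * \<phi> 0 x)"
          unfolding elim[rule_format, OF y]
        proof (rule bound[OF x])
          fix z assume z: "z \<in> D"
          show "0 \<le> pD (2 * s) z y" by (rule pD_nonneg[OF s2(1) z y])
          show "pD (2 * s) z y \<le> B * (A * \<phi> 0 y)" using two[OF y z] pD_symmetric[OF s2(1) z y]
              by simp
        next
          show "0 \<le> B * (A * \<phi> 0 y)" using B(1) A(1) phi_pos[OF y] by simp
        qed
        moreover have "s + 2 * s = 3 * s" by simp
        ultimately show "0 \<le> (B * A * A * \<phi> 0 x) * \<phi> 0 y - pD (3 * s) x y" by (simp add: mult_ac)
      qed
    qed
    from nonneg_of_AE_nonneg[OF open_D _ this y]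
    show ?thesis
      using continuous_on_diff[OF continuous_on_mult[OF continuous_on_const phi_continuous]
          pD_continuous_right[OF s2(3) x]] by simp
  qed
  thus ?thesis by blast
qed

text \<open>
  On a compact subset of \<open>D\<close> the indicator is at most a multiple of \<open>\<phi> 0\<close>; apply the killed semigroup,
  which is positive and multiplies \<open>\<phi> 0\<close> by a number less than \<open>1\<close>. A continuous cut-off function stands
  in for the indicator.
\<close>

lemma interior_probability_bound:
  assumes \<epsilon>: "\<epsilon> > 0"
  obtains A where "A > 0" "\<And>x. x \<in> D \<Longrightarrow> indicator {z. \<epsilon> \<le> depth z} x \<le> A * \<phi> 0 x"
    "\<And>x u. x \<in> D \<Longrightarrow> u > 0 \<Longrightarrow> prob {\<omega> \<in> alive x u. x + X u \<omega> \<in> {z. \<epsilon> \<le> depth z}} \<le> A * \<phi> 0 x"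
proof -
  let ?K = "{z. \<epsilon> / 2 \<le> depth z}"
  have KD: "?K \<subseteq> D"
  proof
    fix z assume "z \<in> ?K"
    hence "0 < depth z" using \<epsilon> by simp
    thus "z \<in> D" by (simp only: depth_pos_iff)
  qed
  have "closed ?K" by (intro closed_Collect_le continuous_intros)
  hence Kc: "compact ?K" using bounded_subset[OF bounded_D KD]
      by (simp add: compact_eq_bounded_closed)
  obtain m where m: "m > 0" "\<And>z. z \<in> ?K \<Longrightarrow> m \<le> \<phi> 0 z"
  proof (cases "?K = {}")
    case True show thesis by (rule that[of 1]) (use True in auto)
  next
    case False
    obtain z0 where "z0 \<in> ?K" "\<And>z. z \<in> ?K \<Longrightarrow> \<phi> 0 z0 \<le> \<phi> 0 z"
      using continuous_attains_inf[OF Kc False continuous_on_subset[OF phi_continuous KD]] by blast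
    moreover have "0 < \<phi> 0 z0" using phi_pos KD calculation(1) by auto
    ultimately show thesis by (intro that[of "\<phi> 0 z0"])
  qed
  define f where "f z = min 1 (max 0 (2 * depth z / \<epsilon> - 1))" for z
  have fc: "continuous_on UNIV f" unfolding f_def using \<epsilon> by (intro continuous_intros) auto
  have f01: "0 \<le> f z" "f z \<le> 1" for z by (auto simp: f_def)
  have f1: "f z = 1" if "\<epsilon> \<le> depth z" for z
  proof -
    have "1 \<le> 2 * depth z / \<epsilon> - 1" using that \<epsilon> by (simp add: field_simps)
    thus ?thesis by (simp add: f_def)
  qed
  have f0: "f z = 0" if "\<not> \<epsilon> / 2 \<le> depth z" for z
  proof -
    have "2 * depth z / \<epsilon> - 1 \<le> 0" using that \<epsilon> by (simp add: field_simps)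
    thus ?thesis by (simp add: f_def)
  qed
  have fphi: "f z \<le> (1 / m) * \<phi> 0 z" if "z \<in> D" for z
  proof (cases "\<epsilon> / 2 \<le> depth z")
    case True
    have "1 \<le> (1 / m) * \<phi> 0 z" using m(2)[of z] True m(1) by simp
    thus ?thesis using f01[of z] by linarith
  next
    case False
    thus ?thesis using f0[OF False] phi_pos[OF that] m by simp
  qed
  show thesis
  proof (rule that[of "1 / m"])
    fix x assume x: "x \<in> D"
    show "indicator {z. \<epsilon> \<le> depth z} x \<le> (1 / m) * \<phi> 0 x"
      using fphi[OF x] f1[of x] f01[of x] by (auto simp: indicator_def)
    fix u :: real assume u: "u > 0"
    have [measurable]: "X u \<in> borel_measurable M" using u by (intro measurable_X) auto
    note alive_events[OF u, measurable]
    have [measurable]: "f \<in> borel_measurable borel" by (rule borel_measurable_continuous_onI[OF fc])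
    let ?E = "{\<omega> \<in> alive x u. x + X u \<omega> \<in> {z. \<epsilon> \<le> depth z}}"
    have [measurable]: "{z. \<epsilon> \<le> depth z} \<in> sets borel"
        by (intro borel_closed closed_Collect_le continuous_intros)
    have E[measurable]: "?E \<in> events"
    proof -
      have "?E = alive x u \<inter> {\<omega> \<in> space M. x + X u \<omega> \<in> {z. \<epsilon> \<le> depth z}}" by (auto simp: alive_def)
      moreover have "{\<omega> \<in> space M. x + X u \<omega> \<in> {z. \<epsilon> \<le> depth z}} \<in> events" by measurable
      ultimately show ?thesis by (simp only: sets.Int alive_events[OF u])
    qed
    have "prob ?E = expectation (\<lambda>\<omega>. indicator ?E \<omega>)"
      by (simp only: Bochner_Integration.integral_indicator sets.Int_space_eq2[OF E])
    also have "\<dots> \<le> expectation (\<lambda>\<omega>. indicator (alive x u) \<omega> * f (x + X u \<omega>))"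
    proof (rule integral_mono)
      show "integrable M (\<lambda>\<omega>. indicator (alive x u) \<omega> * f (x + X u \<omega>))"
        by (rule integrable_bounded[of _ 1]) (use f01 in \<open>auto simp: indicator_def\<close>)
      show "indicator ?E \<omega> \<le> indicator (alive x u) \<omega> * f (x + X u \<omega>)" for \<omega>
        using f1 f01 by (auto simp: indicator_def)
      show "integrable M (indicat_real ?E)"
        by (rule integrable_real_indicator[OF E]) (simp add: emeasure_eq_measure)
    qed
    also have "\<dots> = (LINT y:D|lborel. pD u x y * f y)"
    proof (rule alive_expectation_eq[OF u x fc])
      show "\<bar>f z\<bar> \<le> 1" for z using f01[of z] by simp
      show "f z = 0" if "z \<notin> D" for z
      proof (rule f0)
        have "depth z = 0" using that by (simp only: depth_zero_iff) simp
        thus "\<not> \<epsilon> / 2 \<le> depth z" using \<epsilon> by simp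
      qed
    qed
    also have "\<dots> \<le> (LINT y:D|lborel. (1 / m) * (pD u x y * \<phi> 0 y))"
    proof (rule set_integral_mono)
      have "set_integrable lborel D f"
        unfolding set_integrable_def
      proof (rule Bochner_Integration.integrable_bound[of _ "indicator D :: 'a \<Rightarrow> real"])
        show "integrable lborel (indicator D :: 'a \<Rightarrow> real)" using emeasure_D_finite
            by (intro integrable_real_indicator) auto
      qed (use f01 in \<open>auto simp: indicator_def\<close>)
      thus "set_integrable lborel D (\<lambda>y. pD u x y * f y)" by (rule integrable_pD_mult[OF u x])
      show "set_integrable lborel D (\<lambda>y. (1 / m) * (pD u x y * \<phi> 0 y))"
        using integrable_pD_mult[OF u x phi_integrable] by (intro set_integrable_mult_right) simp
      show "pD u x y * f y \<le> (1 / m) * (pD u x y * \<phi> 0 y)" if "y \<in> D" for y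
        using mult_left_mono[OF fphi[OF that] pD_nonneg[OF u x that]] by (simp add: mult_ac)
    qed
    also have "\<dots> = (1 / m) * (exp (- eig 0 * u) * \<phi> 0 x)"
      unfolding phi_eigen[OF u x, symmetric] by (rule set_integral_mult_right)
    also have "\<dots> \<le> (1 / m) * (1 * \<phi> 0 x)"
      using m eig_pos u phi_pos[OF x] by (intro mult_left_mono mult_right_mono) auto
    finally show "prob ?E \<le> (1 / m) * \<phi> 0 x" by simp
  qed (use m in auto)
qed

end

section \<open>Survival probabilities\<close>

text \<open>
  A supremum of downward paraboloids with tops on \<open>K\<close>, cut off at zero, hence semiconvex. This replaces a
  smooth bump, because only lower bounds of second differences are needed.
\<close>

definition distance_bump :: "real \<Rightarrow> 'a::euclidean_space set \<Rightarrow> 'a \<Rightarrow> real" where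
  "distance_bump \<delta> K z = max 0 (1 - (infdist z K / \<delta>)\<^sup>2)"

lemma distance_bump_bounds: "0 \<le> distance_bump \<delta> K z" "distance_bump \<delta> K z \<le> 1"
  by (auto simp: distance_bump_def)

lemma continuous_distance_bump: "\<delta> \<noteq> 0 \<Longrightarrow> continuous_on S (distance_bump \<delta> K)"
  unfolding distance_bump_def by (intro continuous_intros) auto

lemma distance_bump_eq_1: "z \<in> K \<Longrightarrow> distance_bump \<delta> K z = 1"
  by (simp add: distance_bump_def)

lemma distance_bump_eq_0:
  assumes "0 < \<delta>" "\<delta> \<le> infdist z K"
  shows "distance_bump \<delta> K z = 0"
proof -
  have "1\<^sup>2 \<le> (infdist z K / \<delta>)\<^sup>2" using assms by (intro power_mono) auto
  thus ?thesis by (simp add: distance_bump_def)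
qed

text \<open>
  Where the bump is positive, the paraboloid centred at a nearest point of \<open>K\<close> touches it from below at
  \<open>z\<close>, and a paraboloid has constant second differences.
\<close>

lemma distance_bump_second_difference:
  assumes K: "closed K" "K \<noteq> {}" and \<delta>: "0 < \<delta>"
  shows "- (2 + 2 / \<delta>\<^sup>2) * min 1 ((norm v)\<^sup>2) \<le> distance_bump \<delta> K (z + v)
      + distance_bump \<delta> K (z - v) - 2 * distance_bump \<delta> K z"
    (is "_ \<le> ?d")
proof -
  let ?C = "2 + 2 / \<delta>\<^sup>2"
  have C: "0 \<le> 2 / \<delta>\<^sup>2" by simp
  have d2: "-2 \<le> ?d"
    using distance_bump_bounds[of \<delta> K "z + v"] distance_bump_bounds[of \<delta> K "z - v"]
        distance_bump_bounds[of \<delta> K z] by linarith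
  have dv: "- (2 / \<delta>\<^sup>2) * (norm v)\<^sup>2 \<le> ?d"
  proof (cases "distance_bump \<delta> K z = 0")
    case True
    have "0 \<le> ?d" using True distance_bump_bounds(1)[of \<delta> K "z + v"]
        distance_bump_bounds(1)[of \<delta> K "z - v"] by simp
    moreover have "- (2 / \<delta>\<^sup>2) * (norm v)\<^sup>2 \<le> 0" using C by (simp add: mult_nonneg_nonneg)
    ultimately show ?thesis by linarith
  next
    case False
    obtain k where k: "k \<in> K" "infdist z K = dist z k" using infdist_attains_inf[OF K] by blast
    have lower: "1 - (norm (w - k))\<^sup>2 / \<delta>\<^sup>2 \<le> distance_bump \<delta> K w" for w
    proof -
      have "(infdist w K / \<delta>)\<^sup>2 \<le> (norm (w - k) / \<delta>)\<^sup>2"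
        using infdist_le[OF k(1), of w] infdist_nonneg[of w K] \<delta>
            by (intro power_mono divide_right_mono) (auto simp: dist_norm)
      thus ?thesis by (simp add: distance_bump_def power_divide)
    qed
    have eq: "distance_bump \<delta> K z = 1 - (norm (z - k))\<^sup>2 / \<delta>\<^sup>2"
      using False k by (auto simp: distance_bump_def dist_norm power_divide max_def)
    have par: "(norm (z + v - k))\<^sup>2 + (norm (z - v - k))\<^sup>2 = 2 * (norm (z - k))\<^sup>2 + 2 * (norm v)\<^sup>2"
      unfolding power2_norm_eq_inner
          by (simp add: inner_add_left inner_add_right inner_diff_left inner_diff_right
          inner_commute algebra_simps)
    have "(1 - (norm (z + v - k))\<^sup>2 / \<delta>\<^sup>2) + (1 - (norm (z - v - k))\<^sup>2 / \<delta>\<^sup>2)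
        - 2 * distance_bump \<delta> K z
        = (2 * (norm (z - k))\<^sup>2 - ((norm (z + v - k))\<^sup>2 + (norm (z - v - k))\<^sup>2)) / \<delta>\<^sup>2"
      unfolding eq using \<delta> by (simp add: field_simps)
    also have "\<dots> = - (2 / \<delta>\<^sup>2) * (norm v)\<^sup>2" unfolding par by simp
    finally show ?thesis using lower[of "z + v"] lower[of "z - v"] by linarith
  qed
  show ?thesis
  proof (cases "1 \<le> (norm v)\<^sup>2")
    case True
    hence m: "min 1 ((norm v)\<^sup>2) = 1" by simp
    show ?thesis unfolding m mult_1_right using d2 C by linarith
  next
    case False
    hence m: "min 1 ((norm v)\<^sup>2) = (norm v)\<^sup>2" by simp
    have "- ?C * (norm v)\<^sup>2 = - (2 / \<delta>\<^sup>2) * (norm v)\<^sup>2 - 2 * (norm v)\<^sup>2"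
        by (simp add: left_diff_distrib)
    moreover have "0 \<le> 2 * (norm v)\<^sup>2" by simp
    ultimately show ?thesis unfolding m using dv by linarith
  qed
qed

context cadlag_symmetric_levy
begin

text \<open>
  By symmetry of the increment the difference is half the expectation of a second difference.
\<close>

lemma semigroup_distance_bump_lower:
  assumes K: "closed K" "K \<noteq> {}" and \<delta>: "0 < \<delta>"
  obtains C where "C \<ge> 0" "\<And>h z. h > 0 \<Longrightarrow> - C * h \<le> semigroup h (distance_bump \<delta> K) z
      - distance_bump \<delta> K z"
proof -
  let ?\<psi> = "distance_bump \<delta> K"
  obtain C2 where C2: "C2 \<ge> 0" "\<And>h. h > 0 \<Longrightarrow> expectation (\<lambda>\<omega>. min 1 ((norm (X h \<omega>))\<^sup>2)) \<le> C2 * h"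
  proof (rule truncated_second_moment)
    fix C assume "C \<ge> 0" "\<And>h. h > 0 \<Longrightarrow> expectation (\<lambda>\<omega>. min 1 ((norm (X h \<omega>))\<^sup>2)) \<le> C * h"
    thus thesis by (rule that)
  qed
  define C0 where "C0 = 2 + 2 / \<delta>\<^sup>2"
  have C0: "0 \<le> C0" by (simp add: C0_def)
  have \<psi>m[measurable]: "?\<psi> \<in> borel_measurable borel"
    using \<delta> by (intro borel_measurable_continuous_onI continuous_distance_bump) auto
  show thesis
  proof (rule that[of "C0 * C2 / 2"])
    fix h :: real and z assume h: "h > 0"
    have [measurable]: "X h \<in> borel_measurable M" using h by (intro measurable_X) auto
    have i: "integrable M (\<lambda>\<omega>. ?\<psi> (z + X h \<omega>))" "integrable M (\<lambda>\<omega>. ?\<psi> (z - X h \<omega>))"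
      using distance_bump_bounds[of \<delta> K] by (auto intro!: integrable_bounded[of _ 1])
    have "expectation (\<lambda>\<omega>. ?\<psi> (z - X h \<omega>)) = semigroup h ?\<psi> z"
      using expectation_reflect[of h "\<lambda>v. ?\<psi> (z + v)"] h by (simp add: semigroup_def)
    hence "2 * (semigroup h ?\<psi> z - ?\<psi> z)
        = expectation (\<lambda>\<omega>. ?\<psi> (z + X h \<omega>) + ?\<psi> (z - X h \<omega>) - 2 * ?\<psi> z)"
      using i by (simp add: semigroup_def prob_space)
    also have "\<dots> \<ge> expectation (\<lambda>\<omega>. - C0 * min 1 ((norm (X h \<omega>))\<^sup>2))"
    proof (rule integral_mono)
      show "integrable M (\<lambda>\<omega>. - C0 * min 1 ((norm (X h \<omega>))\<^sup>2))"
        by (intro integrable_mult_right integrable_bounded[of _ 1]) auto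
      show "integrable M (\<lambda>\<omega>. ?\<psi> (z + X h \<omega>) + ?\<psi> (z - X h \<omega>) - 2 * ?\<psi> z)" using i by auto
    qed (use distance_bump_second_difference[OF K \<delta>] in \<open>simp only: C0_def\<close>)
    also have "expectation (\<lambda>\<omega>. - C0 * min 1 ((norm (X h \<omega>))\<^sup>2)) =
        - C0 * expectation (\<lambda>\<omega>. min 1 ((norm (X h \<omega>))\<^sup>2))"
      by (rule integral_mult_right_zero)
    finally have "- C0 * expectation (\<lambda>\<omega>. min 1 ((norm (X h \<omega>))\<^sup>2))
        \<le> 2 * (semigroup h ?\<psi> z - ?\<psi> z)" .
    moreover have "C0 * expectation (\<lambda>\<omega>. min 1 ((norm (X h \<omega>))\<^sup>2)) \<le> C0 * (C2 * h)"
      using C2(2)[OF h] C0 by (intro mult_left_mono)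
    ultimately show "- (C0 * C2 / 2) * h \<le> semigroup h ?\<psi> z - ?\<psi> z" by simp
  qed (use C0 C2 in auto)
qed

end

locale killed_levy_full = levy_with_measure M X \<eta> \<nu> + killed_levy_spectral M X \<eta> D p pD \<phi> eig
  for M :: "'w measure" and X :: "real \<Rightarrow> 'w \<Rightarrow> 'a::euclidean_space" and \<eta> \<nu> D p pD \<phi> eig
begin

text \<open>
  \<open>small_time_lower_bound\<close> is a limit for one starting point at a time. A finite \<open>\<epsilon> / 4\<close>-net of the
  boundary layer makes it uniform, at the price of a target that is larger by \<open>\<epsilon> / 4\<close>.
\<close>

lemma uniform_jump_probability:
  assumes \<epsilon>: "0 < \<epsilon>" and c: "0 \<le> c"
    and jump: "\<And>y. y \<in> D \<Longrightarrow> depth y < \<epsilon>' \<Longrightarrow> ennreal c < emeasure \<nu> {z. \<epsilon> < depth (y + z)}"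
    and \<epsilon>': "\<epsilon>' \<le> \<epsilon>"
  obtains h0 where "h0 > 0"
    "\<And>h y. 0 < h \<Longrightarrow> h < h0 \<Longrightarrow> y \<in> D \<Longrightarrow> depth y < \<epsilon>' \<Longrightarrow> c * h
        \<le> prob {\<omega> \<in> space M. 3 / 4 * \<epsilon> \<le> depth (y + X h \<omega>)}"
proof -
  define S where "S = {y \<in> D. depth y < \<epsilon>'}"
  have "compact (closure S)" using bounded_D
      by (intro compact_closure[THEN iffD2] bounded_subset[OF bounded_D]) (auto simp: S_def)
  moreover have "closure S \<subseteq> (\<Union>y\<in>S. ball y (\<epsilon> / 4))"
  proof
    fix z assume "z \<in> closure S"
    then obtain y where "y \<in> S" "dist y z < \<epsilon> / 4" using \<epsilon> closure_approachable[of z S]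
        by (metis divide_pos_pos zero_less_numeral)
    thus "z \<in> (\<Union>y\<in>S. ball y (\<epsilon> / 4))" by auto
  qed
  ultimately obtain Y where Y: "Y \<subseteq> S" "finite Y" "closure S \<subseteq> (\<Union>y\<in>Y. ball y (\<epsilon> / 4))"
    using compactE_image[of "closure S" S "\<lambda>y. ball y (\<epsilon> / 4)"] by (metis open_ball)
  have "\<forall>\<^sub>F h in at_right 0. \<forall>y\<in>Y. c * h \<le> prob {\<omega> \<in> space M. X h \<omega> \<in> {z. \<epsilon> < depth (y + z)}}"
  proof (rule eventually_ball_finite[OF Y(2)], rule ballI)
    fix y assume "y \<in> Y"
    hence y: "y \<in> D" "depth y < \<epsilon>'" using Y by (auto simp: S_def)
    show "\<forall>\<^sub>F h in at_right 0. c * h \<le> prob {\<omega> \<in> space M. X h \<omega> \<in> {z. \<epsilon> < depth (y + z)}}"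
    proof (rule small_time_lower_bound[OF _ _ jump[OF y] c])
      show "open {z. \<epsilon> < depth (y + z)}" by (intro open_Collect_less continuous_intros)
      show "0 \<notin> {z. \<epsilon> < depth (y + z)}" using y \<epsilon>' by simp
    qed
  qed
  then obtain h0 where h0: "h0 > 0"
      "\<And>h y. 0 < h \<Longrightarrow> h < h0 \<Longrightarrow> y \<in> Y \<Longrightarrow> c * h \<le> prob {\<omega> \<in> space M. \<epsilon> < depth (y + X h \<omega>)}"
    unfolding eventually_at_right_field by auto
  show thesis
  proof (rule that[OF h0(1)])
    fix h y assume h: "0 < h" "h < h0" and y: "y \<in> D" "depth y < \<epsilon>'"
    have [measurable]: "X h \<in> borel_measurable M" using h by (intro measurable_X) auto
    have [measurable]: "depth \<in> borel_measurable borel"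
        by (intro borel_measurable_continuous_onI continuous_intros)
    have "y \<in> closure S" using y closure_subset[of S] by (auto simp: S_def)
    then obtain y' where y': "y' \<in> Y" "dist y' y < \<epsilon> / 4" using Y(3) by auto
    have "c * h \<le> prob {\<omega> \<in> space M. \<epsilon> < depth (y' + X h \<omega>)}" by (rule h0(2)[OF h y'(1)])
    also have "\<dots> \<le> prob {\<omega> \<in> space M. 3 / 4 * \<epsilon> \<le> depth (y + X h \<omega>)}"
    proof (rule finite_measure_mono)
      show "{\<omega> \<in> space M. \<epsilon> < depth (y' + X h \<omega>)} \<subseteq> {\<omega> \<in> space M. 3 / 4 * \<epsilon> \<le> depth (y + X h \<omega>)}"
      proof safe
        fix \<omega> assume "\<epsilon> < depth (y' + X h \<omega>)"
        thus "3 / 4 * \<epsilon> \<le> depth (y + X h \<omega>)"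
          using infdist_triangle[of "y' + X h \<omega>" "- D" "y + X h \<omega>"] y'(2) by simp
      qed
    qed measurable
    finally show "c * h \<le> prob {\<omega> \<in> space M. 3 / 4 * \<epsilon> \<le> depth (y + X h \<omega>)}" .
  qed
qed

text \<open>
  \<open>dynkin_inequality\<close> for a bump that is \<open>1\<close> on the target of the jumps and vanishes in the boundary
  layer. In the layer the difference quotient is at least the jump rate \<open>c\<close>; elsewhere in \<open>D\<close> it is
  bounded below by semiconvexity, and the process is there with probability at most a multiple of
  \<open>\<phi> 0 x\<close>.
\<close>

lemma alive_probability_bound:
  assumes \<epsilon>: "0 < \<epsilon>" "0 < \<rho>" and c: "0 < c" and ne: "D \<noteq> {}"
    and jump: "\<And>y. y \<in> D \<Longrightarrow> depth y < \<rho> \<Longrightarrow> ennreal c < emeasure \<nu> {z. \<epsilon> < depth (y + z)}"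
    and t: "t > 0"
  shows "\<exists>A\<ge>0. \<forall>x\<in>D. prob (alive x t) \<le> A * \<phi> 0 x"
proof -
  obtain z0 where z0: "z0 \<in> D" using ne by blast
  \<comment> \<open>The minimum makes the set \<open>K\<close> below nonempty.\<close>
  define e where "e = min \<epsilon> (depth z0)"
  have e: "0 < e" "e \<le> \<epsilon>" "e \<le> depth z0" using \<epsilon> z0 depth_pos_iff[of z0] by (auto simp: e_def)
  define e' where "e' = min \<rho> (e / 2)"
  have e': "0 < e'" "e' \<le> \<rho>" "e' \<le> e / 2" "e' \<le> e" using e \<epsilon> by (auto simp: e'_def)
  have jump': "ennreal c < emeasure \<nu> {z. e < depth (y + z)}" if "y \<in> D" "depth y < e'" for y
  proof -
    have "ennreal c < emeasure \<nu> {z. \<epsilon> < depth (y + z)}" using that e' by (intro jump) auto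
    also have "\<dots> \<le> emeasure \<nu> {z. e < depth (y + z)}"
      using e by (intro emeasure_mono) (auto intro!: borel_open open_Collect_less continuous_intros)
    finally show ?thesis .
  qed
  obtain h0 where h0: "h0 > 0"
    "\<And>h y. 0 < h \<Longrightarrow> h < h0 \<Longrightarrow> y \<in> D \<Longrightarrow> depth y < e' \<Longrightarrow> c * h
        \<le> prob {\<omega> \<in> space M. 3 / 4 * e \<le> depth (y + X h \<omega>)}"
  proof (rule uniform_jump_probability[OF e(1) less_imp_le[OF c] jump' e'(4)])
    fix h0 assume "h0 > 0" "\<And>h y. 0 < h \<Longrightarrow> h < h0 \<Longrightarrow> y \<in> D \<Longrightarrow> depth y < e' \<Longrightarrow> c * h
        \<le> prob {\<omega> \<in> space M. 3 / 4 * e \<le> depth (y + X h \<omega>)}"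
    thus thesis by (rule that)
  qed
  define K where "K = {z. 3 / 4 * e \<le> depth z}"
  have K: "closed K" unfolding K_def by (intro closed_Collect_le continuous_intros)
  have Kne: "K \<noteq> {}" using e by (auto simp: K_def intro!: exI[of _ z0])
  define K' where "K' = {z. e' \<le> depth z}"
  have K'c: "closed K'" unfolding K'_def by (intro closed_Collect_le continuous_intros)
  have K'D: "z \<in> D" if "z \<in> K'" for z
  proof -
    have "0 < depth z" using that e' by (simp add: K'_def)
    thus ?thesis by (simp only: depth_pos_iff)
  qed
  define \<psi> where "\<psi> = distance_bump (e / 4) K"
  have \<psi>0: "\<psi> z = 0" if "z \<notin> K'" for z
    unfolding \<psi>_def
  proof (rule distance_bump_eq_0)
    obtain k where k: "k \<in> K" "infdist z K = dist z k" using infdist_attains_inf[OF K Kne] by blast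
    have "depth k \<le> depth z + dist k z" by (rule infdist_triangle)
    thus "e / 4 \<le> infdist z K" using k that e' by (simp add: K_def K'_def dist_commute)
  qed (use e in simp)
  obtain C3 where C3: "C3 \<ge> 0" "\<And>h z. h > 0 \<Longrightarrow> - C3 * h \<le> semigroup h \<psi> z - \<psi> z"
  proof (rule semigroup_distance_bump_lower[OF K Kne, of "e / 4", folded \<psi>_def])
    fix C assume "C \<ge> 0" "\<And>h z. h > 0 \<Longrightarrow> - C * h \<le> semigroup h \<psi> z - \<psi> z"
    thus thesis by (rule that)
  qed (use e in simp)
  have \<psi>c: "continuous_on UNIV \<psi>" unfolding \<psi>_def using e by (intro continuous_distance_bump) auto
  have \<psi>b: "0 \<le> \<psi> z" "\<psi> z \<le> 1" for z unfolding \<psi>_def by (rule distance_bump_bounds)+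
  have [measurable]: "\<psi> \<in> borel_measurable borel" by (rule borel_measurable_continuous_onI[OF \<psi>c])
  have gen: "h * (c * indicator D z - (C3 + c) * indicator K' z) \<le> semigroup h \<psi> z - \<psi> z"
      if h: "0 < h" "h < h0" for h z
  proof -
    have [measurable]: "X h \<in> borel_measurable M" using h by (intro measurable_X) auto
    have [measurable]: "depth \<in> borel_measurable borel"
        by (intro borel_measurable_continuous_onI continuous_intros)
    have nn: "0 \<le> semigroup h \<psi> z" unfolding semigroup_def using \<psi>b
        by (intro integral_nonneg_AE) auto
    consider "z \<in> K'" | "z \<notin> K'" "z \<in> D" | "z \<notin> K'" "z \<notin> D" by blast
    thus ?thesis
    proof cases
      case 1
      thus ?thesis using K'D[OF 1] C3(2)[OF h(1), of z] by (simp add: algebra_simps)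
    next
      case 2
      hence "depth z < e'" by (simp add: K'_def)
      let ?E = "{\<omega> \<in> space M. 3 / 4 * e \<le> depth (z + X h \<omega>)}"
      have "c * h \<le> prob ?E" by (rule h0(2)[OF h 2(2) \<open>depth z < e'\<close>])
      also have "\<dots> = expectation (\<lambda>\<omega>. indicator ?E \<omega>)" by (simp add: Int_absorb2)
      also have "\<dots> \<le> semigroup h \<psi> z"
        unfolding semigroup_def
      proof (rule integral_mono)
        show "integrable M (\<lambda>\<omega>. \<psi> (z + X h \<omega>))"
            by (rule integrable_bounded[of _ 1]) (use \<psi>b in auto)
        show "indicator ?E \<omega> \<le> \<psi> (z + X h \<omega>)" for \<omega>
          using \<psi>b(1) distance_bump_eq_1[of "z + X h \<omega>" K "e / 4"]
              by (auto simp: indicator_def K_def \<psi>_def)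
      qed (simp add: emeasure_eq_measure)
      finally show ?thesis using 2 \<psi>0[OF 2(1)] by (simp add: mult.commute)
    next
      case 3
      thus ?thesis using nn \<psi>0[OF 3(1)] by simp
    qed
  qed
  obtain A where A: "A > 0" "\<And>x. x \<in> D \<Longrightarrow> indicator K' x \<le> A * \<phi> 0 x"
    "\<And>x u. x \<in> D \<Longrightarrow> u > 0 \<Longrightarrow> prob {\<omega> \<in> alive x u. x + X u \<omega> \<in> K'} \<le> A * \<phi> 0 x"
  proof (rule interior_probability_bound[OF e'(1), folded K'_def])
    fix A assume "A > 0" "\<And>x. x \<in> D \<Longrightarrow> indicator K' x \<le> A * \<phi> 0 x"
      "\<And>x u. x \<in> D \<Longrightarrow> u > 0 \<Longrightarrow> prob {\<omega> \<in> alive x u. x + X u \<omega> \<in> K'} \<le> A * \<phi> 0 x"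
    thus thesis by (rule that)
  qed
  have "prob (alive x t) \<le> ((1 + (C3 + c) * t) * A / (c * t)) * \<phi> 0 x" if x: "x \<in> D" for x
  proof -
    have "c * t * prob (alive x t) \<le> (1 + (C3 + c) * t) * (A * \<phi> 0 x)"
    proof (rule dynkin_inequality[OF t x \<psi>c \<psi>b _ _ \<psi>0 c _ h0(1) gen A(2)[OF x]])
      show "\<psi> z = 0" if "z \<notin> D" for z using that K'D \<psi>0 by blast
      show "K' \<in> sets borel" using K'c by simp
      show "prob {\<omega> \<in> alive x u. x + X u \<omega> \<in> K'} \<le> A * \<phi> 0 x" if "0 < u" "u \<le> t" for u
          by (rule A(3)[OF x that(1)])
    qed (use C3 c in auto)
    thus ?thesis using c t by (simp add: field_simps)
  qed
  moreover have "0 \<le> (1 + (C3 + c) * t) * A / (c * t)" using C3 c t A by simp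
  ultimately show ?thesis by blast
qed

lemma intrinsically_ultracontractive:
  assumes \<epsilon>: "0 < \<epsilon>" "0 < \<rho>" and c: "0 < c" and ne: "D \<noteq> {}"
    and jump: "\<And>y. y \<in> D \<Longrightarrow> depth y < \<rho> \<Longrightarrow> ennreal c < emeasure \<nu> {z. \<epsilon> < depth (y + z)}"
    and t: "t > 0"
  shows "\<exists>c. \<forall>x\<in>D. \<forall>y\<in>D. pD t x y \<le> c * \<phi> 0 x * \<phi> 0 y"
proof -
  have s: "t / 3 > 0" using t by simp
  obtain A where A: "A \<ge> 0" "\<And>x. x \<in> D \<Longrightarrow> prob (alive x (t / 3)) \<le> A * \<phi> 0 x"
    using alive_probability_bound[OF \<epsilon> c ne jump s] by blast
  have "set_lebesgue_integral lborel D (pD (t / 3) x) \<le> A * \<phi> 0 x" if "x \<in> D" for x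
    using pD_mass_le_alive[OF s that] A(2)[OF that] by linarith
  from intrinsic_bound_of_mass_bound[OF s A(1) this] show ?thesis by simp
qed

end

section \<open>Passage to a version with cadlag paths\<close>

lemma (in prob_space) indep_vars_AE_cong:
  fixes X Y :: "nat \<Rightarrow> 'a \<Rightarrow> 'b::topological_space"
  assumes X: "indep_vars (\<lambda>_. borel) X {..<n}" and Y: "\<And>i. i < n \<Longrightarrow> random_variable borel (Y i)"
    and eq: "AE \<omega> in M. \<forall>i<n. X i \<omega> = Y i \<omega>"
  shows "indep_vars (\<lambda>_. borel) Y {..<n}"
proof (cases "n = 0")
  case True
  thus ?thesis by (simp add: indep_vars_def2 indep_sets_def)
next
  case False
  have Xm: "random_variable borel (X i)" if "i \<in> {..<n}" for i using X that
      by (auto simp: indep_vars_def)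
  have ne: "{..<n} \<noteq> {}" using False by auto
  have 1: "distr M (PiM {..<n} (\<lambda>_. borel)) (\<lambda>x. \<lambda>i\<in>{..<n}. Y i x)
      = distr M (PiM {..<n} (\<lambda>_. borel)) (\<lambda>x. \<lambda>i\<in>{..<n}. X i x)"
  proof (rule distr_cong_AE)
    show "AE x in M. (\<lambda>i\<in>{..<n}. Y i x) = (\<lambda>i\<in>{..<n}. X i x)"
      using eq by eventually_elim (auto simp: restrict_def)
  qed (use Xm Y in \<open>auto intro!: measurable_restrict\<close>)
  have 2: "distr M borel (Y i) = distr M borel (X i)" if "i \<in> {..<n}" for i
    using eq Xm[OF that] Y that by (intro distr_cong_AE) (auto elim!: eventually_mono)
  have "distr M (PiM {..<n} (\<lambda>_. borel)) (\<lambda>x. \<lambda>i\<in>{..<n}. X i x)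
      = PiM {..<n} (\<lambda>i. distr M borel (X i))"
    using indep_vars_iff_distr_eq_PiM'[OF ne, where M'="\<lambda>_. borel" and X=X] Xm X by simp
  also have "\<dots> = PiM {..<n} (\<lambda>i. distr M borel (Y i))" by (intro PiM_cong) (auto simp: 2)
  finally show ?thesis
    using indep_vars_iff_distr_eq_PiM'[OF ne, where M'="\<lambda>_. borel" and X=Y] Y 1 by simp
qed

text \<open>
  The characteristic function is real at all times by symmetry, and \<open>exp (t * z)\<close> is real for all
  \<open>t \<ge> 0\<close> only if \<open>z\<close> is.
\<close>

lemma (in symmetric_levy_process) characteristic_function_real:
  assumes ch: "\<And>t. t \<ge> 0 \<Longrightarrow> (CLINT \<omega>|M. iexp (\<xi> \<bullet> X t \<omega>)) = exp (complex_of_real t * z)"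
  shows "Re z \<le> 0" and "t \<ge> 0 \<Longrightarrow> expectation (\<lambda>\<omega>. cos (\<xi> \<bullet> X t \<omega>)) = exp (t * Re z)"
proof -
  have parts: "expectation (\<lambda>\<omega>. cos (\<xi> \<bullet> X t \<omega>)) = Re (exp (complex_of_real t * z))"
    "Im (exp (complex_of_real t * z)) = 0" if t: "t \<ge> 0" for t
  proof -
    note measurable[OF t, measurable]
    have int: "integrable M (\<lambda>\<omega>. iexp (\<xi> \<bullet> X t \<omega>))"
      by (rule integrable_const_bound[where B=1]) auto
    show "expectation (\<lambda>\<omega>. cos (\<xi> \<bullet> X t \<omega>)) = Re (exp (complex_of_real t * z))"
      unfolding ch[OF t, symmetric] integral_Re[OF int, symmetric] by (simp add: Re_exp)
    have "expectation (\<lambda>\<omega>. sin (\<xi> \<bullet> - X t \<omega>))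
        = integral\<^sup>L (distr M borel (\<lambda>\<omega>. - X t \<omega>)) (\<lambda>v. sin (\<xi> \<bullet> v))"
      by (subst integral_distr) auto
    also have "\<dots> = expectation (\<lambda>\<omega>. sin (\<xi> \<bullet> X t \<omega>))"
      unfolding symmetric[OF t] by (subst integral_distr) auto
    finally have "expectation (\<lambda>\<omega>. sin (\<xi> \<bullet> X t \<omega>)) = 0" by simp
    thus "Im (exp (complex_of_real t * z)) = 0"
      unfolding ch[OF t, symmetric] integral_Im[OF int, symmetric] by (simp add: Im_exp)
  qed
  have im: "Im z = 0"
  proof (rule ccontr)
    assume ne: "Im z \<noteq> 0"
    \<comment> \<open>At this time the argument of \<open>exp (t * z)\<close> is a right angle.\<close>
    define t where "t = pi / (2 * \<bar>Im z\<bar>)"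
    have t: "t \<ge> 0" by (simp add: t_def)
    have "t * Im z = pi / 2 \<or> t * Im z = - (pi / 2)" using ne
        by (cases "Im z > 0") (auto simp: t_def)
    hence "sin (t * Im z) = sin (pi / 2) \<or> sin (t * Im z) = sin (- (pi / 2))" by metis
    hence "sin (t * Im z) \<noteq> 0" unfolding sin_minus sin_pi_half by auto
    thus False using parts(2)[OF t] by (simp add: Im_exp)
  qed
  show ex: "expectation (\<lambda>\<omega>. cos (\<xi> \<bullet> X t \<omega>)) = exp (t * Re z)" if "t \<ge> 0" for t
    using parts(1)[OF that] im by (simp add: Re_exp)
  note measurable[of 1, simplified, measurable]
  have "expectation (\<lambda>\<omega>. cos (\<xi> \<bullet> X 1 \<omega>)) \<le> expectation (\<lambda>\<omega>. 1)"
    by (intro integral_mono integrable_const_bound[where B=1]) auto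
  hence "exp (Re z) \<le> 1" using ex[of 1] by (simp add: prob_space)
  thus "Re z \<le> 0" by simp
qed

text \<open>
  Replace the paths by zero on a null set outside of which they are cadlag and start at the origin. The
  finite-dimensional laws do not change.
\<close>

lemma cadlag_modification:
  fixes M :: "'w measure" and X :: "real \<Rightarrow> 'w \<Rightarrow> 'a::euclidean_space"
  assumes "symmetric_levy_process M X" and nu: "is_levy_measure_of \<nu> M X"
  obtains Y \<eta> where "cadlag_symmetric_levy M Y \<eta>" "AE \<omega> in M. \<forall>t. X t \<omega> = Y t \<omega>"
proof -
  interpret symmetric_levy_process M X by fact
  obtain b A where ch: "\<And>t \<xi>. t \<ge> 0 \<Longrightarrow> (CLINT \<omega>|M. iexp (\<xi> \<bullet> X t \<omega>))
      = exp (complex_of_real t * levy_exponent b A \<nu> \<xi>)"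
    using nu unfolding is_levy_measure_of_def by blast
  define \<eta> where "\<eta> \<xi> = - Re (levy_exponent b A \<nu> \<xi>)" for \<xi>
  have "AE \<omega> in M. cadlag (\<lambda>t. X t \<omega>) \<and> X 0 \<omega> = 0" using cadlag_paths start by eventually_elim auto
  then obtain N where N: "{\<omega> \<in> space M. \<not> (cadlag (\<lambda>t. X t \<omega>) \<and> X 0 \<omega> = 0)} \<subseteq> N" "N \<in> null_sets M"
    unfolding eventually_ae_filter by blast
  define Y where "Y t \<omega> = (if \<omega> \<in> space M - N then X t \<omega> else 0)" for t \<omega>
  have Ym: "Y t \<in> borel_measurable M" if "t \<ge> 0" for t
    unfolding Y_def using N(2) measurable[OF that] by (intro measurable_If_set) auto
  have eq: "AE \<omega> in M. \<forall>t. X t \<omega> = Y t \<omega>"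
    using AE_not_in[OF N(2)] AE_space by eventually_elim (auto simp: Y_def)
  have Xm: "X t \<in> borel_measurable M" if "t \<ge> 0" for t using measurable[OF that] .
  have "cadlag_symmetric_levy M Y \<eta>"
  proof unfold_locales
    show "Y t \<in> borel_measurable M" if "t \<ge> 0" for t by (rule Ym[OF that])
    show "Y 0 \<omega> = 0" for \<omega> using N(1) by (auto simp: Y_def)
    show "cadlag (\<lambda>t. Y t \<omega>)" for \<omega>
    proof (cases "\<omega> \<in> space M - N")
      case True
      thus ?thesis using N(1) by (auto simp: Y_def)
    next
      case False
      hence "(\<lambda>t. Y t \<omega>) = (\<lambda>t. 0)" by (auto simp: Y_def)
      thus ?thesis by (auto simp: cadlag_def)
    qed
    show "indep_vars (\<lambda>_. borel) (\<lambda>i \<omega>. Y (u (Suc i)) \<omega> - Y (u i) \<omega>) {..<n}"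
      if u: "0 \<le> u 0" "\<And>i. i < n \<Longrightarrow> u i < u (Suc i)" for u and n :: nat
    proof (rule indep_vars_AE_cong[OF independent_increments[OF u]])
      have u0: "0 \<le> u i" if "i \<le> n" for i
        using that
      proof (induction i)
        case (Suc i) thus ?case using u(2)[of i] by simp
      qed (use u in simp)
      show "random_variable borel (\<lambda>\<omega>. Y (u (Suc i)) \<omega> - Y (u i) \<omega>)" if "i < n" for i
        using Ym[OF u0[of "Suc i"]] Ym[OF u0[of i]] that by auto
      show "AE \<omega> in M. \<forall>i<n. X (u (Suc i)) \<omega> - X (u i) \<omega> = Y (u (Suc i)) \<omega> - Y (u i) \<omega>"
        using eq by eventually_elim auto
    qed auto
    show "distr M borel (\<lambda>\<omega>. Y (s + t) \<omega> - Y s \<omega>) = distr M borel (Y t)" if st: "0 \<le> s" "0 \<le> t"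
        for s t
    proof -
      have "distr M borel (\<lambda>\<omega>. Y (s + t) \<omega> - Y s \<omega>) = distr M borel (\<lambda>\<omega>. X (s + t) \<omega> - X s \<omega>)"
        using eq Ym Xm st by (intro distr_cong_AE) (auto elim!: eventually_mono)
      also have "\<dots> = distr M borel (X t)" by (rule stationary_increments[OF st])
      also have "\<dots> = distr M borel (Y t)"
        using eq Ym Xm st by (intro distr_cong_AE) (auto elim!: eventually_mono)
      finally show ?thesis .
    qed
    show "distr M borel (\<lambda>\<omega>. - Y t \<omega>) = distr M borel (Y t)" if t: "t \<ge> 0" for t
    proof -
      have "distr M borel (\<lambda>\<omega>. - Y t \<omega>) = distr M borel (\<lambda>\<omega>. - X t \<omega>)"
        using eq Ym[OF t] Xm[OF t] by (intro distr_cong_AE) (auto elim!: eventually_mono)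
      also have "\<dots> = distr M borel (X t)" by (rule symmetric[OF t])
      also have "\<dots> = distr M borel (Y t)"
        using eq Ym[OF t] Xm[OF t] by (intro distr_cong_AE) (auto elim!: eventually_mono)
      finally show ?thesis .
    qed
    show "0 \<le> \<eta> \<xi>" for \<xi> using characteristic_function_real(1)[OF ch] by (simp add: \<eta>_def)
    show "expectation (\<lambda>\<omega>. cos (\<xi> \<bullet> Y t \<omega>)) = exp (- t * \<eta> \<xi>)" if t: "t \<ge> 0" for t \<xi>
    proof -
      note Ym[OF t, measurable] Xm[OF t, measurable]
      have "expectation (\<lambda>\<omega>. cos (\<xi> \<bullet> Y t \<omega>)) = expectation (\<lambda>\<omega>. cos (\<xi> \<bullet> X t \<omega>))"
        using eq by (intro integral_cong_AE) (auto elim!: eventually_mono)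
      thus ?thesis using characteristic_function_real(2)[OF ch t] by (simp add: \<eta>_def)
    qed
  qed
  thus thesis using eq that by blast
qed

lemma killed_density_cong:
  assumes eq: "AE \<omega> in M. \<forall>t. X t \<omega> = Y t \<omega>"
  shows "killed_density M X p D t x y = killed_density M Y p D t x y"
  unfolding killed_density_def
  by (intro arg_cong2[where f="(-)"] refl integral_completion_cong_AE)
     (use eq in \<open>auto simp: Let_def elim!: eventually_mono\<close>)

section \<open>Intrinsic ultracontractivity\<close>

theorem theorem8:
  fixes M :: "'w measure"
    and X :: "real \<Rightarrow> 'w \<Rightarrow> 'a::euclidean_space"
    and \<nu> :: "'a measure"
    and p :: "real \<Rightarrow> 'a \<Rightarrow> real"
    and D :: "'a set"
    and pD :: "real \<Rightarrow> 'a \<Rightarrow> 'a \<Rightarrow> real"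
    and \<phi> :: "nat \<Rightarrow> 'a \<Rightarrow> real"
    and eig :: "nat \<Rightarrow> real"
  assumes "symmetric_levy_process M X"
    and "is_levy_measure_of \<nu> M X"
    and "emeasure \<nu> UNIV \<noteq> 0"
    and "continuous_transition_density M X p"
    and "\<And>\<delta>. \<delta> > 0 \<Longrightarrow> \<exists>c. \<forall>t>0. \<forall>z. norm z \<ge> \<delta> \<longrightarrow> p t z \<le> c"
    and "lipschitz_domain D"
    and "regular_killed_density M X p D pD"
    and "killed_eigenbasis D pD \<phi> eig"
    and "\<And>r \<gamma>. \<lbrakk>r > 0; 0 < \<gamma>; \<gamma> < pi\<rbrakk> \<Longrightarrow>
           \<exists>\<rho>>0. (INF (y, e)\<in>sphere 0 \<rho> \<times> sphere 0 1.
                    emeasure \<nu> (circular_cone \<gamma> y e \<inter> ball 0 r)) > 0"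
  shows "\<forall>t>0. \<exists>c. \<forall>x\<in>D. \<forall>y\<in>D. pD t x y \<le> c * \<phi> 0 x * \<phi> 0 y"
proof -
  obtain Y \<eta> where Y: "cadlag_symmetric_levy M Y \<eta>" and eq: "AE \<omega> in M. \<forall>t. X t \<omega> = Y t \<omega>"
    using cadlag_modification[OF assms(1,2)] .
  interpret X: symmetric_levy_process M X by (rule assms(1))
  interpret Y: cadlag_symmetric_levy M Y \<eta> by (rule Y)
  have sets_nu: "sets \<nu> = sets borel" and moment: "(\<integral>\<^sup>+z. ennreal (min 1 ((norm z)\<^sup>2)) \<partial>\<nu>) < \<infinity>"
    using assms(2) by (auto simp: is_levy_measure_of_def)
  obtain b A where lk: "linear A"
    "\<And>t \<xi>. t \<ge> 0 \<Longrightarrow> (CLINT \<omega>|M. iexp (\<xi> \<bullet> X t \<omega>)) = exp (complex_of_real t * levy_exponent b A \<nu> \<xi>)"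
    using assms(2) unfolding is_levy_measure_of_def by blast
  have lk': "(CLINT \<omega>|M. iexp (\<xi> \<bullet> Y t \<omega>)) = exp (complex_of_real t * levy_exponent b A \<nu> \<xi>)"
      if t: "t \<ge> 0" for t \<xi>
  proof -
    note X.measurable[OF t, measurable] Y.measurable_X[OF t, measurable]
    have "(CLINT \<omega>|M. iexp (\<xi> \<bullet> Y t \<omega>)) = (CLINT \<omega>|M. iexp (\<xi> \<bullet> X t \<omega>))"
      using eq by (intro integral_cong_AE) (auto elim!: eventually_mono)
    thus ?thesis using lk(2)[OF t] by simp
  qed
  have domain: "open D" "bounded D" "D \<noteq> {}" using assms(6) by (auto simp: lipschitz_domain_def)
  hence proper: "D \<noteq> UNIV" using not_bounded_UNIV[where 'a='a] by auto
  have density: "continuous_transition_density M Y p"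
    unfolding continuous_transition_density_def
  proof (intro allI impI conjI)
    fix t :: real assume t: "t > 0"
    have p: "\<forall>z. 0 \<le> p t z" "continuous_on UNIV (p t)"
        "distributed M lborel (X t) (\<lambda>z. ennreal (p t z))"
      using assms(4) t by (auto simp: continuous_transition_density_def)
    show "0 \<le> p t z" "continuous_on UNIV (p t)" for z using p by auto
    have "distr M lborel (Y t) = distr M lborel (X t)"
      using eq X.measurable[of t] Y.measurable_X[of t] t
          by (intro distr_cong_AE) (auto elim!: eventually_mono)
    thus "distributed M lborel (Y t) (\<lambda>z. ennreal (p t z))"
      using p(3) Y.measurable_X[of t] t by (auto simp: distributed_def)
  qed
  have regular: "regular_killed_density M Y p D pD"
    using assms(7) unfolding regular_killed_density_def killed_density_cong[OF eq] .
  interpret killed_levy_full M Y \<eta> \<nu> D p pD \<phi> eig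
  proof unfold_locales
    show "\<exists>b A. linear A \<and> (\<forall>t\<ge>0. \<forall>\<xi>. (CLINT \<omega>|M. iexp (\<xi> \<bullet> Y t \<omega>))
        = exp (complex_of_real t * levy_exponent b A \<nu> \<xi>))"
      using lk(1) lk' by blast
  qed (fact sets_nu moment domain proper density assms regular)+
  obtain \<epsilon> \<rho> c where jump: "0 < \<epsilon>" "0 < \<rho>" "0 < c"
    "\<And>y. y \<in> D \<Longrightarrow> depth y < \<rho> \<Longrightarrow> ennreal c < emeasure \<nu> {z. \<epsilon> < depth (y + z)}"
  proof (rule lipschitz_jump_target[OF assms(6,9) sets_nu])
    fix \<epsilon> \<rho> c
    assume "0 < \<epsilon>" "0 < \<rho>" "0 < c"
      "\<And>y. y \<in> D \<Longrightarrow> depth y < \<rho> \<Longrightarrow> ennreal c < emeasure \<nu> {z. \<epsilon> < depth (y + z)}"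
    thus thesis by (rule that)
  qed
  show ?thesis using intrinsically_ultracontractive[OF jump(1-3) domain(3) jump(4)] by blast
qed

end
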